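(* Let $p(y^N|x^N)$ be an $N$-node discrete memoryless unicast relay network with source node $1$ and destination node $N$ (i.e. destination set $\mathcal{D}=\{N\}$), and let $C$ be its capacity. Then $$C \ge \max_{p(x^N,u_2^N,q)}\ \min_{\substack{\mathcal{S}\subseteq[1:N]:\\ 1\in\mathcal{S},\,N\in\mathcal{S}^c}} \Bigl\{ I(X(\mathcal{S});U(\mathcal{S}^c),Y_N\,|\,X(\mathcal{S}^c),Q) - \sum_{k\in\mathcal{S}^c}\bigl[ I(U_k;U(\mathcal{S}_k^c),X^N\,|\,X_k,Y_k,Q)+I(X_k;X(\mathcal{S}_k^c)\,|\,Q)\bigr]\Bigr\}.$$
   Context: Notation. $[1:N]=\{1,\dots,N\}$; $X^N=(X_1,\dots,X_N)$, $U_2^N=(U_2,\dots,U_N)$, $X(\mathcal{A})=(X_k:k\in\mathcal{A})$; complements are taken in $[1:N]$; for $\mathcal{S}\subseteq[1:N]$, $\mathcal{S}_k^c=\mathcal{S}^c\cap[1:k-1]$. Logarithms are to base 2, and $[1:2^{nR}]$ denotes $\{1,\dots,2^{\lceil nR\rceil}\}$. Network. An $N$-node discrete memoryless network has finite alphabets $\mathcal{X}_k,\mathcal{Y}_k$, $k\in[1:N]$, and a conditional pmf $p(y^N|x^N)$; at each time $i$, given the message, all past inputs and outputs and the current inputs $x_{1i},\dots,x_{Ni}$, the outputs $(Y_{1i},\dots,Y_{Ni})$ are distributed according to $p(y^N|x^N)$. Code. A $(2^{nR},n)$ code for the unicast relay network consists of a message set $[1:2^{nR}]$, a source encoder assigning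 a symbol $x_{1i}(m,y_1^{i-1})$ to each message $m$ and $y_1^{i-1}\in\mathcal{Y}_1^{i-1}$ for $i\in[1:n]$, relay encoders $k\in[2:N]$ assigning $x_{ki}(y_k^{i-1})$ to each $y_k^{i-1}$ for $i\in[1:n]$, and a decoder at node $N$ assigning an estimate $\hat m$ (or an error message) to each $y_N^n$. The message $M$ is uniform on the message set and the probability of error is $P_e^{(n)}=\mathsf{P}\{\hat M\ne M\}$. A rate $R\ge 0$ is achievable if there is a sequence of $(2^{nR},n)$ codes with $P_e^{(n)}\to 0$ as $n\to\infty$; the capacity $C$ is the supremum of achievable rates. Maximization. The maximum (understood as a supremum) is over all joint pmfs $p(x^N,u_2^N,q)$, where $X_k\in\mathcal{X}_k$ and the auxiliary random variables $U_2,\dots,U_N,Q$ have arbitrary finite alphabets; the information quantities are computed under $p(x^N,u_2^N,q)\,p(y^N|x^N)$, so $(U_2^N,Q)\to X^N\to Y^N$ is a Markov chain. *)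

theory Defs
  imports "HOL-Probability.Probability"
begin

text \<open>
  The sample space is the support of the pmf, finite in all uses below, so that every random
  variable on it is a simple function.  \<open>cond_mutual_info\<close> is then the library notation
  \<open>\<I>(X ; Y | Z)\<close> of \<open>information_space\<close>, taken to base 2.
\<close>

definition pmf_space :: "'a pmf \<Rightarrow> 'a measure" where
  "pmf_space p = restrict_space (measure_pmf p) (set_pmf p)"

definition cond_mutual_info ::
    "'a pmf \<Rightarrow> ('a \<Rightarrow> 'b) \<Rightarrow> ('a \<Rightarrow> 'c) \<Rightarrow> ('a \<Rightarrow> 'd) \<Rightarrow> real" where
  "cond_mutual_info p X Y Z =
     prob_space.conditional_mutual_information (pmf_space p) 2
       (count_space (X ` space (pmf_space p)))
       (count_space (Y ` space (pmf_space p)))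
       (count_space (Z ` space (pmf_space p))) X Y Z"

lemma space_pmf_space [simp]: "space (pmf_space p) = set_pmf p"
  by (simp add: pmf_space_def space_restrict_space)

lemma information_space_pmf_space: "information_space (pmf_space p) 2"
proof -
  have "prob_space (pmf_space p)"
    unfolding pmf_space_def by (rule prob_space_restrict_space) (auto simp: emeasure_pmf)
  thus ?thesis
    by (simp add: information_space_def information_space_axioms_def)
qed

lemma simple_distributed_pmf_space:
  assumes "finite (set_pmf p)"
  shows "simple_distributed (pmf_space p) X (pmf (map_pmf X p))"
proof -
  interpret information_space "pmf_space p" 2 by (rule information_space_pmf_space)
  show ?thesis
  proof (rule simple_distributedI)
    show "simple_function (pmf_space p) X"
      using assms by (auto simp: simple_function_def pmf_space_def sets_restrict_space)
    fix x
    have "measure (pmf_space p) (X -` {x} \<inter> set_pmf p) = measure p (X -` {x} \<inter> set_pmf p)"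
      unfolding pmf_space_def by (rule measure_restrict_space) auto
    also have "\<dots> = pmf (map_pmf X p) x"
      by (simp add: pmf_map measure_Int_set_pmf)
    finally show "pmf (map_pmf X p) x = measure (pmf_space p) (X -` {x} \<inter> space (pmf_space p))"
      by simp
  qed simp
qed

lemma cond_mutual_info_eq:
  fixes p :: "'a pmf" and X :: "'a \<Rightarrow> 'b" and Y :: "'a \<Rightarrow> 'c" and Z :: "'a \<Rightarrow> 'd"
  assumes "finite (set_pmf p)"
  defines "Pxyz \<equiv> pmf (map_pmf (\<lambda>w. (X w, Y w, Z w)) p)"
    and "Pxz \<equiv> pmf (map_pmf (\<lambda>w. (X w, Z w)) p)"
    and "Pyz \<equiv> pmf (map_pmf (\<lambda>w. (Y w, Z w)) p)"
    and "Pz \<equiv> pmf (map_pmf Z p)"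
  shows "cond_mutual_info p X Y Z =
    (\<Sum>(x, y, z) \<in> (\<lambda>w. (X w, Y w, Z w)) ` set_pmf p.
       Pxyz (x, y, z) * log 2 (Pxyz (x, y, z) / (Pxz (x, z) * (Pyz (y, z) / Pz z))))"
proof -
  interpret information_space "pmf_space p" 2 by (rule information_space_pmf_space)
  show ?thesis
    unfolding cond_mutual_info_def Pxyz_def Pxz_def Pyz_def Pz_def
    using conditional_mutual_information_eq
      [OF simple_distributed_pmf_space[OF assms(1)] simple_distributed_pmf_space[OF assms(1)]
          simple_distributed_pmf_space[OF assms(1)] simple_distributed_pmf_space[OF assms(1)],
       of X Y Z]
    by (simp only: space_pmf_space)
qed

text \<open>
  The alphabets of the nodes \<open>1, \<dots>, N\<close> are finite subsets \<open>\<X> k\<close>, \<open>\<Y> k\<close> of two types, and tuples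
  \<open>x\<^sup>N\<close>, \<open>y\<^sup>N\<close> are elements of the products \<open>PiE {1..N} \<X>\<close>, \<open>PiE {1..N} \<Y>\<close>.  The values of the
  channel \<open>W\<close> outside \<open>PiE {1..N} \<X>\<close> are irrelevant.
\<close>

definition dm_network ::
    "nat \<Rightarrow> (nat \<Rightarrow> 'x set) \<Rightarrow> (nat \<Rightarrow> 'y set) \<Rightarrow> ((nat \<Rightarrow> 'x) \<Rightarrow> (nat \<Rightarrow> 'y) pmf) \<Rightarrow> bool" where
  "dm_network N \<X> \<Y> W \<longleftrightarrow>
     (\<forall>k\<in>{1..N}. finite (\<X> k) \<and> \<X> k \<noteq> {} \<and> finite (\<Y> k) \<and> \<Y> k \<noteq> {}) \<and>
     (\<forall>x \<in> PiE {1..N} \<X>. set_pmf (W x) \<subseteq> PiE {1..N} \<Y>)"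

definition messages :: "real \<Rightarrow> nat \<Rightarrow> nat set" where
  "messages R n = {1..2 ^ nat \<lceil>real n * R\<rceil>}"

text \<open>
  An encoder is applied at time \<open>i\<close> to the list \<open>y\<^sup>i\<^sup>-\<^sup>1\<close> of past outputs, oldest first; the time is
  determined by the length of that list.  The decoder result \<open>None\<close> is the error message.
\<close>

record ('x, 'y) relay_code =
  source_enc :: "nat \<Rightarrow> 'y list \<Rightarrow> 'x"
  relay_enc :: "nat \<Rightarrow> 'y list \<Rightarrow> 'x"
  decoder :: "'y list \<Rightarrow> nat option"

definition is_code ::
    "nat \<Rightarrow> (nat \<Rightarrow> 'x set) \<Rightarrow> (nat \<Rightarrow> 'y set) \<Rightarrow> real \<Rightarrow> nat \<Rightarrow> ('x, 'y) relay_code \<Rightarrow> bool" where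
  "is_code N \<X> \<Y> R n c \<longleftrightarrow>
     (\<forall>m \<in> messages R n. \<forall>ys \<in> lists (\<Y> 1). length ys < n \<longrightarrow> source_enc c m ys \<in> \<X> 1) \<and>
     (\<forall>k \<in> {2..N}. \<forall>ys \<in> lists (\<Y> k). length ys < n \<longrightarrow> relay_enc c k ys \<in> \<X> k) \<and>
     (\<forall>ys \<in> lists (\<Y> N). length ys = n \<longrightarrow> decoder c ys \<in> insert None (Some ` messages R n))"

definition channel_input ::
    "nat \<Rightarrow> ('x, 'y) relay_code \<Rightarrow> nat \<Rightarrow> (nat \<Rightarrow> 'y) list \<Rightarrow> nat \<Rightarrow> 'x" where
  "channel_input N c m h =
     (\<lambda>k\<in>{1..N}. let ys = map (\<lambda>y. y k) h in if k = 1 then source_enc c m ys else relay_enc c k ys)"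

primrec outputs ::
    "nat \<Rightarrow> ((nat \<Rightarrow> 'x) \<Rightarrow> (nat \<Rightarrow> 'y) pmf) \<Rightarrow> ('x, 'y) relay_code \<Rightarrow> nat \<Rightarrow> nat \<Rightarrow>
     (nat \<Rightarrow> 'y) list pmf" where
  "outputs N W c m 0 = return_pmf []"
| "outputs N W c m (Suc i) =
     bind_pmf (outputs N W c m i)
       (\<lambda>h. map_pmf (\<lambda>y. h @ [y]) (W (channel_input N c m h)))"

definition message_estimate ::
    "nat \<Rightarrow> ((nat \<Rightarrow> 'x) \<Rightarrow> (nat \<Rightarrow> 'y) pmf) \<Rightarrow> real \<Rightarrow> nat \<Rightarrow> ('x, 'y) relay_code \<Rightarrow>
     (nat \<times> nat option) pmf" where
  "message_estimate N W R n c =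
     bind_pmf (pmf_of_set (messages R n))
       (\<lambda>m. map_pmf (\<lambda>h. (m, decoder c (map (\<lambda>y. y N) h))) (outputs N W c m n))"

definition error_prob ::
    "nat \<Rightarrow> ((nat \<Rightarrow> 'x) \<Rightarrow> (nat \<Rightarrow> 'y) pmf) \<Rightarrow> real \<Rightarrow> nat \<Rightarrow> ('x, 'y) relay_code \<Rightarrow> real" where
  "error_prob N W R n c =
     measure_pmf.prob (message_estimate N W R n c) {(m, m'). m' \<noteq> Some m}"

definition achievable ::
    "nat \<Rightarrow> (nat \<Rightarrow> 'x set) \<Rightarrow> (nat \<Rightarrow> 'y set) \<Rightarrow> ((nat \<Rightarrow> 'x) \<Rightarrow> (nat \<Rightarrow> 'y) pmf) \<Rightarrow> real \<Rightarrow> bool" where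
  "achievable N \<X> \<Y> W R \<longleftrightarrow>
     0 \<le> R \<and>
     (\<exists>c. (\<forall>n. is_code N \<X> \<Y> R n (c n)) \<and> (\<lambda>n. error_prob N W R n (c n)) \<longlonglongrightarrow> 0)"

definition capacity ::
    "nat \<Rightarrow> (nat \<Rightarrow> 'x set) \<Rightarrow> (nat \<Rightarrow> 'y set) \<Rightarrow> ((nat \<Rightarrow> 'x) \<Rightarrow> (nat \<Rightarrow> 'y) pmf) \<Rightarrow> ereal" where
  "capacity N \<X> \<Y> W = (SUP R \<in> {R. achievable N \<X> \<Y> W R}. ereal R)"

text \<open>
  Joint pmfs \<open>p(x\<^sup>N, u\<^sub>2\<^sup>N, q)\<close>.  Arbitrary finite auxiliary alphabets are represented, up to
  relabelling, by finite sets of natural numbers.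
\<close>

definition input_pmfs ::
    "nat \<Rightarrow> (nat \<Rightarrow> 'x set) \<Rightarrow> ((nat \<Rightarrow> 'x) \<times> (nat \<Rightarrow> nat) \<times> nat) pmf set" where
  "input_pmfs N \<X> =
     {p. \<exists>\<U> \<Q>. (\<forall>k\<in>{2..N}. finite (\<U> k)) \<and> finite \<Q> \<and>
            set_pmf p \<subseteq> PiE {1..N} \<X> \<times> PiE {2..N} \<U> \<times> \<Q>}"

definition joint_pmf ::
    "((nat \<Rightarrow> 'x) \<Rightarrow> (nat \<Rightarrow> 'y) pmf) \<Rightarrow> ((nat \<Rightarrow> 'x) \<times> (nat \<Rightarrow> nat) \<times> nat) pmf \<Rightarrow>
     ((nat \<Rightarrow> 'x) \<times> (nat \<Rightarrow> nat) \<times> nat \<times> (nat \<Rightarrow> 'y)) pmf" where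
  "joint_pmf W p = bind_pmf p (\<lambda>(x, u, q). map_pmf (\<lambda>y. (x, u, q, y)) (W x))"

definition cuts :: "nat \<Rightarrow> nat set set" where
  "cuts N = {S. S \<subseteq> {1..N} \<and> 1 \<in> S \<and> N \<in> {1..N} - S}"

definition ddf_bound ::
    "nat \<Rightarrow> ((nat \<Rightarrow> 'x) \<Rightarrow> (nat \<Rightarrow> 'y) pmf) \<Rightarrow> ((nat \<Rightarrow> 'x) \<times> (nat \<Rightarrow> nat) \<times> nat) pmf \<Rightarrow>
     nat set \<Rightarrow> real" where
  "ddf_bound N W p S =
     (let r = joint_pmf W p;
          Sc = {1..N} - S;
          Sck = (\<lambda>k. Sc \<inter> {1..k - 1})
      in cond_mutual_info r
           (\<lambda>(x, u, q, y). restrict x S)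
           (\<lambda>(x, u, q, y). (restrict u Sc, y N))
           (\<lambda>(x, u, q, y). (restrict x Sc, q))
         - (\<Sum>k\<in>Sc.
              cond_mutual_info r
                (\<lambda>(x, u, q, y). u k)
                (\<lambda>(x, u, q, y). (restrict u (Sck k), x))
                (\<lambda>(x, u, q, y). (x k, y k, q))
              + cond_mutual_info r
                  (\<lambda>(x, u, q, y). x k)
                  (\<lambda>(x, u, q, y). restrict x (Sck k))
                  (\<lambda>(x, u, q, y). q)))"

end

theory Submission
  imports Defs
begin

text \<open>
  Fix auxiliary codewords \<open>u\<^sub>k(b\<^sub>k|a\<^sub>k)\<close> and inputs \<open>x\<^sub>k(a\<^sub>k)\<close> for each block, where \<open>a\<close> and \<open>b\<close>
  are the index vectors at the beginning and at the end of the block: relay \<open>k\<close>, knowing \<open>a\<^sub>k\<close>,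
  decodes \<open>b\<^sub>k\<close> from its observation, and the destination, knowing its own indices, recovers
  \<open>a\<close> from \<open>b\<close> by backward decoding.

  The messages are trajectories of index vectors with fixed end points.  No covering lemma is
  needed: it suffices that \<^emph>\<open>some\<close> code book has many trajectories with small error probability,
  which follows from a first-moment computation in which every trajectory is weighted by the
  likelihood ratio between the target law \<open>p\<close> and the law of independently drawn codewords.
  Under this weight the chosen codewords have law \<open>p\<close> while all other codewords stay
  independent, so that the usual packing bounds apply; the weight is at most \<open>2\<^bsup>n(D+\<delta>)\<^esup>\<close> by the
  law of large numbers, which bounds the number of good trajectories from below.

  The codewords \<open>x\<^sub>1\<close> and \<open>u\<^sub>k\<close> are drawn uniformly from a set of \<open>K\<close> symbols.  Decoding rates and
  loss \<open>D\<close> grow by \<open>log K\<close> per component and cancel in the final rate, and a large \<open>K\<close> makes all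
  index rates positive.
\<close>

section \<open>Finitely supported pmfs\<close>

text \<open>The rates are means of log-likelihood ratios. If \<open>relay_info k\<close> has mean
  m_k and \<open>dest_info S\<close> has mean D_S, then relay index k may carry exponent m_k, and
  index 1, which no relay sees, the minimum r of D_S - sum of m_k over k in S. Per block the
  trajectories number about 2 to the n (r + sum of all m_k), and at least a fraction of about 2 to
  the -n D survives. At the minimising S the exponent left is D_S + sum of m_k over k outside S - D,
  which entropy bookkeeping turns into \<open>ddf_bound\<close> at the cut formed by 1 and S. The
  fixed end points start the forward decoding of the relays and the backward decoding of the
  destination; they cost one of B blocks, whence large B. The obstacle is feedback: relay inputs
  depend on past outputs, so blocks are not independent. But on outputs where every block decodes
  correctly the encoders send a predetermined sequence, so this event has the probability computed
  for the memoryless channel with fixed inputs. Survival is decided trajectory by trajectory, so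
  every message has small error, not only the average one.\<close>

lemma expectation_finite_sum:
  fixes f :: "'a \<Rightarrow> real"
  assumes "finite (set_pmf p)"
  shows "measure_pmf.expectation p f = (\<Sum>x\<in>set_pmf p. pmf p x * f x)"
  using integral_measure_pmf_real[OF assms, of p f] by (simp add: mult.commute)

lemma expectation_mono_finite:
  fixes f g :: "'a \<Rightarrow> real"
  assumes "finite (set_pmf p)" "\<And>x. x \<in> set_pmf p \<Longrightarrow> f x \<le> g x"
  shows "measure_pmf.expectation p f \<le> measure_pmf.expectation p g"
  unfolding expectation_finite_sum[OF assms(1)] by (intro sum_mono mult_left_mono assms) auto

lemma expectation_cong_finite:
  fixes f g :: "'a \<Rightarrow> real"
  assumes "finite (set_pmf p)" "\<And>x. x \<in> set_pmf p \<Longrightarrow> f x = g x"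
  shows "measure_pmf.expectation p f = measure_pmf.expectation p g"
  unfolding expectation_finite_sum[OF assms(1)] by (intro sum.cong) (use assms in auto)

lemma expectation_bind_finite:
  fixes h :: "'b \<Rightarrow> real"
  assumes "finite (set_pmf p)" "\<And>x. x \<in> set_pmf p \<Longrightarrow> finite (set_pmf (f x))"
  shows "measure_pmf.expectation (bind_pmf p f) h =
    measure_pmf.expectation p (\<lambda>x. measure_pmf.expectation (f x) h)"
  using pmf_expectation_bind[OF assms(1), of f p h] assms by (simp add: expectation_finite_sum)

lemma expectation_pair_finite:
  fixes h :: "'a \<times> 'b \<Rightarrow> real"
  assumes "finite (set_pmf p)" "finite (set_pmf q)"
  shows "measure_pmf.expectation (pair_pmf p q) h =
    measure_pmf.expectation p (\<lambda>x. measure_pmf.expectation q (\<lambda>y. h (x, y)))"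
proof -
  have "pair_pmf p q = bind_pmf p (\<lambda>x. map_pmf (Pair x) q)"
    by (simp add: pair_pmf_def map_pmf_def)
  thus ?thesis using assms by (simp add: expectation_bind_finite)
qed

lemma expectation_sum_finite:
  fixes f :: "'i \<Rightarrow> 'a \<Rightarrow> real"
  assumes "finite (set_pmf p)"
  shows "measure_pmf.expectation p (\<lambda>x. \<Sum>i\<in>I. f i x) = (\<Sum>i\<in>I. measure_pmf.expectation p (f i))"
  by (rule Bochner_Integration.integral_sum) (use assms in \<open>auto intro: integrable_measure_pmf_finite\<close>)

lemma expectation_add_finite:
  fixes f g :: "'a \<Rightarrow> real"
  assumes "finite (set_pmf p)"
  shows "measure_pmf.expectation p (\<lambda>x. f x + g x) =
    measure_pmf.expectation p f + measure_pmf.expectation p g"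
  by (rule Bochner_Integration.integral_add) (use assms in \<open>auto intro: integrable_measure_pmf_finite\<close>)

lemma expectation_diff_finite:
  fixes f g :: "'a \<Rightarrow> real"
  assumes "finite (set_pmf p)"
  shows "measure_pmf.expectation p (\<lambda>x. f x - g x) =
    measure_pmf.expectation p f - measure_pmf.expectation p g"
  by (rule Bochner_Integration.integral_diff) (use assms in \<open>auto intro: integrable_measure_pmf_finite\<close>)

lemma expectation_commute_finite:
  fixes f :: "'a \<Rightarrow> 'b \<Rightarrow> real"
  assumes "finite (set_pmf p)" "finite (set_pmf q)"
  shows "measure_pmf.expectation p (\<lambda>x. measure_pmf.expectation q (f x)) =
    measure_pmf.expectation q (\<lambda>y. measure_pmf.expectation p (\<lambda>x. f x y))"
  unfolding expectation_finite_sum[OF assms(1)] expectation_finite_sum[OF assms(2)]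
  by (simp add: sum_distrib_left mult_ac sum.swap[of _ "set_pmf p"])

lemma expectation_nonneg:
  fixes f :: "'a \<Rightarrow> real"
  shows "(\<And>x. 0 \<le> f x) \<Longrightarrow> 0 \<le> measure_pmf.expectation p f"
  by (rule Bochner_Integration.integral_nonneg_AE) simp

lemma prob_eq_expectation:
  "measure_pmf.prob p {x. Q x} = measure_pmf.expectation p (\<lambda>x. of_bool (Q x))"
proof -
  have "(\<lambda>x. of_bool (Q x) :: real) = indicator {x. Q x}" by (auto simp: indicator_def)
  thus ?thesis by simp
qed

text \<open>Change of measure. The inclusion of supports keeps mass of \<open>P\<close> from sitting
  where the quotient is a division by zero.\<close>

lemma expectation_density_ratio:
  fixes f :: "'a \<Rightarrow> real"
  assumes "finite (set_pmf Q)" "set_pmf P \<subseteq> set_pmf Q"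
  shows "measure_pmf.expectation Q (\<lambda>z. pmf P z / pmf Q z * f z) = measure_pmf.expectation P f"
proof -
  have "measure_pmf.expectation Q (\<lambda>z. pmf P z / pmf Q z * f z) = (\<Sum>z\<in>set_pmf Q. pmf P z * f z)"
    unfolding expectation_finite_sum[OF assms(1)]
    by (intro sum.cong) (auto simp: set_pmf_eq)
  also have "\<dots> = (\<Sum>z\<in>set_pmf P. pmf P z * f z)"
    by (rule sum.mono_neutral_right) (use assms in \<open>auto simp: set_pmf_eq\<close>)
  finally show ?thesis using finite_subset[OF assms(2,1)] by (simp only: expectation_finite_sum)
qed

section \<open>Products of pmfs read at chosen coordinates\<close>

lemma finite_set_Pi_pmf:
  assumes "finite A" "\<And>x. x \<in> A \<Longrightarrow> finite (set_pmf (p x))"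
  shows "finite (set_pmf (Pi_pmf A d p))"
  using assms by (auto simp: set_Pi_pmf intro: finite_PiE_dflt)

text \<open>The independence behind random coding: \<open>h\<close> will point to the codewords of
  the true indices and \<open>h'\<close> to those of a competitor. Both are read off the same book,
  but at distinct coordinates.\<close>

lemma Pi_pmf_two_views:
  fixes h :: "'a \<Rightarrow> 'k" and h' :: "'b \<Rightarrow> 'k" and p :: "'k \<Rightarrow> 'c pmf"
  assumes K: "finite K" and A: "h ` A \<subseteq> K" "inj_on h A" and S: "h' ` S \<subseteq> K" "inj_on h' S"
    and disj: "h ` A \<inter> h' ` S = {}"
  shows "map_pmf (\<lambda>C. (\<lambda>c\<in>A. C (h c), \<lambda>c\<in>S. C (h' c))) (Pi_pmf K d p) =
    pair_pmf (Pi_pmf A undefined (\<lambda>c. p (h c))) (Pi_pmf S undefined (\<lambda>c. p (h' c)))"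
proof (rule pmf_eqI)
  fix fg :: "('a \<Rightarrow> 'c) \<times> ('b \<Rightarrow> 'c)"
  obtain f g where fg: "fg = (f, g)" by (rule prod.exhaust)
  have fA: "finite A" and fS: "finite S"
    using K A S by (auto dest!: finite_subset simp: finite_image_iff)
  define P :: "('k \<Rightarrow> 'c) \<Rightarrow> _" where "P = (\<lambda>C. (\<lambda>c\<in>A. C (h c), \<lambda>c\<in>S. C (h' c)))"
  show "pmf (map_pmf P (Pi_pmf K d p)) fg =
     pmf (pair_pmf (Pi_pmf A undefined (\<lambda>c. p (h c))) (Pi_pmf S undefined (\<lambda>c. p (h' c)))) fg"
  proof (cases "f \<in> extensional A \<and> g \<in> extensional S")
    case False
    hence "P -` {fg} = {}" by (auto simp: P_def fg)
    moreover from False have "pmf (Pi_pmf A undefined (\<lambda>c. p (h c))) f = 0 \<or>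
        pmf (Pi_pmf S undefined (\<lambda>c. p (h' c))) g = 0"
      by (auto simp: extensional_def pmf_Pi fA fS)
    ultimately show ?thesis by (auto simp: pmf_map fg pmf_pair)
  next
    case True
    \<comment> \<open>The preimage of \<open>(f, g)\<close> is a box: coordinates that are read are
      pinned, the others are free and contribute a factor one.\<close>
    define B where "B = (\<lambda>y. if y \<in> h ` A then {f (inv_into A h y)}
       else if y \<in> h' ` S then {g (inv_into S h' y)} else UNIV)"
    have B1: "B (h c) = {f c}" if "c \<in> A" for c using that A by (auto simp: B_def)
    have B2: "B (h' c) = {g c}" if "c \<in> S" for c
      using that S disj by (auto simp: B_def)
    have "P -` {fg} = Pi K B"
    proof (rule set_eqI)
      fix C
      have "C \<in> Pi K B \<longleftrightarrow> (\<forall>c\<in>A. C (h c) = f c) \<and> (\<forall>c\<in>S. C (h' c) = g c)"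
      proof
        assume "C \<in> Pi K B"
        thus "(\<forall>c\<in>A. C (h c) = f c) \<and> (\<forall>c\<in>S. C (h' c) = g c)"
          using A S B1 B2 by (metis Pi_mem image_subset_iff singletonD)
      next
        assume *: "(\<forall>c\<in>A. C (h c) = f c) \<and> (\<forall>c\<in>S. C (h' c) = g c)"
        show "C \<in> Pi K B"
        proof
          fix y assume "y \<in> K"
          show "C y \<in> B y"
          proof -
            consider c where "c \<in> A" "y = h c" | c where "c \<in> S" "y = h' c"
              | "y \<notin> h ` A" "y \<notin> h' ` S" by blast
            thus ?thesis using * B1 B2 by cases (simp_all, simp add: B_def)
          qed
        qed
      qed
      moreover have "C \<in> P -` {fg} \<longleftrightarrow> (\<forall>c\<in>A. C (h c) = f c) \<and> (\<forall>c\<in>S. C (h' c) = g c)"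
        using True by (auto simp: P_def fg fun_eq_iff extensional_def restrict_def)
      ultimately show "C \<in> P -` {fg} \<longleftrightarrow> C \<in> Pi K B" by simp
    qed
    hence "pmf (map_pmf P (Pi_pmf K d p)) fg = (\<Prod>y\<in>K. measure_pmf.prob (p y) (B y))"
      using K by (simp add: pmf_map measure_Pi_pmf_Pi)
    also have "\<dots> = (\<Prod>y\<in>h ` A \<union> h' ` S. measure_pmf.prob (p y) (B y))"
      by (rule prod.mono_neutral_right) (use K A S in \<open>auto simp: B_def\<close>)
    also have "\<dots> = (\<Prod>y\<in>h ` A. measure_pmf.prob (p y) (B y)) * (\<Prod>y\<in>h' ` S. measure_pmf.prob (p y) (B y))"
      by (rule prod.union_disjoint) (use disj fA fS in auto)
    also have "(\<Prod>y\<in>h ` A. measure_pmf.prob (p y) (B y)) = (\<Prod>c\<in>A. pmf (p (h c)) (f c))"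
      by (subst prod.reindex[OF A(2)]) (auto simp: B1 measure_pmf_single intro!: prod.cong)
    also have "(\<Prod>y\<in>h' ` S. measure_pmf.prob (p y) (B y)) = (\<Prod>c\<in>S. pmf (p (h' c)) (g c))"
      by (subst prod.reindex[OF S(2)]) (auto simp: B2 measure_pmf_single intro!: prod.cong)
    finally show ?thesis
      using True by (simp add: fg pmf_pair pmf_Pi fA fS extensional_def)
  qed
qed

lemma Pi_pmf_reindex:
  assumes "finite K" "h ` A \<subseteq> K" "inj_on h A"
  shows "map_pmf (\<lambda>C. \<lambda>c\<in>A. C (h c)) (Pi_pmf K d p) = Pi_pmf A undefined (\<lambda>c. p (h c))"
proof -
  have "map_pmf (\<lambda>C. \<lambda>c\<in>A. C (h c)) (Pi_pmf K d p) =
    map_pmf fst (map_pmf (\<lambda>C. (\<lambda>c\<in>A. C (h c), \<lambda>c\<in>{}. C (h c))) (Pi_pmf K d p))"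
    by (simp add: map_pmf_comp)
  also have "\<dots> = Pi_pmf A undefined (\<lambda>c. p (h c))"
    by (subst Pi_pmf_two_views) (use assms in \<open>auto simp: map_fst_pair_pmf\<close>)
  finally show ?thesis .
qed

lemma ex_ge_expectation:
  fixes f :: "'a \<Rightarrow> real"
  assumes "finite (set_pmf p)"
  shows "\<exists>x\<in>set_pmf p. measure_pmf.expectation p f \<le> f x"
proof (rule ccontr)
  assume "\<not> ?thesis"
  hence *: "\<And>x. x \<in> set_pmf p \<Longrightarrow> f x < measure_pmf.expectation p f" by force
  let ?M = "Max (f ` set_pmf p)"
  have "measure_pmf.expectation p f \<le> measure_pmf.expectation p (\<lambda>_. ?M)"
    by (rule expectation_mono_finite) (use assms in auto)
  moreover have "?M \<in> f ` set_pmf p" using assms by (intro Max_in) (auto simp: set_pmf_not_empty)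
  ultimately show False using * by force
qed

lemma expectation_prod_Pi_finite:
  fixes f :: "'i \<Rightarrow> 'a \<Rightarrow> real"
  assumes "finite A" "finite (set_pmf p)" "\<And>i x. 0 \<le> f i x"
  shows "measure_pmf.expectation (Pi_pmf A d (\<lambda>_. p)) (\<lambda>C. \<Prod>i\<in>A. f i (C i)) =
    (\<Prod>i\<in>A. measure_pmf.expectation p (f i))"
  by (rule expectation_prod_Pi_pmf) (use assms in \<open>auto intro: integrable_measure_pmf_finite\<close>)

section \<open>Random coding in one block\<close>

text \<open>\<open>N + 1\<close> is skipped because there is no \<open>u_1\<close>.\<close>

definition comps :: "nat \<Rightarrow> nat set" where
  "comps N = {1..N} \<union> {N + 2..2 * N}"

text \<open>
  Component \<open>k \<le> N\<close> stands for the codeword \<open>x\<^sub>k\<close> and component \<open>N + k\<close> for the codeword \<open>u\<^sub>k\<close>.  In a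
  block with index vectors \<open>a\<close> (old) and \<open>b\<close> (new), the codewords are \<open>x\<^sub>1(a)\<close>, \<open>x\<^sub>k(a\<^sub>k)\<close> and
  \<open>u\<^sub>k(b\<^sub>k|a\<^sub>k)\<close>; the entry \<open>a\<^sub>1\<close> is not known to any relay.
\<close>

definition key :: "nat \<Rightarrow> (nat \<Rightarrow> nat) \<Rightarrow> (nat \<Rightarrow> nat) \<Rightarrow> nat \<Rightarrow> nat \<times> nat list" where
  "key N a b c = (c, if c \<le> 1 then map a [1..<N+1] else if c \<le> N then [a c] else [a (c - N), b (c - N)])"

lemma fst_key [simp]: "fst (key N a b c) = c" by (simp add: key_def)

lemma inj_key: "inj_on (key N a b) A" by (auto simp: inj_on_def key_def)

lemma finite_comps [simp]: "finite (comps N)" by (simp add: comps_def)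

text \<open>The codewords that change when the old vector is wrong exactly on \<open>S\<close>,
  apart from the entry 1. Component 1 is always among them, since \<open>x_1\<close> is keyed by the
  whole vector \<open>a\<close>; \<open>x_k\<close> and \<open>u_k\<close> are both keyed by
  \<open>a k\<close> and so change together.\<close>

definition wrong_comps :: "nat \<Rightarrow> nat set \<Rightarrow> nat set" where
  "wrong_comps N S = insert 1 (S \<union> (+) N ` S)"

lemma wrong_comps_subset: "S \<subseteq> {2..<N} \<Longrightarrow> 2 \<le> N \<Longrightarrow> wrong_comps N S \<subseteq> comps N"
  by (auto simp: wrong_comps_def comps_def)

text \<open>A one-shot setting: \<open>'e\<close> is the type of entire codewords, and the tests
  \<open>acc\<close> and \<open>accd\<close> are arbitrary. Letters and thresholds enter only when
  the locale is interpreted.\<close>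

locale block_code =
  fixes N :: nat and L :: "nat \<Rightarrow> nat" and \<rho> :: "nat \<Rightarrow> 'e pmf" and P :: "(nat \<Rightarrow> 'e) pmf"
    and Wb :: "(nat \<Rightarrow> 'e) \<Rightarrow> 'o pmf" and Yk :: "nat \<Rightarrow> 'o \<Rightarrow> 'v"
    and acc :: "nat \<Rightarrow> 'e \<Rightarrow> 'e \<Rightarrow> 'v \<Rightarrow> bool" and accd :: "(nat \<Rightarrow> 'e) \<Rightarrow> 'v \<Rightarrow> bool"
    and G :: "(nat \<Rightarrow> 'e) set" and \<Gamma> :: real
  assumes N2: "2 \<le> N" and L1: "\<And>k. 1 \<le> L k"
    and fin_\<rho>: "\<And>c. finite (set_pmf (\<rho> c))" and fin_Wb: "\<And>z. finite (set_pmf (Wb z))"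
    and supp_P: "set_pmf P \<subseteq> set_pmf (Pi_pmf (comps N) undefined \<rho>)"
    and gain: "\<And>z. z \<in> G \<Longrightarrow> pmf P z \<le> \<Gamma> * pmf (Pi_pmf (comps N) undefined \<rho>) z"
begin

definition "Idx = PiE {1..N} (\<lambda>k. {..<L k})"

definition "keys = (\<Union>a\<in>Idx. \<Union>b\<in>Idx. key N a b ` comps N)"

definition "book = Pi_pmf keys undefined (\<lambda>\<kappa>. \<rho> (fst \<kappa>))"

definition "view a b C = (\<lambda>c\<in>comps N. C (key N a b c))"

abbreviation "ref \<equiv> Pi_pmf (comps N) undefined \<rho>"

text \<open>Truncating the likelihood ratio to \<open>G\<close> is what bounds it by
  \<open>\<Gamma>\<close>; the price is the mass of \<open>P\<close> outside \<open>G\<close> (see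
  \<open>expectation_weight\<close>).\<close>

definition "weight z = (if z \<in> G then pmf P z / pmf ref z else 0)"

text \<open>The equivalences demand that the true index passes and every other one fails, so that
  decoding by unique acceptance is right. For k = N the first line is the destination decoding its
  own new index; since it also knows its own old one, it compares only vectors with the same entry
  at \<open>N\<close>.\<close>

definition good :: "(nat \<Rightarrow> nat) \<Rightarrow> (nat \<Rightarrow> nat) \<Rightarrow> (nat \<times> nat list \<Rightarrow> 'e) \<Rightarrow> 'o \<Rightarrow> bool" where
  "good a b C y \<longleftrightarrow>
     (\<forall>k\<in>{2..N}. \<forall>l<L k. acc k (C (k, [a k])) (C (N + k, [a k, l])) (Yk k y) \<longleftrightarrow> l = b k) \<and>
     (\<forall>a'\<in>Idx. a' N = a N \<longrightarrow> (accd (view a' b C) (Yk N y) \<longleftrightarrow> a' = a))"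

definition "bad_prob a b C = measure_pmf.prob (Wb (view a b C)) {y. \<not> good a b C y}"

definition "miss = measure_pmf.expectation P (\<lambda>z. measure_pmf.prob (Wb z)
    {y. (\<exists>k\<in>{2..N}. \<not> acc k (z k) (z (N + k)) (Yk k y)) \<or> \<not> accd z (Yk N y)})"

text \<open>The codeword \<open>s\<close> is drawn independently of the output, as is any codeword
  whose key is not among those sent.\<close>

definition "relay_false k = measure_pmf.expectation P (\<lambda>z. measure_pmf.expectation (Wb z) (\<lambda>y.
     measure_pmf.expectation (\<rho> (N + k)) (\<lambda>s. of_bool (acc k (z k) s (Yk k y)) :: real)))"

definition "dest_false S = measure_pmf.expectation P (\<lambda>z. measure_pmf.expectation (Wb z) (\<lambda>y.
     measure_pmf.expectation (Pi_pmf (wrong_comps N S) undefined \<rho>)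
       (\<lambda>s. of_bool (accd (\<lambda>c\<in>comps N. if c \<in> wrong_comps N S then s c else z c) (Yk N y)) :: real)))"

section \<open>First-moment bounds for a single block\<close>

lemma finite_Idx: "finite Idx" by (auto simp: Idx_def intro: finite_PiE)

lemma finite_keys: "finite keys" by (simp add: keys_def finite_Idx)

lemma finite_book: "finite (set_pmf book)"
  unfolding book_def by (intro finite_set_Pi_pmf finite_keys fin_\<rho>)

lemma finite_ref: "finite (set_pmf ref)"
  by (intro finite_set_Pi_pmf fin_\<rho>) simp

lemma weight_nonneg: "0 \<le> weight z" by (simp add: weight_def)

lemma weight_le: "weight z \<le> pmf P z / pmf ref z" by (simp add: weight_def)

lemma weight_le_gain: "\<Gamma> \<ge> 0 \<Longrightarrow> weight z \<le> \<Gamma>"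
  using gain[of z] by (cases "pmf ref z = 0") (auto simp: weight_def divide_le_eq pmf_nonneg order.strict_iff_order)

text \<open>Only an inequality, since \<open>weight\<close> is truncated; nonnegativity of
  \<open>F\<close> allows the truncation to be dropped. Condition \<open>d\<close> keeps the
  competing keys apart from the true ones, so that \<open>Pi_pmf_two_views\<close> yields
  independence.\<close>

lemma expectation_two_views:
  assumes "a \<in> Idx" "b \<in> Idx" and S: "h ` S \<subseteq> keys" "\<And>c. fst (h c) = c"
    and d: "\<And>c. c \<in> S \<inter> comps N \<Longrightarrow> h c \<noteq> key N a b c" and F: "\<And>z s. 0 \<le> F z s"
  shows "measure_pmf.expectation book (\<lambda>C. weight (view a b C) * F (view a b C) (\<lambda>c\<in>S. C (h c)))
    \<le> measure_pmf.expectation P (\<lambda>z. measure_pmf.expectation (Pi_pmf S undefined \<rho>) (F z))"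
proof -
  have inj: "inj_on h S" using S(2) by (metis inj_onI)
  have fS: "finite S" using S(1) inj finite_keys finite_subset finite_image_iff by blast
  have fr: "finite (set_pmf (Pi_pmf S undefined \<rho>))" by (intro finite_set_Pi_pmf fS fin_\<rho>)
  have "measure_pmf.expectation book (\<lambda>C. weight (view a b C) * F (view a b C) (\<lambda>c\<in>S. C (h c))) =
    measure_pmf.expectation (map_pmf (\<lambda>C. (\<lambda>c\<in>comps N. C (key N a b c), \<lambda>c\<in>S. C (h c))) book)
      (\<lambda>(z, s). weight z * F z s)"
    by (simp add: view_def)
  also have "map_pmf (\<lambda>C. (\<lambda>c\<in>comps N. C (key N a b c), \<lambda>c\<in>S. C (h c))) book =
     pair_pmf ref (Pi_pmf S undefined \<rho>)"
    unfolding book_def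
  proof (subst Pi_pmf_two_views)
    show "key N a b ` comps N \<subseteq> keys" using assms by (auto simp: keys_def)
    show "key N a b ` comps N \<inter> h ` S = {}"
      using d S(2) by (auto simp: image_iff) (metis IntI fst_key)+
  qed (use finite_keys S inj inj_key in auto)
  also have "measure_pmf.expectation (pair_pmf ref (Pi_pmf S undefined \<rho>)) (\<lambda>(z, s). weight z * F z s) =
    measure_pmf.expectation ref (\<lambda>z. weight z * measure_pmf.expectation (Pi_pmf S undefined \<rho>) (F z))"
    by (simp add: expectation_pair_finite finite_ref fr)
  also have "\<dots> \<le> measure_pmf.expectation ref (\<lambda>z. pmf P z / pmf ref z *
       measure_pmf.expectation (Pi_pmf S undefined \<rho>) (F z))"
    by (intro expectation_mono_finite finite_ref mult_right_mono weight_le Bochner_Integration.integral_nonneg F)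
  also have "\<dots> = measure_pmf.expectation P (\<lambda>z. measure_pmf.expectation (Pi_pmf S undefined \<rho>) (F z))"
    by (rule expectation_density_ratio[OF finite_ref supp_P])
  finally show ?thesis .
qed

lemma expectation_weight:
  assumes "a \<in> Idx" "b \<in> Idx"
  shows "measure_pmf.expectation book (\<lambda>C. weight (view a b C)) = measure_pmf.prob P G"
proof -
  have "map_pmf (view a b) book = ref"
    unfolding book_def view_def[abs_def]
    by (subst Pi_pmf_reindex) (use assms in \<open>auto simp: keys_def finite_keys[unfolded keys_def] inj_key\<close>)
  hence "measure_pmf.expectation book (\<lambda>C. weight (view a b C)) = measure_pmf.expectation ref weight"
    by (metis integral_map_pmf)
  also have "\<dots> = measure_pmf.expectation ref (\<lambda>z. pmf P z / pmf ref z * of_bool (z \<in> G))"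
    by (intro arg_cong[where f="measure_pmf.expectation ref"]) (auto simp: weight_def)
  also have "\<dots> = measure_pmf.prob P {z. z \<in> G}"
    unfolding prob_eq_expectation by (rule expectation_density_ratio[OF finite_ref supp_P])
  finally show ?thesis by simp
qed

definition "diff_set a a' = {k\<in>{2..N}. a' k \<noteq> a k}"

lemma view_other:
  assumes "a \<in> Idx" "a' \<in> Idx" "a' \<noteq> a"
  shows "view a' b C = (\<lambda>c\<in>comps N. if c \<in> wrong_comps N (diff_set a a')
     then (\<lambda>c\<in>wrong_comps N (diff_set a a'). C (key N a' b c)) c else view a b C c)"
proof
  fix c
  consider "c \<notin> comps N" | "c \<in> comps N" "c \<in> wrong_comps N (diff_set a a')"
    | "c \<in> comps N" "c \<notin> wrong_comps N (diff_set a a')" by blast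
  thus "view a' b C c = (\<lambda>c\<in>comps N. if c \<in> wrong_comps N (diff_set a a')
     then (\<lambda>c\<in>wrong_comps N (diff_set a a'). C (key N a' b c)) c else view a b C c) c"
  proof cases
    case 3
    hence "key N a' b c = key N a b c"
    proof (cases "c \<le> N")
      case True
      with 3 have "c \<in> {2..N}" "c \<notin> diff_set a a'" by (auto simp: wrong_comps_def comps_def)
      thus ?thesis by (auto simp: key_def diff_set_def)
    next
      case False
      with 3 have "c = N + (c - N)" "c - N \<in> {2..N}" by (auto simp: comps_def)
      moreover have "c - N \<notin> diff_set a a'"
        using 3 calculation(1) by (metis UnCI imageI insertCI wrong_comps_def)
      ultimately show ?thesis using False by (auto simp: key_def diff_set_def)
    qed
    with 3 show ?thesis by (simp add: view_def)
  qed (simp_all add: view_def)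
qed

text \<open>Outside \<open>insert 1 S\<close> the competitor equals \<open>a\<close>, so its entries
  on \<open>insert 1 S\<close> determine it. The factor \<open>L 1\<close> is always there because
  \<open>diff_set\<close> does not look at the entry 1.\<close>

lemma card_diff_set:
  assumes "S \<subseteq> {2..<N}"
  shows "card {a'\<in>Idx. diff_set a a' = S} \<le> L 1 * (\<Prod>k\<in>S. L k)"
proof -
  have fS: "finite S" using assms finite_subset by blast
  have "card {a'\<in>Idx. diff_set a a' = S} \<le> card (PiE (insert 1 S) (\<lambda>k. {..<L k}))"
  proof (rule card_inj_on_le[where f = "\<lambda>a'. restrict a' (insert 1 S)"])
    show "inj_on (\<lambda>a'. restrict a' (insert 1 S)) {a'\<in>Idx. diff_set a a' = S}"
    proof (rule inj_onI)
      fix f g assume f: "f \<in> {a'\<in>Idx. diff_set a a' = S}" and g: "g \<in> {a'\<in>Idx. diff_set a a' = S}"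
        and e: "restrict f (insert 1 S) = restrict g (insert 1 S)"
      have "f k = g k" if "k \<in> {1..N}" for k
      proof (cases "k \<in> insert 1 S")
        case True thus ?thesis using e by (metis restrict_apply')
      next
        case False
        hence "k \<in> {2..N}" "k \<notin> S" using that by auto
        moreover have "diff_set a f = S" "diff_set a g = S" using f g by simp_all
        ultimately have "f k = a k" "g k = a k" unfolding diff_set_def by blast+
        thus ?thesis by simp
      qed
      moreover have "f \<in> Idx" "g \<in> Idx" using f g by simp_all
      ultimately show "f = g" unfolding Idx_def by (blast intro: PiE_ext)
    qed
    show "(\<lambda>a'. restrict a' (insert 1 S)) ` {a'\<in>Idx. diff_set a a' = S} \<subseteq> PiE (insert 1 S) (\<lambda>k. {..<L k})"
    proof (intro image_subsetI restrict_PiE_iff[THEN iffD2] ballI)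
      fix f i assume "f \<in> {a'\<in>Idx. diff_set a a' = S}" "i \<in> insert 1 S"
      moreover have "insert 1 S \<subseteq> {1..N}" using assms N2 by auto
      ultimately show "f i \<in> {..<L i}" unfolding Idx_def by blast
    qed
  qed (use fS in \<open>auto intro: finite_PiE\<close>)
  also have "\<dots> = L 1 * (\<Prod>k\<in>S. L k)"
  proof -
    have "1 \<notin> S" using assms by auto
    thus ?thesis using fS by (simp add: card_PiE)
  qed
  finally show ?thesis .
qed

text \<open>Union bound over the ways to fail: the true codewords miss a test, a wrong new index
  passes at some node, or a wrong old vector passes at the destination.\<close>

lemma bad_prob_le:
  assumes "a \<in> Idx" "b \<in> Idx"
  shows "bad_prob a b C \<le>
     measure_pmf.prob (Wb (view a b C)) {y. (\<exists>k\<in>{2..N}. \<not> acc k (view a b C k) (view a b C (N + k)) (Yk k y)) \<or> \<not> accd (view a b C) (Yk N y)}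
    + (\<Sum>k\<in>{2..N}. \<Sum>l\<in>{..<L k} - {b k}. measure_pmf.expectation (Wb (view a b C)) (\<lambda>y. of_bool (acc k (view a b C k) (C (N + k, [a k, l])) (Yk k y))))
    + (\<Sum>a'\<in>{a'\<in>Idx. a' N = a N \<and> a' \<noteq> a}. measure_pmf.expectation (Wb (view a b C)) (\<lambda>y. of_bool (accd (view a' b C) (Yk N y))))"
proof -
  let ?z = "view a b C"
  have fI: "finite {a'\<in>Idx. a' N = a N \<and> a' \<noteq> a}" using finite_Idx by simp
  have vk: "?z k = C (k, [a k])" "?z (N + k) = C (N + k, [a k, b k])" if "k \<in> {2..N}" for k
    using that by (auto simp: view_def comps_def key_def)
  have "of_bool (\<not> good a b C y) \<le>
     of_bool ((\<exists>k\<in>{2..N}. \<not> acc k (?z k) (?z (N + k)) (Yk k y)) \<or> \<not> accd ?z (Yk N y))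
    + (\<Sum>k\<in>{2..N}. \<Sum>l\<in>{..<L k} - {b k}. of_bool (acc k (?z k) (C (N + k, [a k, l])) (Yk k y)))
    + (\<Sum>a'\<in>{a'\<in>Idx. a' N = a N \<and> a' \<noteq> a}. of_bool (accd (view a' b C) (Yk N y)) :: real)"
    (is "_ \<le> ?T + ?R + ?D") for y
  proof (cases "good a b C y")
    case True
    thus ?thesis by (auto intro!: add_nonneg_nonneg sum_nonneg)
  next
    case False
    have nn: "?T \<ge> 0" "?R \<ge> 0" "?D \<ge> 0" by (auto intro!: sum_nonneg)
    from False consider "?T = 1"
      | k l where "k \<in> {2..N}" "l < L k" "l \<noteq> b k" "acc k (?z k) (C (N + k, [a k, l])) (Yk k y)"
      | a' where "a' \<in> Idx" "a' N = a N" "a' \<noteq> a" "accd (view a' b C) (Yk N y)"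
    proof -
      have "?T = 1" if "k \<in> {2..N}" "\<not> acc k (C (k, [a k])) (C (N + k, [a k, b k])) (Yk k y)" for k
      proof -
        have "\<exists>k\<in>{2..N}. \<not> acc k (?z k) (?z (N + k)) (Yk k y)"
          by (rule bexI[of _ k]) (use that vk[OF that(1)] in simp_all)
        thus ?thesis by simp
      qed
      moreover have "?T = 1" if "\<not> accd ?z (Yk N y)" using that by simp
      moreover have "(\<exists>k\<in>{2..N}. \<exists>l<L k. acc k (C (k, [a k])) (C (N + k, [a k, l])) (Yk k y) \<noteq> (l = b k)) \<or>
          (\<exists>a'\<in>Idx. a' N = a N \<and> accd (view a' b C) (Yk N y) \<noteq> (a' = a))"
        using False by (auto simp only: good_def)
      ultimately show ?thesis
      proof (elim disjE bexE exE conjE, goal_cases)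
        case (1 k l)
        show ?thesis
        proof (cases "l = b k")
          case True
          with 1 show ?thesis using that(1) by blast
        next
          case False
          with 1 show ?thesis using that(2)[of k l] vk(1) by simp
        qed
      next
        case (2 a')
        show ?thesis
        proof (cases "a' = a")
          case True
          with 2 show ?thesis using that(1) by blast
        next
          case False
          with 2 show ?thesis using that(3)[of a'] by simp
        qed
      qed
    qed
    thus ?thesis
    proof cases
      case 2
      have "1 \<le> (\<Sum>l\<in>{..<L k} - {b k}. of_bool (acc k (?z k) (C (N + k, [a k, l])) (Yk k y)) :: real)"
        using member_le_sum[of l "{..<L k} - {b k}" "\<lambda>l. of_bool (acc k (?z k) (C (N + k, [a k, l])) (Yk k y)) :: real"] 2
        by auto
      also have "\<dots> \<le> ?R"
        by (rule member_le_sum[where f="\<lambda>k. \<Sum>l\<in>{..<L k} - {b k}. of_bool (acc k (?z k) (C (N + k, [a k, l])) (Yk k y))"])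
           (use 2 in \<open>auto intro: sum_nonneg\<close>)
      finally show ?thesis using nn False by simp
    next
      case 3
      have "1 \<le> ?D"
        using member_le_sum[of a' "{a'\<in>Idx. a' N = a N \<and> a' \<noteq> a}" "\<lambda>a'. of_bool (accd (view a' b C) (Yk N y)) :: real"] 3 fI
        by auto
      thus ?thesis using nn False by simp
    qed (use nn False in auto)
  qed
  hence "bad_prob a b C \<le> measure_pmf.expectation (Wb ?z) (\<lambda>y.
     of_bool ((\<exists>k\<in>{2..N}. \<not> acc k (?z k) (?z (N + k)) (Yk k y)) \<or> \<not> accd ?z (Yk N y))
    + (\<Sum>k\<in>{2..N}. \<Sum>l\<in>{..<L k} - {b k}. of_bool (acc k (?z k) (C (N + k, [a k, l])) (Yk k y)))
    + (\<Sum>a'\<in>{a'\<in>Idx. a' N = a N \<and> a' \<noteq> a}. of_bool (accd (view a' b C) (Yk N y))))"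
    unfolding bad_prob_def prob_eq_expectation by (intro expectation_mono_finite fin_Wb)
  also have "\<dots> = measure_pmf.prob (Wb ?z) {y. (\<exists>k\<in>{2..N}. \<not> acc k (?z k) (?z (N + k)) (Yk k y)) \<or> \<not> accd ?z (Yk N y)}
    + (\<Sum>k\<in>{2..N}. \<Sum>l\<in>{..<L k} - {b k}. measure_pmf.expectation (Wb ?z) (\<lambda>y. of_bool (acc k (?z k) (C (N + k, [a k, l])) (Yk k y))))
    + (\<Sum>a'\<in>{a'\<in>Idx. a' N = a N \<and> a' \<noteq> a}. measure_pmf.expectation (Wb ?z) (\<lambda>y. of_bool (accd (view a' b C) (Yk N y))))"
    by (simp only: prob_eq_expectation expectation_add_finite[OF fin_Wb] expectation_sum_finite[OF fin_Wb])
  finally show ?thesis .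
qed

lemma miss_term:
  assumes "a \<in> Idx" "b \<in> Idx"
  shows "measure_pmf.expectation book (\<lambda>C. weight (view a b C) *
      measure_pmf.prob (Wb (view a b C)) {y. (\<exists>k\<in>{2..N}. \<not> acc k (view a b C k) (view a b C (N + k)) (Yk k y)) \<or> \<not> accd (view a b C) (Yk N y)})
    \<le> miss"
  using expectation_two_views[of a b "\<lambda>c. key N a b c" "{}" "\<lambda>z s. measure_pmf.prob (Wb z)
    {y. (\<exists>k\<in>{2..N}. \<not> acc k (z k) (z (N + k)) (Yk k y)) \<or> \<not> accd z (Yk N y)}", OF assms]
  by (simp add: miss_def)

lemma relay_term:
  assumes "a \<in> Idx" "b \<in> Idx" "k \<in> {2..N}" "l < L k" "l \<noteq> b k"
  shows "measure_pmf.expectation book (\<lambda>C. weight (view a b C) *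
      measure_pmf.expectation (Wb (view a b C)) (\<lambda>y. of_bool (acc k (view a b C k) (C (N + k, [a k, l])) (Yk k y))))
    \<le> relay_false k"
proof -
  define h where "h = (\<lambda>c::nat. (c, [a k, l]))"
  \<comment> \<open>The wrong codeword has to be in the book: its key belongs to the pair of vectors
    \<open>a\<close> and \<open>b(k := l)\<close>.\<close>
  have "b(k := l) \<in> Idx" using assms by (auto simp: Idx_def PiE_def extensional_def)
  moreover have "h (N + k) = key N a (b(k := l)) (N + k)" "N + k \<in> comps N"
    using assms by (auto simp: h_def key_def comps_def)
  ultimately have hS: "h ` {N + k} \<subseteq> keys"
    unfolding keys_def using assms(1) by blast
  have "measure_pmf.expectation book (\<lambda>C. weight (view a b C) *
      (\<lambda>z s. measure_pmf.expectation (Wb z) (\<lambda>y. of_bool (acc k (z k) (s (N + k)) (Yk k y)))) (view a b C) (\<lambda>c\<in>{N+k}. C (h c)))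
   \<le> measure_pmf.expectation P (\<lambda>z. measure_pmf.expectation (Pi_pmf {N + k} undefined \<rho>)
       ((\<lambda>z s. measure_pmf.expectation (Wb z) (\<lambda>y. of_bool (acc k (z k) (s (N + k)) (Yk k y)))) z))"
    by (rule expectation_two_views) (use assms hS in \<open>auto simp: h_def key_def\<close>)
  also have "\<dots> = relay_false k"
    unfolding relay_false_def
    by (subst expectation_commute_finite[OF finite_set_Pi_pmf fin_Wb])
       (auto simp: Pi_pmf_singleton fin_\<rho> if_distrib)
  finally show ?thesis by (simp add: h_def)
qed

lemma dest_term:
  assumes "a \<in> Idx" "b \<in> Idx" "a' \<in> Idx" "a' N = a N" "a' \<noteq> a"
  shows "measure_pmf.expectation book (\<lambda>C. weight (view a b C) *
      measure_pmf.expectation (Wb (view a b C)) (\<lambda>y. of_bool (accd (view a' b C) (Yk N y))))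
    \<le> dest_false (diff_set a a')"
proof -
  let ?S = "wrong_comps N (diff_set a a')"
  have sub: "diff_set a a' \<subseteq> {2..<N}" using assms(4)
    by (auto simp: diff_set_def order.strict_iff_order)
  have S: "?S \<subseteq> comps N" by (rule wrong_comps_subset[OF sub N2])
  hence fS: "finite ?S" using finite_subset finite_comps by blast
  have hS: "key N a' b ` ?S \<subseteq> keys" using S assms by (auto simp: keys_def)
  have ne: "\<exists>k\<in>{1..N}. a' k \<noteq> a k"
    using assms(1,3,5) unfolding Idx_def by (meson PiE_ext)
  \<comment> \<open>For component 1 the keys differ because the whole vectors do, even when only the
    entry 1 is wrong.\<close>
  have d: "key N a' b c \<noteq> key N a b c" if "c \<in> ?S \<inter> comps N" for c
    using that ne sub by (auto simp: wrong_comps_def key_def diff_set_def)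
  have "measure_pmf.expectation book (\<lambda>C. weight (view a b C) *
      (\<lambda>z s. measure_pmf.expectation (Wb z) (\<lambda>y. of_bool (accd (\<lambda>c\<in>comps N. if c \<in> ?S then s c else z c) (Yk N y)))) (view a b C) (\<lambda>c\<in>?S. C (key N a' b c)))
   \<le> measure_pmf.expectation P (\<lambda>z. measure_pmf.expectation (Pi_pmf ?S undefined \<rho>)
       ((\<lambda>z s. measure_pmf.expectation (Wb z) (\<lambda>y. of_bool (accd (\<lambda>c\<in>comps N. if c \<in> ?S then s c else z c) (Yk N y)))) z))"
    by (rule expectation_two_views) (use assms hS d in auto)
  also have "\<dots> = dest_false (diff_set a a')"
    unfolding dest_false_def
    by (subst expectation_commute_finite[OF finite_set_Pi_pmf fin_Wb]) (auto simp: fin_\<rho> fS)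
  also have "measure_pmf.expectation book (\<lambda>C. weight (view a b C) *
      (\<lambda>z s. measure_pmf.expectation (Wb z) (\<lambda>y. of_bool (accd (\<lambda>c\<in>comps N. if c \<in> ?S then s c else z c) (Yk N y)))) (view a b C) (\<lambda>c\<in>?S. C (key N a' b c)))
    = measure_pmf.expectation book (\<lambda>C. weight (view a b C) *
      measure_pmf.expectation (Wb (view a b C)) (\<lambda>y. of_bool (accd (view a' b C) (Yk N y))))"
    by (subst view_other[OF assms(1,3,5)]) simp
  finally show ?thesis .
qed

definition "error_bound = miss + (\<Sum>k\<in>{2..N}. L k * relay_false k)
   + (\<Sum>S\<in>Pow {2..<N}. real (L 1 * (\<Prod>k\<in>S. L k)) * dest_false S)"

lemma expectation_weight_bad:
  assumes ab: "a \<in> Idx" "b \<in> Idx"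
  shows "measure_pmf.expectation book (\<lambda>C. weight (view a b C) * bad_prob a b C) \<le> error_bound"
proof -
  let ?w = "\<lambda>C. weight (view a b C)" and ?I = "{a'\<in>Idx. a' N = a N \<and> a' \<noteq> a}"
  let ?E = "measure_pmf.expectation book"
  have rf: "relay_false k \<ge> 0" for k unfolding relay_false_def by (intro expectation_nonneg) simp
  have df: "dest_false S \<ge> 0" for S unfolding dest_false_def by (intro expectation_nonneg) simp
  have sub: "diff_set a a' \<in> Pow {2..<N}" if "a' \<in> ?I" for a' using that
    by (auto simp: diff_set_def order.strict_iff_order)
  have "?E (\<lambda>C. ?w C * bad_prob a b C) \<le> ?E (\<lambda>C. ?w C *
     measure_pmf.prob (Wb (view a b C)) {y. (\<exists>k\<in>{2..N}. \<not> acc k (view a b C k) (view a b C (N + k)) (Yk k y)) \<or> \<not> accd (view a b C) (Yk N y)}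
    + (\<Sum>k\<in>{2..N}. \<Sum>l\<in>{..<L k} - {b k}. ?w C * measure_pmf.expectation (Wb (view a b C)) (\<lambda>y. of_bool (acc k (view a b C k) (C (N + k, [a k, l])) (Yk k y))))
    + (\<Sum>a'\<in>?I. ?w C * measure_pmf.expectation (Wb (view a b C)) (\<lambda>y. of_bool (accd (view a' b C) (Yk N y)))))"
  proof (rule expectation_mono_finite[OF finite_book])
    fix C
    show "?w C * bad_prob a b C \<le> ?w C *
     measure_pmf.prob (Wb (view a b C)) {y. (\<exists>k\<in>{2..N}. \<not> acc k (view a b C k) (view a b C (N + k)) (Yk k y)) \<or> \<not> accd (view a b C) (Yk N y)}
    + (\<Sum>k\<in>{2..N}. \<Sum>l\<in>{..<L k} - {b k}. ?w C * measure_pmf.expectation (Wb (view a b C)) (\<lambda>y. of_bool (acc k (view a b C k) (C (N + k, [a k, l])) (Yk k y))))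
    + (\<Sum>a'\<in>?I. ?w C * measure_pmf.expectation (Wb (view a b C)) (\<lambda>y. of_bool (accd (view a' b C) (Yk N y))))"
      using mult_left_mono[OF bad_prob_le[OF ab, of C] weight_nonneg[of "view a b C"]]
      unfolding distrib_left sum_distrib_left .
  qed
  also have "\<dots> = ?E (\<lambda>C. ?w C *
     measure_pmf.prob (Wb (view a b C)) {y. (\<exists>k\<in>{2..N}. \<not> acc k (view a b C k) (view a b C (N + k)) (Yk k y)) \<or> \<not> accd (view a b C) (Yk N y)})
    + (\<Sum>k\<in>{2..N}. \<Sum>l\<in>{..<L k} - {b k}. ?E (\<lambda>C. ?w C * measure_pmf.expectation (Wb (view a b C)) (\<lambda>y. of_bool (acc k (view a b C k) (C (N + k, [a k, l])) (Yk k y)))))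
    + (\<Sum>a'\<in>?I. ?E (\<lambda>C. ?w C * measure_pmf.expectation (Wb (view a b C)) (\<lambda>y. of_bool (accd (view a' b C) (Yk N y)))))"
    by (simp only: expectation_add_finite[OF finite_book] expectation_sum_finite[OF finite_book])
  also have "\<dots> \<le> miss + (\<Sum>k\<in>{2..N}. \<Sum>l\<in>{..<L k} - {b k}. relay_false k) + (\<Sum>a'\<in>?I. dest_false (diff_set a a'))"
    by (intro add_mono sum_mono miss_term relay_term dest_term ab) auto
  also have "(\<Sum>k\<in>{2..N}. \<Sum>l\<in>{..<L k} - {b k}. relay_false k) \<le> (\<Sum>k\<in>{2..N}. L k * relay_false k)"
  proof (rule sum_mono)
    fix k
    have "card ({..<L k} - {b k}) \<le> L k" using card_mono[of "{..<L k}" "{..<L k} - {b k}"] by simp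
    thus "(\<Sum>l\<in>{..<L k} - {b k}. relay_false k) \<le> L k * relay_false k"
      using rf by (simp add: mult_right_mono del: card_Diff_insert)
  qed
  \<comment> \<open>The bound on a competitor depends only on the set of relays at which it errs, so
    competitors are grouped by that set and counted with \<open>card_diff_set\<close>.\<close>
  also have "(\<Sum>a'\<in>?I. dest_false (diff_set a a')) = (\<Sum>S\<in>Pow {2..<N}. \<Sum>a'\<in>{a'\<in>?I. diff_set a a' = S}. dest_false (diff_set a a'))"
    by (rule sum.group[symmetric]) (use sub finite_Idx in auto)
  also have "\<dots> \<le> (\<Sum>S\<in>Pow {2..<N}. real (L 1 * (\<Prod>k\<in>S. L k)) * dest_false S)"
  proof (rule sum_mono)
    fix S assume S: "S \<in> Pow {2..<N}"
    have "card {a'\<in>?I. diff_set a a' = S} \<le> card {a'\<in>Idx. diff_set a a' = S}"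
      by (rule card_mono) (use finite_Idx in auto)
    also have "\<dots> \<le> L 1 * (\<Prod>k\<in>S. L k)" by (rule card_diff_set) (use S in simp)
    finally have "real (card {a'\<in>?I. diff_set a a' = S}) \<le> real (L 1 * (\<Prod>k\<in>S. L k))"
      by (rule of_nat_mono)
    from mult_right_mono[OF this df[of S]]
    show "(\<Sum>a'\<in>{a'\<in>?I. diff_set a a' = S}. dest_false (diff_set a a')) \<le> real (L 1 * (\<Prod>k\<in>S. L k)) * dest_false S"
      by simp
  qed
  finally show ?thesis by (simp add: error_bound_def)
qed

end

section \<open>Counting good trajectories\<close>

context block_code
begin

definition traj :: "nat \<Rightarrow> (nat \<Rightarrow> nat \<Rightarrow> nat) set" where
  "traj B = PiE {1..<B} (\<lambda>_. Idx)"

text \<open>Block \<open>j\<close> leads from \<open>ix B \<tau> j\<close> to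
  \<open>ix B \<tau> (Suc j)\<close>. The zero vectors at both ends leave \<open>B - 1\<close> free
  vectors for \<open>B\<close> blocks.\<close>

definition ix :: "nat \<Rightarrow> (nat \<Rightarrow> nat \<Rightarrow> nat) \<Rightarrow> nat \<Rightarrow> nat \<Rightarrow> nat" where
  "ix B \<tau> j = (if j \<in> {1..<B} then \<tau> j else (\<lambda>k\<in>{1..N}. 0))"

lemma ix_Idx: "\<tau> \<in> traj B \<Longrightarrow> ix B \<tau> j \<in> Idx"
  using L1 by (auto simp: ix_def traj_def Idx_def Suc_le_eq)

lemma card_traj: "card (traj B) = (\<Prod>k\<in>{1..N}. L k) ^ (B - 1)"
  by (simp add: traj_def card_PiE Idx_def)

lemma finite_traj: "finite (traj B)"
  unfolding traj_def by (rule finite_PiE) (simp_all add: finite_Idx)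

definition "traj_error B \<tau> C = (\<Sum>j<B. bad_prob (ix B \<tau> j) (ix B \<tau> (Suc j)) (C j))"

lemma bad_prob_nonneg: "0 \<le> bad_prob a b C" by (simp add: bad_prob_def)

text \<open>The factor \<open>1 - traj_error B \<tau> C / \<epsilon>\<close> is at most the
  indicator of a small trajectory error, but unlike the indicator it is a sum over blocks. As the
  blocks have independent books, its weighted expectation factorises.\<close>

lemma expected_good_trajectory:
  assumes \<tau>: "\<tau> \<in> traj B" and G: "1 - \<eta> \<le> measure_pmf.prob P G" and e: "error_bound \<le> \<eta>"
    and \<epsilon>: "0 < \<epsilon>" and \<eta>: "0 \<le> \<eta>" "\<eta> \<le> 1"
  shows "1 - B * \<eta> - B * \<eta> / \<epsilon> \<le> measure_pmf.expectation (Pi_pmf {..<B} undefined (\<lambda>_. book))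
    (\<lambda>C. (\<Prod>j<B. weight (view (ix B \<tau> j) (ix B \<tau> (Suc j)) (C j))) * (1 - traj_error B \<tau> C / \<epsilon>))"
proof -
  define w where "w = (\<lambda>j C. weight (view (ix B \<tau> j) (ix B \<tau> (Suc j)) C))"
  define e where "e = (\<lambda>j C. bad_prob (ix B \<tau> j) (ix B \<tau> (Suc j)) C)"
  let ?E = "measure_pmf.expectation (Pi_pmf {..<B} undefined (\<lambda>_. book))"
  have fin: "finite (set_pmf (Pi_pmf {..<B} undefined (\<lambda>_. book)))"
    by (intro finite_set_Pi_pmf finite_book) simp
  have Ew: "measure_pmf.expectation book (w j) = measure_pmf.prob P G" for j
    unfolding w_def by (rule expectation_weight) (use ix_Idx[OF \<tau>] in auto)
  have Ewe: "measure_pmf.expectation book (\<lambda>C. w j C * e j C) \<le> \<eta>" for j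
    unfolding w_def e_def using expectation_weight_bad[OF ix_Idx[OF \<tau>] ix_Idx[OF \<tau>], of j "Suc j"] assms(3) by simp
  have 1: "?E (\<lambda>C. \<Prod>j<B. w j (C j)) = measure_pmf.prob P G ^ B"
    by (subst expectation_prod_Pi_finite) (simp_all add: finite_book Ew, simp add: w_def weight_nonneg)
  have "1 - B * \<eta> \<le> (1 - \<eta>) ^ B" using Bernoulli_inequality[of "- \<eta>" B] \<eta> by simp
  also have "\<dots> \<le> measure_pmf.prob P G ^ B" using G \<eta> by (intro power_mono) auto
  finally have 2: "1 - B * \<eta> \<le> ?E (\<lambda>C. \<Prod>j<B. w j (C j))" by (simp add: 1)
  have 3: "?E (\<lambda>C. (\<Prod>j<B. w j (C j)) * e i (C i)) \<le> \<eta>" if "i < B" for i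
  proof -
    \<comment> \<open>Absorbing the error of block \<open>i\<close> into the i-th factor keeps the
      product form; the other \<open>B - 1\<close> factors have expectation at most one.\<close>
    have "(\<Prod>j<B. w j (C j)) * e i (C i) = (\<Prod>j<B. if j = i then w j (C j) * e j (C j) else w j (C j))" for C
      using that by (simp add: prod.remove[of "{..<B}" i] if_distrib cong: prod.cong) (auto intro!: prod.cong)
    hence "?E (\<lambda>C. (\<Prod>j<B. w j (C j)) * e i (C i)) =
      ?E (\<lambda>C. \<Prod>j<B. (\<lambda>j x. if j = i then w j x * e j x else w j x) j (C j))" by simp
    also have "\<dots> = (\<Prod>j<B. measure_pmf.expectation book ((\<lambda>j x. if j = i then w j x * e j x else w j x) j))"
      by (rule expectation_prod_Pi_finite) (simp_all add: finite_book w_def e_def weight_nonneg bad_prob_nonneg)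
    also have "\<dots> = (\<Prod>j<B. if j = i then measure_pmf.expectation book (\<lambda>C. w j C * e j C) else measure_pmf.prob P G)"
      by (intro prod.cong) (auto simp: Ew)
    also have "\<dots> = measure_pmf.expectation book (\<lambda>C. w i C * e i C) * measure_pmf.prob P G ^ (B - 1)"
      using that by (simp add: prod.remove[of "{..<B}" i])
    also have "\<dots> \<le> \<eta> * 1"
      by (intro mult_mono Ewe power_le_one \<eta>) auto
    finally show ?thesis by simp
  qed
  have "?E (\<lambda>C. \<Prod>j<B. w j (C j)) = ?E (\<lambda>C. (\<Prod>j<B. w j (C j)) * (1 - traj_error B \<tau> C / \<epsilon>)
       + (\<Sum>i<B. (\<Prod>j<B. w j (C j)) * e i (C i) * (1 / \<epsilon>)))"
    by (rule expectation_cong_finite[OF fin])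
       (simp add: traj_error_def e_def algebra_simps sum_distrib_left sum_divide_distrib)
  also have "\<dots> = ?E (\<lambda>C. (\<Prod>j<B. w j (C j)) * (1 - traj_error B \<tau> C / \<epsilon>))
       + (\<Sum>i<B. ?E (\<lambda>C. (\<Prod>j<B. w j (C j)) * e i (C i)) * (1 / \<epsilon>))"
    by (simp add: expectation_add_finite[OF fin] expectation_sum_finite[OF fin])
  also have "(\<Sum>i<B. ?E (\<lambda>C. (\<Prod>j<B. w j (C j)) * e i (C i)) * (1 / \<epsilon>)) \<le> (\<Sum>i<B. \<eta> * (1 / \<epsilon>))"
    using \<epsilon> by (intro sum_mono mult_right_mono 3) auto
  finally show ?thesis using 2 by (simp add: w_def)
qed

text \<open>Summed over all trajectories the preceding bound gives at least half their number, and
  some choice of books reaches this average. There a good trajectory contributes at most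
  \<open>\<Gamma> ^ B\<close> and any other at most zero.\<close>

theorem many_good_trajectories:
  assumes G: "1 - \<eta> \<le> measure_pmf.prob P G" and e: "error_bound \<le> \<eta>"
    and \<epsilon>: "0 < \<epsilon>" and \<eta>: "0 \<le> \<eta>" "\<eta> \<le> 1" "B * \<eta> + B * \<eta> / \<epsilon> \<le> 1 / 2" and \<Gamma>: "0 \<le> \<Gamma>"
  shows "\<exists>C. card (traj B) \<le> 2 * \<Gamma> ^ B * card {\<tau>\<in>traj B. traj_error B \<tau> C \<le> \<epsilon>}"
proof -
  let ?M = "Pi_pmf {..<B} undefined (\<lambda>_. book)"
  let ?w = "\<lambda>\<tau> C. \<Prod>j<B. weight (view (ix B \<tau> j) (ix B \<tau> (Suc j)) (C j))"
  have fin: "finite (set_pmf ?M)"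
    by (intro finite_set_Pi_pmf finite_book) simp
  have "card (traj B) * (1 / 2) = (\<Sum>\<tau>\<in>traj B. 1 / 2 :: real)" by simp
  also have "\<dots> \<le> (\<Sum>\<tau>\<in>traj B. measure_pmf.expectation ?M (\<lambda>C. ?w \<tau> C * (1 - traj_error B \<tau> C / \<epsilon>)))"
  proof (rule sum_mono)
    fix \<tau> assume "\<tau> \<in> traj B"
    from expected_good_trajectory[OF this G e \<epsilon> \<eta>(1,2)] \<eta>(3)
    show "1 / 2 \<le> measure_pmf.expectation ?M (\<lambda>C. ?w \<tau> C * (1 - traj_error B \<tau> C / \<epsilon>))" by linarith
  qed
  also have "\<dots> = measure_pmf.expectation ?M (\<lambda>C. \<Sum>\<tau>\<in>traj B. ?w \<tau> C * (1 - traj_error B \<tau> C / \<epsilon>))"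
    by (rule expectation_sum_finite[OF fin, symmetric])
  finally have half: "card (traj B) * (1 / 2) \<le>
      measure_pmf.expectation ?M (\<lambda>C. \<Sum>\<tau>\<in>traj B. ?w \<tau> C * (1 - traj_error B \<tau> C / \<epsilon>))" .
  obtain C where "measure_pmf.expectation ?M (\<lambda>C. \<Sum>\<tau>\<in>traj B. ?w \<tau> C * (1 - traj_error B \<tau> C / \<epsilon>))
      \<le> (\<Sum>\<tau>\<in>traj B. ?w \<tau> C * (1 - traj_error B \<tau> C / \<epsilon>))"
    using ex_ge_expectation[OF fin] by blast
  with half have "card (traj B) * (1 / 2) \<le> (\<Sum>\<tau>\<in>traj B. ?w \<tau> C * (1 - traj_error B \<tau> C / \<epsilon>))"
    by (rule order_trans)
  also have "\<dots> \<le> (\<Sum>\<tau>\<in>traj B. if traj_error B \<tau> C \<le> \<epsilon> then \<Gamma> ^ B else 0)"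
  proof (rule sum_mono)
    fix \<tau>
    have w: "0 \<le> ?w \<tau> C" "?w \<tau> C \<le> \<Gamma> ^ B"
      using prod_mono[of "{..<B}" "\<lambda>j. weight (view (ix B \<tau> j) (ix B \<tau> (Suc j)) (C j))" "\<lambda>_. \<Gamma>"]
      by (auto intro!: prod_nonneg weight_nonneg simp: weight_le_gain[OF \<Gamma>])
    have "0 \<le> traj_error B \<tau> C" unfolding traj_error_def by (intro sum_nonneg bad_prob_nonneg)
    hence "1 - traj_error B \<tau> C / \<epsilon> \<le> 1" using \<epsilon> by simp
    hence "?w \<tau> C * (1 - traj_error B \<tau> C / \<epsilon>) \<le> \<Gamma> ^ B"
      using mult_left_mono[OF _ w(1), of "1 - traj_error B \<tau> C / \<epsilon>" 1] w(2) by simp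
    moreover have "?w \<tau> C * (1 - traj_error B \<tau> C / \<epsilon>) \<le> 0" if "\<not> traj_error B \<tau> C \<le> \<epsilon>"
      using that \<epsilon> w(1) by (intro mult_nonneg_nonpos) auto
    ultimately show "?w \<tau> C * (1 - traj_error B \<tau> C / \<epsilon>) \<le> (if traj_error B \<tau> C \<le> \<epsilon> then \<Gamma> ^ B else 0)"
      by simp
  qed
  also have "\<dots> = \<Gamma> ^ B * card {\<tau>\<in>traj B. traj_error B \<tau> C \<le> \<epsilon>}"
    by (simp add: sum.If_cases[OF finite_traj] Int_def)
  finally show ?thesis by (intro exI[of _ C]) (simp add: mult_ac)
qed

end

section \<open>Block Markov codes\<close>

lemma pmf_bind_Pair: "pmf (bind_pmf p (\<lambda>x. map_pmf (Pair x) (K x))) (x, y) = pmf p x * pmf (K x) y"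
proof -
  have "pmf (map_pmf (Pair x') (K x')) (x, y) = pmf (K x) y * indicator {x} x'" for x'
  proof (cases "x' = x")
    case True
    thus ?thesis by (simp add: pmf_map_inj' inj_def)
  next
    case False
    hence "(x, y) \<notin> set_pmf (map_pmf (Pair x') (K x'))" by auto
    thus ?thesis using False by (simp add: set_pmf_eq)
  qed
  thus ?thesis by (simp add: pmf_bind measure_pmf_single mult.commute)
qed

lemma pmf_bind_snoc:
  "pmf (bind_pmf p (\<lambda>h. map_pmf (\<lambda>y. h @ [y]) (K h))) (h @ [y]) = pmf p h * pmf (K h) y"
proof -
  let ?f = "\<lambda>(h, y). h @ [y]"
  have "bind_pmf p (\<lambda>h. map_pmf (\<lambda>y. h @ [y]) (K h)) = map_pmf ?f (bind_pmf p (\<lambda>h. map_pmf (Pair h) (K h)))"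
    by (simp add: map_bind_pmf map_pmf_comp)
  moreover have "inj ?f" by (auto simp: inj_def)
  ultimately show ?thesis
    using pmf_map_inj'[of ?f "bind_pmf p (\<lambda>h. map_pmf (Pair h) (K h))" "(h, y)"]
    by (simp only: pmf_bind_Pair prod.case)
qed

lemma prob_cong_pmf:
  assumes "\<And>x. x \<in> A \<Longrightarrow> pmf p x = pmf q x"
  shows "measure_pmf.prob p A = measure_pmf.prob q A"
  unfolding integral_pmf[symmetric]
  by (rule Bochner_Integration.integral_cong) (use assms in auto)

section \<open>Replacing feedback by predetermined inputs\<close>

primrec fixed_outputs :: "('x \<Rightarrow> 'y pmf) \<Rightarrow> (nat \<Rightarrow> 'x) \<Rightarrow> nat \<Rightarrow> 'y list pmf" where
  "fixed_outputs W xs 0 = return_pmf []"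
| "fixed_outputs W xs (Suc i) =
     bind_pmf (fixed_outputs W xs i) (\<lambda>h. map_pmf (\<lambda>y. h @ [y]) (W (xs i)))"

text \<open>The probability of one output sequence \<open>h\<close> involves only the inputs chosen
  along the prefixes of \<open>h\<close>, so agreement with \<open>xs\<close> along \<open>h\<close>
  alone is enough.\<close>

lemma pmf_outputs_eq_fixed:
  assumes "length h = n" "\<And>i. i < n \<Longrightarrow> channel_input N c m (take i h) = xs i"
  shows "pmf (outputs N W c m n) h = pmf (fixed_outputs W xs n) h"
  using assms
proof (induction n arbitrary: h)
  case (Suc n)
  from Suc.prems(1) obtain h' y where h: "h = h' @ [y]" by (cases h rule: rev_cases) auto
  have "pmf (outputs N W c m n) h' = pmf (fixed_outputs W xs n) h'"
  proof (rule Suc.IH)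
    show "length h' = n" using Suc.prems(1) h by simp
    fix i assume "i < n"
    thus "channel_input N c m (take i h') = xs i"
      using Suc.prems(2)[of i] Suc.prems(1) h by simp
  qed
  moreover have "channel_input N c m h' = xs n"
    using Suc.prems(2)[of n] Suc.prems(1) h by simp
  ultimately show ?case by (simp add: h pmf_bind_snoc)
qed simp

lemma fixed_outputs_eq_Pi:
  "fixed_outputs W xs n = map_pmf (\<lambda>y. map y [0..<n]) (Pi_pmf {..<n} d (\<lambda>t. W (xs t)))"
proof (induction n)
  case (Suc n)
  have "map_pmf (\<lambda>y. map y [0..<Suc n]) (Pi_pmf {..<Suc n} d (\<lambda>t. W (xs t))) =
    bind_pmf (W (xs n)) (\<lambda>y. bind_pmf (Pi_pmf {..<n} d (\<lambda>t. W (xs t))) (\<lambda>f. return_pmf (map f [0..<n] @ [y])))"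
    by (simp add: lessThan_Suc Pi_pmf_insert' map_bind_pmf)
  also have "\<dots> = bind_pmf (Pi_pmf {..<n} d (\<lambda>t. W (xs t))) (\<lambda>f. bind_pmf (W (xs n)) (\<lambda>y. return_pmf (map f [0..<n] @ [y])))"
    by (rule bind_commute_pmf)
  also have "\<dots> = fixed_outputs W xs (Suc n)"
    by (simp add: Suc.IH bind_map_pmf map_pmf_def bind_assoc_pmf bind_return_pmf)
  finally show ?case ..
qed simp

lemma length_fixed_outputs: "h \<in> set_pmf (fixed_outputs W xs n) \<Longrightarrow> length h = n"
  by (subst (asm) fixed_outputs_eq_Pi[of _ _ _ undefined]) auto

definition blk :: "nat \<Rightarrow> nat \<Rightarrow> 'a list \<Rightarrow> nat \<Rightarrow> 'a" where
  "blk n j ys = (\<lambda>i\<in>{..<n}. ys ! (j * n + i))"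

lemma blk_fixed_outputs:
  assumes "j * n + n \<le> T"
  shows "map_pmf (blk n j) (fixed_outputs W xs T) = Pi_pmf {..<n} undefined (\<lambda>i. W (xs (j * n + i)))"
proof -
  have "map_pmf (blk n j) (fixed_outputs W xs T) =
     map_pmf (\<lambda>y. blk n j (map y [0..<T])) (Pi_pmf {..<T} undefined (\<lambda>t. W (xs t)))"
    by (subst fixed_outputs_eq_Pi[of _ _ _ undefined]) (simp add: map_pmf_comp)
  also have "(\<lambda>y. blk n j (map y [0..<T])) = (\<lambda>y. \<lambda>i\<in>{..<n}. y (j * n + i))"
    using assms by (auto simp: blk_def fun_eq_iff)
  also have "map_pmf (\<lambda>y. \<lambda>i\<in>{..<n}. y (j * n + i)) (Pi_pmf {..<T} undefined (\<lambda>t. W (xs t))) =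
     Pi_pmf {..<n} undefined (\<lambda>i. W (xs (j * n + i)))"
    by (rule Pi_pmf_reindex) (use assms in \<open>auto simp: inj_on_def\<close>)
  finally show ?thesis .
qed

text \<open>Codewords are now sequences of symbols, turned into channel inputs by \<open>f\<close>.
  Only components up to \<open>N\<close> are transmitted; the \<open>u_k\<close> occur in the tests
  alone.\<close>

locale net_code = block_code N L \<rho> P
    "\<lambda>z. Pi_pmf {..<n} undefined (\<lambda>i. W (\<lambda>k\<in>{1..N}. f k (z k i)))" "\<lambda>k y. \<lambda>i\<in>{..<n}. y i k" acc accd G \<Gamma>
  for N :: nat and L :: "nat \<Rightarrow> nat" and \<rho> :: "nat \<Rightarrow> (nat \<Rightarrow> 'v) pmf" and P :: "(nat \<Rightarrow> nat \<Rightarrow> 'v) pmf"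
    and W :: "(nat \<Rightarrow> 'x) \<Rightarrow> (nat \<Rightarrow> 'y) pmf" and f :: "nat \<Rightarrow> 'v \<Rightarrow> 'x" and n :: nat
    and acc accd G \<Gamma> +
  fixes \<X> :: "nat \<Rightarrow> 'x set" and \<Y> :: "nat \<Rightarrow> 'y set"
  assumes f_in: "\<And>k v. k \<in> {1..N} \<Longrightarrow> f k v \<in> \<X> k" and n_pos: "0 < n"
begin

text \<open>After block \<open>B\<close> node \<open>k\<close> sends \<open>f k undefined\<close>, a
  legal symbol because \<open>f_in\<close> holds for every argument. This lets the code length
  exceed \<open>n * B\<close>.\<close>

definition input :: "nat \<Rightarrow> (nat \<Rightarrow> nat \<Rightarrow> nat) \<Rightarrow> (nat \<Rightarrow> nat \<times> nat list \<Rightarrow> nat \<Rightarrow> 'v) \<Rightarrow> nat \<Rightarrow> nat \<Rightarrow> 'x" where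
  "input B \<tau> C t = (\<lambda>k\<in>{1..N}. f k (if t div n < B then
     view (ix B \<tau> (t div n)) (ix B \<tau> (Suc (t div n))) (C (t div n)) k (t mod n) else undefined))"

text \<open>Whatever \<open>THE\<close> returns when no unique index passes, the resulting input is
  legal by \<open>f_in\<close>; the failure itself is counted as an error of the block.\<close>

primrec est :: "(nat \<Rightarrow> nat \<times> nat list \<Rightarrow> nat \<Rightarrow> 'v) \<Rightarrow> nat \<Rightarrow> 'y list \<Rightarrow> nat \<Rightarrow> nat" where
  "est C k ys 0 = 0"
| "est C k ys (Suc j) =
     (THE l. l < L k \<and> acc k (C j (k, [est C k ys j])) (C j (N + k, [est C k ys j, l])) (blk n j ys))"

text \<open>The forward pass for the own index and the backward pass for the full vectors, stated as
  one condition on a candidate trajectory; the passes themselves reappear in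
  \<open>dest_ok_unique\<close>.\<close>

definition dest_ok :: "nat \<Rightarrow> (nat \<Rightarrow> nat \<times> nat list \<Rightarrow> nat \<Rightarrow> 'v) \<Rightarrow> (nat \<Rightarrow> nat \<Rightarrow> nat) \<Rightarrow> 'y list \<Rightarrow> bool" where
  "dest_ok B C \<tau> ys \<longleftrightarrow> (\<forall>j<B.
     (\<forall>l<L N. acc N (C j (N, [ix B \<tau> j N])) (C j (N + N, [ix B \<tau> j N, l])) (blk n j ys) \<longleftrightarrow> l = ix B \<tau> (Suc j) N) \<and>
     (\<forall>a\<in>Idx. a N = ix B \<tau> j N \<longrightarrow> (accd (view a (ix B \<tau> (Suc j)) (C j)) (blk n j ys) \<longleftrightarrow> a = ix B \<tau> j)))"

definition traj_ok :: "nat \<Rightarrow> (nat \<Rightarrow> nat \<times> nat list \<Rightarrow> nat \<Rightarrow> 'v) \<Rightarrow> (nat \<Rightarrow> nat \<Rightarrow> nat) \<Rightarrow> (nat \<Rightarrow> 'y) list \<Rightarrow> bool" where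
  "traj_ok B C \<tau> h \<longleftrightarrow> (\<forall>j<B. good (ix B \<tau> j) (ix B \<tau> (Suc j)) (C j) (blk n j h))"

definition code :: "nat \<Rightarrow> (nat \<Rightarrow> nat \<times> nat list \<Rightarrow> nat \<Rightarrow> 'v) \<Rightarrow> nat set \<Rightarrow> (nat \<Rightarrow> nat \<Rightarrow> nat \<Rightarrow> nat) \<Rightarrow> ('x, 'y) relay_code" where
  "code B C Ms \<sigma> = \<lparr>
     source_enc = (\<lambda>m ys. f 1 (let t = length ys in if t div n < B
       then C (t div n) (1, map (ix B (\<sigma> m) (t div n)) [1..<N+1]) (t mod n) else undefined)),
     relay_enc = (\<lambda>k ys. f k (let t = length ys in if t div n < B
       then C (t div n) (k, [est C k ys (t div n)]) (t mod n) else undefined)),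
     decoder = (\<lambda>ys. if \<exists>m\<in>Ms. dest_ok B C (\<sigma> m) ys then Some (SOME m. m \<in> Ms \<and> dest_ok B C (\<sigma> m) ys) else None)\<rparr>"

section \<open>Correctness of the decoders\<close>

lemma ix_0 [simp]: "ix B \<tau> 0 = (\<lambda>k\<in>{1..N}. 0)" and ix_B [simp]: "ix B \<tau> B = (\<lambda>k\<in>{1..N}. 0)"
  by (simp_all add: ix_def)

lemma ix_less: "\<tau> \<in> traj B \<Longrightarrow> k \<in> {1..N} \<Longrightarrow> ix B \<tau> j k < L k"
  using ix_Idx[of \<tau> B j] by (auto simp: Idx_def)

text \<open>From the common start, unique acceptance in the test of node \<open>N\<close> fixes its
  own indices forwards. From the common end, with the own indices known, unique acceptance of old
  vectors fixes the rest backwards.\<close>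

lemma dest_ok_unique:
  assumes \<tau>: "\<tau> \<in> traj B" "\<tau>' \<in> traj B" and ok: "dest_ok B C \<tau> ys" "dest_ok B C \<tau>' ys"
  shows "\<tau> = \<tau>'"
proof -
  have N: "N \<in> {1..N}" using N2 by simp
  have fw: "ix B \<tau> j N = ix B \<tau>' j N" if "j \<le> B" for j
    using that
  proof (induction j)
    case (Suc j)
    have "acc N (C j (N, [ix B \<tau> j N])) (C j (N + N, [ix B \<tau> j N, ix B \<tau> (Suc j) N])) (blk n j ys)"
      using ok(1) Suc.prems ix_less[OF \<tau>(1) N] by (auto simp: dest_ok_def)
    thus ?case using ok(2) Suc ix_less[OF \<tau>(1) N] by (auto simp: dest_ok_def)
  qed simp
  have bw: "ix B \<tau> j = ix B \<tau>' j" if "j \<le> B" for j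
    using that
  proof (induction rule: inc_induct)
    case (step j)
    have "accd (view (ix B \<tau> j) (ix B \<tau> (Suc j)) (C j)) (blk n j ys)"
      using ok(1) step.hyps ix_Idx[OF \<tau>(1)] by (auto simp: dest_ok_def)
    hence "accd (view (ix B \<tau> j) (ix B \<tau>' (Suc j)) (C j)) (blk n j ys)" by (simp only: step.IH)
    thus ?case using ok(2) step.hyps ix_Idx[OF \<tau>(1), of j] fw[of j] by (auto simp: dest_ok_def)
  qed simp
  show ?thesis
  proof (rule PiE_ext[OF \<tau>[unfolded traj_def]])
    fix j assume "j \<in> {1..<B}"
    thus "\<tau> j = \<tau>' j" using bw[of j] by (simp add: ix_def)
  qed
qed

lemma blk_node:
  assumes "length h = T" "j * n + n \<le> t" "t \<le> T"
  shows "blk n j (map (\<lambda>y. y k) (take t h)) = (\<lambda>i\<in>{..<n}. blk n j h i k)"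
  using assms by (auto simp: blk_def fun_eq_iff)

text \<open>Causality is in \<open>j * n \<le> t\<close>: the first \<open>j\<close> blocks are
  complete at time \<open>t\<close>, and the estimate at stage \<open>j\<close> reads no
  others.\<close>

lemma est_correct:
  assumes \<tau>: "\<tau> \<in> traj B" and ok: "traj_ok B C \<tau> h" and h: "length h = T" "t \<le> T" and k: "k \<in> {2..N}"
  shows "j \<le> B \<Longrightarrow> j * n \<le> t \<Longrightarrow> est C k (map (\<lambda>y. y k) (take t h)) j = ix B \<tau> j k"
proof (induction j)
  case 0
  thus ?case using k by simp
next
  case (Suc j)
  have IH: "est C k (map (\<lambda>y. y k) (take t h)) j = ix B \<tau> j k" using Suc by simp
  have b: "blk n j (map (\<lambda>y. y k) (take t h)) = (\<lambda>i\<in>{..<n}. blk n j h i k)"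
    by (rule blk_node[OF h(1) _ h(2)]) (use Suc.prems in \<open>simp add: algebra_simps\<close>)
  have "\<forall>l<L k. acc k (C j (k, [ix B \<tau> j k])) (C j (N + k, [ix B \<tau> j k, l])) (\<lambda>i\<in>{..<n}. blk n j h i k)
      \<longleftrightarrow> l = ix B \<tau> (Suc j) k"
    using ok Suc.prems k by (auto simp: traj_ok_def good_def)
  moreover have "ix B \<tau> (Suc j) k < L k" using ix_less[OF \<tau>] k by simp
  ultimately show ?case by (auto simp: IH b intro!: the_equality)
qed

lemma traj_ok_dest_ok:
  assumes ok: "traj_ok B C \<tau> h" and h: "length h = T" "n * B \<le> T"
  shows "dest_ok B C \<tau> (map (\<lambda>y. y N) h)"
  unfolding dest_ok_def
proof (intro allI impI)
  fix j assume j: "j < B"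
  hence "Suc j * n \<le> B * n" by (intro mult_le_mono1) simp
  hence "j * n + n \<le> T" using h by (simp add: mult.commute)
  hence b: "blk n j (map (\<lambda>y. y N) h) = (\<lambda>i\<in>{..<n}. blk n j h i N)"
    using blk_node[OF h(1), of j T N] h(1) by simp
  have "N \<in> {2..N}" using N2 by simp
  thus "(\<forall>l<L N. acc N (C j (N, [ix B \<tau> j N])) (C j (N + N, [ix B \<tau> j N, l])) (blk n j (map (\<lambda>y. y N) h)) \<longleftrightarrow> l = ix B \<tau> (Suc j) N) \<and>
     (\<forall>a\<in>Idx. a N = ix B \<tau> j N \<longrightarrow> (accd (view a (ix B \<tau> (Suc j)) (C j)) (blk n j (map (\<lambda>y. y N) h)) \<longleftrightarrow> a = ix B \<tau> j))"
    using ok j unfolding traj_ok_def good_def b by blast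
qed

lemma channel_input_correct:
  assumes \<tau>: "\<sigma> m \<in> traj B" and ok: "traj_ok B C (\<sigma> m) h" and h: "length h = T" and t: "t < T"
  shows "channel_input N (code B C Ms \<sigma>) m (take t h) = input B (\<sigma> m) C t"
proof
  fix k
  show "channel_input N (code B C Ms \<sigma>) m (take t h) k = input B (\<sigma> m) C t k"
  proof (cases "k \<in> {1..N}")
    case True
    have len: "length (map (\<lambda>y. y k) (take t h)) = t" using h t by simp
    show ?thesis
    proof (cases "k = 1")
      case True
      thus ?thesis using len N2
        by (simp add: channel_input_def input_def code_def view_def key_def comps_def Let_def)
    next
      case False
      have "est C k (map (\<lambda>y. y k) (take t h)) (t div n) = ix B (\<sigma> m) (t div n) k" if "t div n < B"
        by (rule est_correct[OF \<tau> ok h]) (use t that True False in auto)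
      thus ?thesis using len True False
        by (simp add: channel_input_def input_def code_def view_def key_def comps_def Let_def)
    qed
  next
    case False
    thus ?thesis by (simp only: channel_input_def input_def restrict_apply if_False)
  qed
qed

text \<open>The laws with feedback and with fixed inputs agree pointwise on \<open>A\<close> only;
  taking complements twice transfers the bad event all the same. Under fixed inputs block
  \<open>j\<close> has the law in \<open>bad_prob\<close>, and a union bound over blocks
  finishes.\<close>

lemma message_error_le:
  assumes \<sigma>: "\<sigma> ` Ms \<subseteq> traj B" "inj_on \<sigma> Ms" and m: "m \<in> Ms" and T: "n * B \<le> T"
  shows "measure_pmf.prob (outputs N W (code B C Ms \<sigma>) m T)
      {h. decoder (code B C Ms \<sigma>) (map (\<lambda>y. y N) h) \<noteq> Some m} \<le> traj_error B (\<sigma> m) C"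
proof -
  let ?c = "code B C Ms \<sigma>" and ?\<tau> = "\<sigma> m"
  let ?F = "fixed_outputs W (input B ?\<tau> C) T"
  define A where "A = {h. length h = T \<and> traj_ok B C ?\<tau> h}"
  have \<tau>: "?\<tau> \<in> traj B" using \<sigma> m by auto
  have dec: "decoder ?c (map (\<lambda>y. y N) h) = Some m" if "h \<in> A" for h
  proof -
    have ok: "dest_ok B C ?\<tau> (map (\<lambda>y. y N) h)" using that T traj_ok_dest_ok by (auto simp: A_def)
    have "(SOME m'. m' \<in> Ms \<and> dest_ok B C (\<sigma> m') (map (\<lambda>y. y N) h)) = m"
    proof (rule some_equality)
      fix m' assume m': "m' \<in> Ms \<and> dest_ok B C (\<sigma> m') (map (\<lambda>y. y N) h)"
      hence "\<sigma> m' = \<sigma> m" using dest_ok_unique[OF _ \<tau> _ ok] \<sigma>(1) by blast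
      thus "m' = m" using \<sigma>(2) m m' by (meson inj_onD)
    qed (use m ok in simp)
    thus ?thesis using m ok by (auto simp: code_def)
  qed
  have "measure_pmf.prob (outputs N W ?c m T) {h. decoder ?c (map (\<lambda>y. y N) h) \<noteq> Some m}
    \<le> measure_pmf.prob (outputs N W ?c m T) (- A)"
    by (rule measure_pmf.finite_measure_mono) (use dec in auto)
  also have "\<dots> = 1 - measure_pmf.prob (outputs N W ?c m T) A"
    using measure_pmf.prob_compl[of A "outputs N W ?c m T"] by (simp add: Compl_eq_Diff_UNIV)
  also have "measure_pmf.prob (outputs N W ?c m T) A = measure_pmf.prob ?F A"
  proof (rule prob_cong_pmf)
    fix h assume "h \<in> A"
    thus "pmf (outputs N W ?c m T) h = pmf ?F h"
      using channel_input_correct[where \<sigma> = \<sigma> and m = m, OF \<tau>, of C h T] by (intro pmf_outputs_eq_fixed) (auto simp: A_def)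
  qed
  also have "1 - measure_pmf.prob ?F A = measure_pmf.prob ?F (- A)"
    using measure_pmf.prob_compl[of A ?F] by (simp add: Compl_eq_Diff_UNIV)
  also have "\<dots> \<le> measure_pmf.prob ?F (\<Union>j\<in>{..<B}. blk n j -` {y. \<not> good (ix B ?\<tau> j) (ix B ?\<tau> (Suc j)) (C j) y})"
    by (rule measure_pmf.finite_measure_mono_AE)
       (auto simp: AE_measure_pmf_iff A_def traj_ok_def length_fixed_outputs)
  also have "\<dots> \<le> (\<Sum>j<B. measure_pmf.prob ?F (blk n j -` {y. \<not> good (ix B ?\<tau> j) (ix B ?\<tau> (Suc j)) (C j) y}))"
    by (rule measure_pmf.finite_measure_subadditive_finite) auto
  also have "\<dots> = traj_error B ?\<tau> C"
    unfolding traj_error_def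
  proof (rule sum.cong)
    fix j assume j: "j \<in> {..<B}"
    hence "Suc j * n \<le> B * n" by (intro mult_le_mono1) simp
    hence le: "j * n + n \<le> T" using T by (simp add: mult.commute)
    have "input B ?\<tau> C (j * n + i) = (\<lambda>k\<in>{1..N}. f k (view (ix B ?\<tau> j) (ix B ?\<tau> (Suc j)) (C j) k i))" if "i < n" for i
      using that j by (simp add: input_def)
    hence "map_pmf (blk n j) ?F = Pi_pmf {..<n} undefined
       (\<lambda>i. W (\<lambda>k\<in>{1..N}. f k (view (ix B ?\<tau> j) (ix B ?\<tau> (Suc j)) (C j) k i)))"
      unfolding blk_fixed_outputs[OF le] by (intro Pi_pmf_cong) auto
    thus "measure_pmf.prob ?F (blk n j -` {y. \<not> good (ix B ?\<tau> j) (ix B ?\<tau> (Suc j)) (C j) y}) =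
       bad_prob (ix B ?\<tau> j) (ix B ?\<tau> (Suc j)) (C j)"
      unfolding bad_prob_def by (metis measure_map_pmf)
  qed simp
  finally show ?thesis .
qed

text \<open>Each message receives its own good trajectory; the bound then holds for every message
  and hence for the uniform average.\<close>

theorem code_exists:
  assumes c: "card (messages R T) \<le> card {\<tau>\<in>traj B. traj_error B \<tau> C \<le> \<epsilon>}" and T: "n * B \<le> T" and \<epsilon>: "0 \<le> \<epsilon>"
  shows "\<exists>c. is_code N \<X> \<Y> R T c \<and> error_prob N W R T c \<le> \<epsilon>"
proof -
  have fm: "finite (messages R T)" and ne: "messages R T \<noteq> {}" by (simp_all add: messages_def)
  have "finite {\<tau>\<in>traj B. traj_error B \<tau> C \<le> \<epsilon>}" using finite_traj by simp
  then obtain \<sigma> where \<sigma>: "\<sigma> ` messages R T \<subseteq> {\<tau>\<in>traj B. traj_error B \<tau> C \<le> \<epsilon>}" "inj_on \<sigma> (messages R T)"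
    using card_le_inj[OF fm _ c] by blast
  let ?c = "code B C (messages R T) \<sigma>"
  have "is_code N \<X> \<Y> R T ?c"
    unfolding is_code_def
  proof (intro conjI ballI impI)
    fix ys
    let ?Q = "\<lambda>m. m \<in> messages R T \<and> dest_ok B C (\<sigma> m) ys"
    show "decoder ?c ys \<in> insert None (Some ` messages R T)"
    proof (cases "\<exists>m. ?Q m")
      case True
      from someI_ex[OF True] True show ?thesis by (auto simp: code_def)
    qed (auto simp: code_def)
  next
    fix m ys
    show "source_enc ?c m ys \<in> \<X> 1" using f_in[of 1] N2 by (simp add: code_def)
  next
    fix k ys assume "k \<in> {2..N}"
    thus "relay_enc ?c k ys \<in> \<X> k" using f_in[of k] by (simp add: code_def)
  qed
  moreover have "error_prob N W R T ?c \<le> \<epsilon>"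
  proof -
    have "emeasure (measure_pmf (message_estimate N W R T ?c)) {(m, m'). m' \<noteq> Some m} =
      (\<integral>\<^sup>+m. emeasure (measure_pmf (outputs N W ?c m T)) {h. decoder ?c (map (\<lambda>y. y N) h) \<noteq> Some m}
         \<partial>pmf_of_set (messages R T))"
      by (simp add: message_estimate_def vimage_def)
    also have "\<dots> \<le> (\<integral>\<^sup>+m. ennreal \<epsilon> \<partial>pmf_of_set (messages R T))"
    proof (rule nn_integral_mono_AE, rule AE_pmfI)
      fix m assume "m \<in> set_pmf (pmf_of_set (messages R T))"
      hence m: "m \<in> messages R T" using fm ne by simp
      have "measure_pmf.prob (outputs N W ?c m T) {h. decoder ?c (map (\<lambda>y. y N) h) \<noteq> Some m} \<le> \<epsilon>"
        using message_error_le[of \<sigma> "messages R T" B m T C] \<sigma> m T by force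
      thus "emeasure (measure_pmf (outputs N W ?c m T)) {h. decoder ?c (map (\<lambda>y. y N) h) \<noteq> Some m} \<le> ennreal \<epsilon>"
        by (simp add: measure_pmf.emeasure_eq_measure ennreal_leI)
    qed
    also have "\<dots> = ennreal \<epsilon>" by (simp add: measure_pmf.emeasure_space_1)
    finally show ?thesis using \<epsilon> by (simp add: error_prob_def measure_pmf.emeasure_eq_measure)
  qed
  ultimately show ?thesis by blast
qed

end

section \<open>Memoryless extension of a single-letter law\<close>

text \<open>Where the test accepts, the product law is at most \<open>pmf V / c\<close>; since
  \<open>m\<close> is injective these values belong to distinct points and sum to at most
  \<open>1 / c\<close>.\<close>

lemma packing_bound:
  fixes R :: "'w pmf" and t :: "'w \<Rightarrow> 't" and Q :: "'s pmf" and m :: "'t \<times> 's \<Rightarrow> 'v"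
  assumes fin: "finite (set_pmf R)" "finite (set_pmf Q)" and c: "0 < c"
    and inj: "inj_on m (t ` set_pmf R \<times> set_pmf Q)"
    and acc: "\<And>u s. u \<in> t ` set_pmf R \<Longrightarrow> s \<in> set_pmf Q \<Longrightarrow> Acc u s \<Longrightarrow>
      c * (pmf Q s * pmf (map_pmf t R) u) \<le> pmf V (m (u, s))"
  shows "measure_pmf.expectation R (\<lambda>\<omega>. measure_pmf.expectation Q (\<lambda>s. of_bool (Acc (t \<omega>) s))) \<le> 1 / c"
proof -
  let ?T = "map_pmf t R" and ?D = "t ` set_pmf R \<times> set_pmf Q"
  have fT: "finite (set_pmf ?T)" and fD: "finite ?D" using fin by auto
  have "measure_pmf.expectation R (\<lambda>\<omega>. measure_pmf.expectation Q (\<lambda>s. of_bool (Acc (t \<omega>) s))) =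
    measure_pmf.expectation ?T (\<lambda>u. measure_pmf.expectation Q (\<lambda>s. of_bool (Acc u s) :: real))"
    by simp
  also have "\<dots> = (\<Sum>u\<in>t ` set_pmf R. \<Sum>s\<in>set_pmf Q. pmf ?T u * (pmf Q s * of_bool (Acc u s)))"
    by (simp only: expectation_finite_sum[OF fT] expectation_finite_sum[OF fin(2)] sum_distrib_left set_map_pmf)
  also have "\<dots> = (\<Sum>(u, s)\<in>?D. pmf ?T u * (pmf Q s * of_bool (Acc u s)))"
    by (rule sum.cartesian_product)
  also have "\<dots> \<le> (\<Sum>p\<in>?D. pmf V (m p) / c)"
  proof (rule sum_mono)
    fix p assume p: "p \<in> ?D"
    obtain u s where us: "p = (u, s)" by (rule prod.exhaust)
    show "(case p of (u, s) \<Rightarrow> pmf ?T u * (pmf Q s * of_bool (Acc u s))) \<le> pmf V (m p) / c"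
    proof (cases "Acc u s")
      case True
      thus ?thesis using acc[of u s] p c by (simp add: us le_divide_eq mult_ac)
    next
      case False
      thus ?thesis using c by (simp add: us)
    qed
  qed
  also have "\<dots> = (\<Sum>p\<in>?D. pmf V (m p)) / c" by (simp add: sum_divide_distrib)
  also have "(\<Sum>p\<in>?D. pmf V (m p)) = (\<Sum>v\<in>m ` ?D. pmf V v)"
    by (simp add: sum.reindex[OF inj])
  also have "\<dots> = measure_pmf.prob V (m ` ?D)" using fD by (simp add: measure_measure_pmf_finite)
  also have "\<dots> / c \<le> 1 / c" using c by (intro divide_right_mono) auto
  finally show ?thesis .
qed

lemma prod_ge_of_sum_log:
  fixes a b :: "'i \<Rightarrow> real"
  assumes "finite I" "\<And>i. i \<in> I \<Longrightarrow> 0 < a i" "\<And>i. i \<in> I \<Longrightarrow> 0 < b i"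
    and "g \<le> (\<Sum>i\<in>I. log 2 (a i / b i))"
  shows "2 powr g * (\<Prod>i\<in>I. b i) \<le> (\<Prod>i\<in>I. a i)"
proof -
  have pos: "0 < (\<Prod>i\<in>I. a i / b i)" using assms by (intro prod_pos) auto
  have "log 2 (\<Prod>i\<in>I. a i / b i) = (\<Sum>i\<in>I. log 2 (a i / b i))"
    using ln_prod[OF assms(1), of "\<lambda>i. a i / b i"] assms(2,3)
    by (simp add: log_def less_imp_neq[THEN not_sym] sum_divide_distrib)
  hence "2 powr g \<le> (\<Prod>i\<in>I. a i / b i)"
    using assms(4) le_log_iff[of 2, OF _ pos, of g] by simp
  moreover have "0 < (\<Prod>i\<in>I. b i)" using assms by (intro prod_pos) auto
  ultimately show ?thesis by (simp add: prod_dividef le_divide_eq)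
qed

text \<open>An outcome \<open>\<omega>\<close> carries all variables of one letter, and
  \<open>rq q\<close> is their law given Q = q. The assumption \<open>channel\<close> is the Markov
  condition: given all components, the outputs are drawn from \<open>W\<close> at the inputs.
  \<open>\<rho>l\<close> is the law for drawing codeword symbols; it is finite and covers the
  support, and is otherwise left open.\<close>

locale letter_model =
  fixes N :: nat and pQ :: "'q pmf" and rq :: "'q \<Rightarrow> 'w pmf" and qof :: "'w \<Rightarrow> 'q"
    and zc :: "nat \<Rightarrow> 'w \<Rightarrow> 'v" and yc :: "'w \<Rightarrow> nat \<Rightarrow> 'y"
    and W :: "(nat \<Rightarrow> 'x) \<Rightarrow> (nat \<Rightarrow> 'y) pmf" and f :: "nat \<Rightarrow> 'v \<Rightarrow> 'x"
    and \<rho>l :: "nat \<Rightarrow> 'q \<Rightarrow> 'v pmf"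
  assumes N2: "2 \<le> N"
    and fin_pQ: "finite (set_pmf pQ)"
    and fin_rq: "\<And>q. q \<in> set_pmf pQ \<Longrightarrow> finite (set_pmf (rq q))"
    and qof: "\<And>q \<omega>. q \<in> set_pmf pQ \<Longrightarrow> \<omega> \<in> set_pmf (rq q) \<Longrightarrow> qof \<omega> = q"
    and channel: "\<And>q. q \<in> set_pmf pQ \<Longrightarrow> map_pmf (\<lambda>\<omega>. (\<lambda>c\<in>comps N. zc c \<omega>, yc \<omega>)) (rq q) =
      bind_pmf (map_pmf (\<lambda>\<omega>. \<lambda>c\<in>comps N. zc c \<omega>) (rq q)) (\<lambda>z. map_pmf (Pair z) (W (\<lambda>k\<in>{1..N}. f k (z k))))"
    and supp_\<rho>l: "\<And>q \<omega> c. q \<in> set_pmf pQ \<Longrightarrow> \<omega> \<in> set_pmf (rq q) \<Longrightarrow> c \<in> comps N \<Longrightarrow> zc c \<omega> \<in> set_pmf (\<rho>l c q)"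
    and fin_\<rho>l: "\<And>c q. q \<in> set_pmf pQ \<Longrightarrow> finite (set_pmf (\<rho>l c q))"
    and fin_W: "\<And>z. finite (set_pmf (W (\<lambda>k\<in>{1..N}. f k (z k))))"
begin

definition "zl \<omega> = (\<lambda>c\<in>comps N. zc c \<omega>)"

definition cond_density :: "('w \<Rightarrow> 'b) \<Rightarrow> 'w \<Rightarrow> real" where
  "cond_density g \<omega> = pmf (map_pmf g (rq (qof \<omega>))) (g \<omega>)"

text \<open>If \<open>\<rho>l (N + k)\<close> were the law of u_k given Q, this would be the
  information density of U_k and (X_k, Y_k) given Q. Any other drawing law can only raise its
  mean.\<close>

definition "relay_info k \<omega> = log 2 (cond_density (\<lambda>\<omega>. (zc k \<omega>, zc (N + k) \<omega>, yc \<omega> k)) \<omega> /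
    (pmf (\<rho>l (N + k) (qof \<omega>)) (zc (N + k) \<omega>) * cond_density (\<lambda>\<omega>. (zc k \<omega>, yc \<omega> k)) \<omega>))"

definition "dest_info S \<omega> = log 2 (cond_density (\<lambda>\<omega>. (zl \<omega>, yc \<omega> N)) \<omega> /
    ((\<Prod>c\<in>wrong_comps N S. pmf (\<rho>l c (qof \<omega>)) (zc c \<omega>)) *
      cond_density (\<lambda>\<omega>. (restrict (zl \<omega>) (comps N - wrong_comps N S), yc \<omega> N)) \<omega>))"

definition "gain_info \<omega> = log 2 (cond_density zl \<omega> / (\<Prod>c\<in>comps N. pmf (\<rho>l c (qof \<omega>)) (zc c \<omega>)))"

end

text \<open>The time sharing sequence \<open>qs\<close> is a parameter, so letters are independent
  but not identically distributed. Thresholds and index ranges stay free until the rates are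
  chosen.\<close>

locale block_model = letter_model N pQ rq qof zc yc W f \<rho>l
  for N :: nat and pQ :: "'q pmf" and rq :: "'q \<Rightarrow> 'w pmf" and qof :: "'w \<Rightarrow> 'q"
    and zc :: "nat \<Rightarrow> 'w \<Rightarrow> 'v" and yc :: "'w \<Rightarrow> nat \<Rightarrow> 'y"
    and W :: "(nat \<Rightarrow> 'x) \<Rightarrow> (nat \<Rightarrow> 'y) pmf" and f :: "nat \<Rightarrow> 'v \<Rightarrow> 'x"
    and \<rho>l :: "nat \<Rightarrow> 'q \<Rightarrow> 'v pmf" +
  fixes n :: nat and qs :: "nat \<Rightarrow> 'q" and gR :: "nat \<Rightarrow> real" and gD :: "nat set \<Rightarrow> real" and gW :: real
    and L :: "nat \<Rightarrow> nat" and d :: 'w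
  assumes qs: "\<And>i. i < n \<Longrightarrow> qs i \<in> set_pmf pQ" and L1: "\<And>k. 1 \<le> L k"
begin

definition "R = Pi_pmf {..<n} d (\<lambda>i. rq (qs i))"

definition "\<rho> c = Pi_pmf {..<n} undefined (\<lambda>i. \<rho>l c (qs i))"

definition "zb \<omega> = (\<lambda>c\<in>comps N. \<lambda>i\<in>{..<n}. zc c (\<omega> i))"

definition "yb \<omega> = (\<lambda>i\<in>{..<n}. yc (\<omega> i))"

definition "ob k \<omega> = (\<lambda>i\<in>{..<n}. yc (\<omega> i) k)"

definition "P = map_pmf zb R"

definition "Wb z = Pi_pmf {..<n} undefined (\<lambda>i. W (\<lambda>k\<in>{1..N}. f k (z k i)))"

text \<open>A likelihood-ratio threshold multiplied out, which is exactly the inequality that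
  \<open>packing_bound\<close> needs; it replaces membership in a typical set. \<open>accd\<close>
  imposes one such threshold for every possible set of wrong relays.\<close>

definition "acc k x u v \<longleftrightarrow>
  2 powr gR k * (pmf (\<rho> (N + k)) u * pmf (map_pmf (\<lambda>\<omega>. (zb \<omega> k, ob k \<omega>)) R) (x, v))
    \<le> pmf (map_pmf (\<lambda>\<omega>. (zb \<omega> k, zb \<omega> (N + k), ob k \<omega>)) R) (x, u, v)"

definition "accd z v \<longleftrightarrow> (\<forall>S\<subseteq>{2..<N}.
  2 powr gD S * ((\<Prod>c\<in>wrong_comps N S. pmf (\<rho> c) (z c)) *
      pmf (map_pmf (\<lambda>\<omega>. (restrict (zb \<omega>) (comps N - wrong_comps N S), ob N \<omega>)) R)
        (restrict z (comps N - wrong_comps N S), v))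
    \<le> pmf (map_pmf (\<lambda>\<omega>. (zb \<omega>, ob N \<omega>)) R) (z, v))"

definition "G = {z. pmf P z \<le> 2 powr gW * pmf (Pi_pmf (comps N) undefined \<rho>) z}"

section \<open>Block laws as products over letters\<close>

lemma finite_R: "finite (set_pmf R)"
  unfolding R_def by (intro finite_set_Pi_pmf fin_rq qs) simp_all

lemma R_letter: "\<omega> \<in> set_pmf R \<Longrightarrow> i < n \<Longrightarrow> \<omega> i \<in> set_pmf (rq (qs i))"
  by (auto simp: R_def set_Pi_pmf PiE_dflt_def)

lemma R_qof: "\<omega> \<in> set_pmf R \<Longrightarrow> i < n \<Longrightarrow> qof (\<omega> i) = qs i"
  using R_letter qs qof by blast

lemma finite_\<rho>: "finite (set_pmf (\<rho> c))"
  unfolding \<rho>_def by (intro finite_set_Pi_pmf fin_\<rho>l qs) simp_all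

lemma finite_Wb: "finite (set_pmf (Wb z))"
  unfolding Wb_def by (intro finite_set_Pi_pmf fin_W) simp

lemma pmf_map_R:
  assumes "\<And>\<omega>'. g \<omega>' = v \<longleftrightarrow> (\<forall>i<n. gl (\<omega>' i) = vl i)"
  shows "pmf (map_pmf g R) v = (\<Prod>i<n. pmf (map_pmf gl (rq (qs i))) (vl i))"
proof -
  have "g -` {v} = Pi {..<n} (\<lambda>i. gl -` {vl i})"
    using assms by (auto simp: Pi_def)
  thus ?thesis unfolding pmf_map R_def by (simp add: measure_Pi_pmf_Pi)
qed

lemma pmf_map_R_cond_density:
  assumes "\<omega> \<in> set_pmf R" "\<And>\<omega>'. g \<omega>' = g \<omega> \<longleftrightarrow> (\<forall>i<n. gl (\<omega>' i) = gl (\<omega> i))"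
  shows "pmf (map_pmf g R) (g \<omega>) = (\<Prod>i<n. cond_density gl (\<omega> i))"
proof -
  have "pmf (map_pmf g R) (g \<omega>) = (\<Prod>i<n. pmf (map_pmf gl (rq (qs i))) (gl (\<omega> i)))"
    by (rule pmf_map_R) (use assms in auto)
  also have "\<dots> = (\<Prod>i<n. cond_density gl (\<omega> i))"
    by (rule prod.cong) (simp_all add: cond_density_def R_qof[OF assms(1)])
  finally show ?thesis .
qed

lemma cond_density_pos: "\<omega> \<in> set_pmf R \<Longrightarrow> i < n \<Longrightarrow> 0 < cond_density gl (\<omega> i)"
  unfolding cond_density_def using R_letter[of \<omega> i] by (subst R_qof) (auto intro!: pmf_positive)

lemma pmf_\<rho>_zb:
  assumes "\<omega> \<in> set_pmf R" "c \<in> comps N"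
  shows "pmf (\<rho> c) (zb \<omega> c) = (\<Prod>i<n. pmf (\<rho>l c (qof (\<omega> i))) (zc c (\<omega> i)))"
proof -
  have "pmf (\<rho> c) (zb \<omega> c) = (\<Prod>i<n. pmf (\<rho>l c (qs i)) (zc c (\<omega> i)))"
    using assms by (simp add: \<rho>_def zb_def pmf_Pi)
  also have "\<dots> = (\<Prod>i<n. pmf (\<rho>l c (qof (\<omega> i))) (zc c (\<omega> i)))"
    by (rule prod.cong) (simp_all add: R_qof[OF assms(1)])
  finally show ?thesis .
qed

lemma \<rho>l_pos:
  assumes "\<omega> \<in> set_pmf R" "c \<in> comps N" "i < n"
  shows "0 < pmf (\<rho>l c (qof (\<omega> i))) (zc c (\<omega> i))"
  using supp_\<rho>l[OF qs[OF assms(3)] R_letter[OF assms(1,3)] assms(2)] assms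
  by (simp add: R_qof pmf_positive)

lemma zb_eq_iff: "c \<in> comps N \<Longrightarrow> zb \<omega>' c = zb \<omega> c \<longleftrightarrow> (\<forall>i<n. zc c (\<omega>' i) = zc c (\<omega> i))"
  by (auto simp: zb_def fun_eq_iff restrict_def)

lemma ob_eq_iff: "ob k \<omega>' = ob k \<omega> \<longleftrightarrow> (\<forall>i<n. yc (\<omega>' i) k = yc (\<omega> i) k)"
  by (auto simp: ob_def fun_eq_iff restrict_def)

lemma restrict_zb_eq_iff:
  assumes "A \<subseteq> comps N"
  shows "restrict (zb \<omega>') A = restrict (zb \<omega>) A \<longleftrightarrow> (\<forall>i<n. restrict (zl (\<omega>' i)) A = restrict (zl (\<omega> i)) A)"
proof -
  have "restrict (zb \<omega>') A = restrict (zb \<omega>) A \<longleftrightarrow> (\<forall>c\<in>A. zb \<omega>' c = zb \<omega> c)"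
    by (auto simp: fun_eq_iff restrict_def)
  also have "\<dots> \<longleftrightarrow> (\<forall>c\<in>A. \<forall>i<n. zc c (\<omega>' i) = zc c (\<omega> i))"
    by (rule ball_cong) (use zb_eq_iff assms in auto)
  also have "\<dots> \<longleftrightarrow> (\<forall>i<n. \<forall>c\<in>A. zl (\<omega>' i) c = zl (\<omega> i) c)"
    using assms by (auto simp: zl_def)
  also have "\<dots> \<longleftrightarrow> (\<forall>i<n. restrict (zl (\<omega>' i)) A = restrict (zl (\<omega> i)) A)"
    by (auto simp: fun_eq_iff restrict_def)
  finally show ?thesis .
qed

lemma zb_eq_iff_all: "zb \<omega>' = zb \<omega> \<longleftrightarrow> (\<forall>i<n. zl (\<omega>' i) = zl (\<omega> i))"
proof -
  have "restrict (zb \<omega>) (comps N) = zb \<omega>" "restrict (zl v) (comps N) = zl v" for \<omega> v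
    by (simp_all add: zb_def zl_def)
  thus ?thesis using restrict_zb_eq_iff[of "comps N" \<omega>' \<omega>] by simp
qed

text \<open>The n-fold product of \<open>channel\<close>. It allows quantities defined by first
  choosing codewords and then sending them to be computed on sequences of letters.\<close>

lemma disintegration:
  "map_pmf (\<lambda>\<omega>. (zb \<omega>, yb \<omega>)) R = bind_pmf P (\<lambda>z. map_pmf (Pair z) (Wb z))"
proof (rule pmf_eqI)
  fix zy :: "(nat \<Rightarrow> nat \<Rightarrow> 'v) \<times> (nat \<Rightarrow> nat \<Rightarrow> 'y)"
  obtain z y where zy: "zy = (z, y)" by (rule prod.exhaust)
  show "pmf (map_pmf (\<lambda>\<omega>. (zb \<omega>, yb \<omega>)) R) zy = pmf (bind_pmf P (\<lambda>z. map_pmf (Pair z) (Wb z))) zy"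
  proof (cases "z \<in> extensional (comps N) \<and> (\<forall>c\<in>comps N. z c \<in> extensional {..<n}) \<and> y \<in> extensional {..<n}")
    case True
    let ?zi = "\<lambda>i. \<lambda>c\<in>comps N. z c i"
    have ez: "zb \<omega> = z \<longleftrightarrow> (\<forall>i<n. zl (\<omega> i) = ?zi i)" for \<omega>
    proof -
      have "zb \<omega> = z \<longleftrightarrow> (\<forall>c\<in>comps N. zb \<omega> c = z c)"
        using True by (auto simp: zb_def fun_eq_iff extensional_def)
      also have "\<dots> \<longleftrightarrow> (\<forall>c\<in>comps N. \<forall>i<n. zc c (\<omega> i) = z c i)"
        using True by (auto simp: zb_def fun_eq_iff extensional_def)
      also have "\<dots> \<longleftrightarrow> (\<forall>i<n. zl (\<omega> i) = ?zi i)"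
        by (auto simp: zl_def fun_eq_iff)
      finally show ?thesis .
    qed
    have ey: "yb \<omega> = y \<longleftrightarrow> (\<forall>i<n. yc (\<omega> i) = y i)" for \<omega>
      using True by (auto simp: yb_def fun_eq_iff extensional_def)
    have "pmf (map_pmf (\<lambda>\<omega>. (zb \<omega>, yb \<omega>)) R) zy =
      (\<Prod>i<n. pmf (map_pmf (\<lambda>\<omega>. (zl \<omega>, yc \<omega>)) (rq (qs i))) (?zi i, y i))"
      by (rule pmf_map_R) (auto simp: zy ez ey)
    also have "\<dots> = (\<Prod>i<n. pmf (map_pmf zl (rq (qs i))) (?zi i) * pmf (W (\<lambda>k\<in>{1..N}. f k (?zi i k))) (y i))"
      by (rule prod.cong) (simp_all add: zl_def[abs_def] channel[OF qs] pmf_bind_Pair)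
    also have "\<dots> = (\<Prod>i<n. pmf (map_pmf zl (rq (qs i))) (?zi i)) * (\<Prod>i<n. pmf (W (\<lambda>k\<in>{1..N}. f k (z k i))) (y i))"
    proof -
      have "(\<lambda>k\<in>{1..N}. f k (?zi i k)) = (\<lambda>k\<in>{1..N}. f k (z k i))" for i
        by (auto simp: comps_def fun_eq_iff restrict_def)
      thus ?thesis by (simp add: prod.distrib)
    qed
    also have "(\<Prod>i<n. pmf (map_pmf zl (rq (qs i))) (?zi i)) = pmf P z"
      unfolding P_def by (rule pmf_map_R[symmetric]) (rule ez)
    also have "(\<Prod>i<n. pmf (W (\<lambda>k\<in>{1..N}. f k (z k i))) (y i)) = pmf (Wb z) y"
      using True by (auto simp: Wb_def pmf_Pi extensional_def)
    finally show ?thesis by (simp add: zy pmf_bind_Pair)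
  next
    case False
    have "(\<lambda>\<omega>. (zb \<omega>, yb \<omega>)) -` {zy} = {}" using False by (auto simp: zy zb_def yb_def)
    hence 1: "pmf (map_pmf (\<lambda>\<omega>. (zb \<omega>, yb \<omega>)) R) zy = 0" by (simp add: pmf_map)
    have "pmf P z = 0 \<or> pmf (Wb z) y = 0"
    proof (cases "y \<in> extensional {..<n}")
      case True
      hence "zb -` {z} = {}" using False by (auto simp: zb_def)
      thus ?thesis by (simp add: P_def pmf_map)
    next
      case False
      thus ?thesis by (auto simp: Wb_def pmf_Pi extensional_def)
    qed
    thus ?thesis using 1 by (auto simp: zy pmf_bind_Pair)
  qed
qed

lemma finite_P: "finite (set_pmf P)" by (simp add: P_def finite_R)

lemma expectation_P_Wb:
  fixes h :: "(nat \<Rightarrow> nat \<Rightarrow> 'v) \<Rightarrow> (nat \<Rightarrow> nat \<Rightarrow> 'y) \<Rightarrow> real"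
  shows "measure_pmf.expectation P (\<lambda>z. measure_pmf.expectation (Wb z) (h z)) =
    measure_pmf.expectation R (\<lambda>\<omega>. h (zb \<omega>) (yb \<omega>))"
proof -
  have "measure_pmf.expectation P (\<lambda>z. measure_pmf.expectation (Wb z) (h z)) =
    measure_pmf.expectation (bind_pmf P (\<lambda>z. map_pmf (Pair z) (Wb z))) (\<lambda>(z, y). h z y)"
    by (subst expectation_bind_finite) (simp_all add: finite_P finite_Wb)
  also have "\<dots> = measure_pmf.expectation R (\<lambda>\<omega>. h (zb \<omega>) (yb \<omega>))"
    by (simp add: disintegration[symmetric])
  finally show ?thesis .
qed

lemma ob_yb: "(\<lambda>i\<in>{..<n}. yb \<omega> i k) = ob k \<omega>"
  by (auto simp: yb_def ob_def fun_eq_iff)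

lemma supp_P: "set_pmf P \<subseteq> set_pmf (Pi_pmf (comps N) undefined \<rho>)"
proof
  fix z assume "z \<in> set_pmf P"
  then obtain \<omega> where \<omega>: "\<omega> \<in> set_pmf R" "z = zb \<omega>" by (auto simp: P_def)
  have "zc c (\<omega> i) \<in> set_pmf (\<rho>l c (qs i))" if "i < n" "c \<in> comps N" for c i
    using supp_\<rho>l[OF qs R_letter[OF \<omega>(1)]] that by blast
  thus "z \<in> set_pmf (Pi_pmf (comps N) undefined \<rho>)"
    by (auto simp: \<omega>(2) zb_def set_Pi_pmf PiE_dflt_def \<rho>_def)
qed

section \<open>False acceptance and atypical letters\<close>

sublocale blk: block_code N L \<rho> P Wb "\<lambda>k y. \<lambda>i\<in>{..<n}. y i k" acc accd G "2 powr gW"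
  by unfold_locales (use N2 L1 finite_\<rho> finite_Wb supp_P in \<open>auto simp: G_def\<close>)

lemma relay_false_le:
  assumes "k \<in> {2..N}"
  shows "blk.relay_false k \<le> 1 / 2 powr gR k"
proof -
  have "blk.relay_false k = measure_pmf.expectation R (\<lambda>\<omega>. measure_pmf.expectation (\<rho> (N + k))
      (\<lambda>s. of_bool (acc k (zb \<omega> k) s (ob k \<omega>))))"
    unfolding blk.relay_false_def expectation_P_Wb ob_yb ..
  also have "\<dots> = measure_pmf.expectation R (\<lambda>\<omega>. measure_pmf.expectation (\<rho> (N + k))
      (\<lambda>s. of_bool ((\<lambda>(x, v) s. acc k x s v) ((\<lambda>\<omega>. (zb \<omega> k, ob k \<omega>)) \<omega>) s)))" by simp
  also have "\<dots> \<le> 1 / 2 powr gR k"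
    by (rule packing_bound[where m = "\<lambda>((x, v), s). (x, s, v)" and
          V = "map_pmf (\<lambda>\<omega>. (zb \<omega> k, zb \<omega> (N + k), ob k \<omega>)) R"])
       (auto simp: finite_R finite_\<rho> inj_on_def acc_def)
  finally show ?thesis .
qed

lemma dest_false_le:
  assumes S: "S \<subseteq> {2..<N}"
  shows "blk.dest_false S \<le> 1 / 2 powr gD S"
proof -
  let ?w = "wrong_comps N S"
  let ?A = "comps N - ?w"
  have w: "?w \<subseteq> comps N" by (rule wrong_comps_subset[OF S N2])
  hence fw: "finite ?w" using finite_comps finite_subset by blast
  \<comment> \<open>\<open>mrg t s\<close> replaces the wrong components by fresh ones. Both
    arguments can be recovered by restriction, which is the injectivity in
    \<open>packing_bound\<close>.\<close>
  define mrg :: "(nat \<Rightarrow> nat \<Rightarrow> 'v) \<Rightarrow> (nat \<Rightarrow> nat \<Rightarrow> 'v) \<Rightarrow> nat \<Rightarrow> nat \<Rightarrow> 'v"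
    where "mrg = (\<lambda>t s. \<lambda>c\<in>comps N. if c \<in> ?w then s c else t c)"
  have s_ext: "s \<in> extensional ?w" if "s \<in> set_pmf (Pi_pmf ?w undefined \<rho>)" for s
    using that fw by (auto simp: set_Pi_pmf PiE_dflt_def extensional_def)
  have m1: "restrict (mrg t s) ?A = t" if "t \<in> extensional ?A" for t s
    using that by (auto simp: mrg_def fun_eq_iff extensional_def restrict_def)
  have m2: "restrict (mrg t s) ?w = s" if "s \<in> extensional ?w" for t s
    using that w by (auto simp: mrg_def fun_eq_iff extensional_def restrict_def)
  have mz: "mrg (restrict z ?A) s = mrg z s" for z s by (auto simp: mrg_def fun_eq_iff)
  have "blk.dest_false S = measure_pmf.expectation R (\<lambda>\<omega>. measure_pmf.expectation (Pi_pmf ?w undefined \<rho>)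
      (\<lambda>s. of_bool (accd (mrg (zb \<omega>) s) (ob N \<omega>))))"
    unfolding blk.dest_false_def expectation_P_Wb ob_yb mrg_def ..
  also have "\<dots> = measure_pmf.expectation R (\<lambda>\<omega>. measure_pmf.expectation (Pi_pmf ?w undefined \<rho>)
      (\<lambda>s. of_bool ((\<lambda>(t, v) s. accd (mrg t s) v) ((\<lambda>\<omega>. (restrict (zb \<omega>) ?A, ob N \<omega>)) \<omega>) s)))"
    by (simp add: mz)
  also have "\<dots> \<le> 1 / 2 powr gD S"
  proof (rule packing_bound[where m = "\<lambda>((t, v), s). (mrg t s, v)" and
          Acc = "\<lambda>(t, v) s. accd (mrg t s) v" and t = "\<lambda>\<omega>. (restrict (zb \<omega>) ?A, ob N \<omega>)" and
          V = "map_pmf (\<lambda>\<omega>. (zb \<omega>, ob N \<omega>)) R"])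
    let ?D = "(\<lambda>\<omega>. (restrict (zb \<omega>) ?A, ob N \<omega>)) ` set_pmf R \<times> set_pmf (Pi_pmf ?w undefined \<rho>)"
    show "inj_on (\<lambda>((t, v), s). (mrg t s, v)) ?D"
    proof (rule inj_onI)
      fix a b assume ab: "a \<in> ?D" "b \<in> ?D" "(\<lambda>((t, v), s). (mrg t s, v)) a = (\<lambda>((t, v), s). (mrg t s, v)) b"
      obtain t v s where a: "a = ((t, v), s)" by (metis surj_pair)
      obtain t' v' s' where b: "b = ((t', v'), s')" by (metis surj_pair)
      have "t \<in> extensional ?A" "t' \<in> extensional ?A" "s \<in> extensional ?w" "s' \<in> extensional ?w"
        using ab(1,2) s_ext by (auto simp: a b)
      moreover have "mrg t s = mrg t' s'" "v = v'" using ab(3) by (simp_all add: a b)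
      ultimately show "a = b" using m1 m2 by (metis a b)
    qed
    fix u s assume u: "u \<in> (\<lambda>\<omega>. (restrict (zb \<omega>) ?A, ob N \<omega>)) ` set_pmf R" and s: "s \<in> set_pmf (Pi_pmf ?w undefined \<rho>)"
      and "(\<lambda>(t, v) s. accd (mrg t s) v) u s"
    then obtain t v where tv: "u = (t, v)" "t \<in> extensional ?A" "accd (mrg t s) v" by auto
    from tv(3) have "2 powr gD S * ((\<Prod>c\<in>?w. pmf (\<rho> c) (mrg t s c)) *
        pmf (map_pmf (\<lambda>\<omega>. (restrict (zb \<omega>) ?A, ob N \<omega>)) R) (restrict (mrg t s) ?A, v))
      \<le> pmf (map_pmf (\<lambda>\<omega>. (zb \<omega>, ob N \<omega>)) R) (mrg t s, v)"
      using S by (simp add: accd_def)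
    moreover have "(\<Prod>c\<in>?w. pmf (\<rho> c) (mrg t s c)) = pmf (Pi_pmf ?w undefined \<rho>) s"
      using s_ext[OF s] fw w by (auto simp: pmf_Pi extensional_def mrg_def intro!: prod.cong)
    ultimately show "2 powr gD S * (pmf (Pi_pmf ?w undefined \<rho>) s *
        pmf (map_pmf (\<lambda>\<omega>. (restrict (zb \<omega>) ?A, ob N \<omega>)) R) u)
      \<le> pmf (map_pmf (\<lambda>\<omega>. (zb \<omega>, ob N \<omega>)) R) ((\<lambda>((t, v), s). (mrg t s, v)) (u, s))"
      using m1[OF tv(2)] by (simp add: tv(1))
  qed (simp_all add: finite_R finite_set_Pi_pmf fw finite_\<rho>)
  finally show ?thesis .
qed

text \<open>On the support of \<open>R\<close> both sides of the test are products over the letters,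
  so in logarithms it is a lower bound on a sum of densities.\<close>

lemma accI:
  assumes \<omega>: "\<omega> \<in> set_pmf R" and k: "k \<in> {2..N}" and g: "gR k \<le> (\<Sum>i<n. relay_info k (\<omega> i))"
  shows "acc k (zb \<omega> k) (zb \<omega> (N + k)) (ob k \<omega>)"
proof -
  have c: "k \<in> comps N" "N + k \<in> comps N" using k by (auto simp: comps_def)
  have 1: "pmf (map_pmf (\<lambda>\<omega>. (zb \<omega> k, ob k \<omega>)) R) (zb \<omega> k, ob k \<omega>) = (\<Prod>i<n. cond_density (\<lambda>\<omega>. (zc k \<omega>, yc \<omega> k)) (\<omega> i))"
    by (rule pmf_map_R_cond_density[OF \<omega>, where g = "\<lambda>\<omega>. (zb \<omega> k, ob k \<omega>)"]) (auto simp: zb_eq_iff[OF c(1)] ob_eq_iff)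
  have 2: "pmf (map_pmf (\<lambda>\<omega>. (zb \<omega> k, zb \<omega> (N + k), ob k \<omega>)) R) (zb \<omega> k, zb \<omega> (N + k), ob k \<omega>) =
      (\<Prod>i<n. cond_density (\<lambda>\<omega>. (zc k \<omega>, zc (N + k) \<omega>, yc \<omega> k)) (\<omega> i))"
    by (rule pmf_map_R_cond_density[OF \<omega>, where g = "\<lambda>\<omega>. (zb \<omega> k, zb \<omega> (N + k), ob k \<omega>)"])
       (auto simp: zb_eq_iff[OF c(1)] zb_eq_iff[OF c(2)] ob_eq_iff)
  show ?thesis
    unfolding acc_def 1 2 pmf_\<rho>_zb[OF \<omega> c(2)] prod.distrib[symmetric]
    by (rule prod_ge_of_sum_log)
       (use g c \<omega> in \<open>auto simp: relay_info_def intro!: mult_pos_pos cond_density_pos \<rho>l_pos\<close>)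
qed

lemma accdI:
  assumes \<omega>: "\<omega> \<in> set_pmf R" and g: "\<And>S. S \<subseteq> {2..<N} \<Longrightarrow> gD S \<le> (\<Sum>i<n. dest_info S (\<omega> i))"
  shows "accd (zb \<omega>) (ob N \<omega>)"
  unfolding accd_def
proof (intro allI impI)
  fix S assume S: "S \<subseteq> {2..<N}"
  let ?w = "wrong_comps N S"
  let ?A = "comps N - ?w"
  have w: "?w \<subseteq> comps N" by (rule wrong_comps_subset[OF S N2])
  have 1: "pmf (map_pmf (\<lambda>\<omega>. (restrict (zb \<omega>) ?A, ob N \<omega>)) R) (restrict (zb \<omega>) ?A, ob N \<omega>) =
      (\<Prod>i<n. cond_density (\<lambda>\<omega>. (restrict (zl \<omega>) ?A, yc \<omega> N)) (\<omega> i))"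
    by (rule pmf_map_R_cond_density[OF \<omega>, where g = "\<lambda>\<omega>. (restrict (zb \<omega>) ?A, ob N \<omega>)"])
       (auto simp: restrict_zb_eq_iff ob_eq_iff)
  have 2: "pmf (map_pmf (\<lambda>\<omega>. (zb \<omega>, ob N \<omega>)) R) (zb \<omega>, ob N \<omega>) = (\<Prod>i<n. cond_density (\<lambda>\<omega>. (zl \<omega>, yc \<omega> N)) (\<omega> i))"
    by (rule pmf_map_R_cond_density[OF \<omega>, where g = "\<lambda>\<omega>. (zb \<omega>, ob N \<omega>)"])
       (auto simp: zb_eq_iff_all ob_eq_iff)
  have 3: "(\<Prod>c\<in>?w. pmf (\<rho> c) (zb \<omega> c)) = (\<Prod>i<n. \<Prod>c\<in>?w. pmf (\<rho>l c (qof (\<omega> i))) (zc c (\<omega> i)))"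
    by (subst prod.swap, rule prod.cong) (use w pmf_\<rho>_zb[OF \<omega>] in auto)
  show "2 powr gD S * ((\<Prod>c\<in>?w. pmf (\<rho> c) (zb \<omega> c)) *
      pmf (map_pmf (\<lambda>\<omega>. (restrict (zb \<omega>) ?A, ob N \<omega>)) R) (restrict (zb \<omega>) ?A, ob N \<omega>))
    \<le> pmf (map_pmf (\<lambda>\<omega>. (zb \<omega>, ob N \<omega>)) R) (zb \<omega>, ob N \<omega>)"
    unfolding 1 2 3 prod.distrib[symmetric]
  proof (rule prod_ge_of_sum_log)
    show "0 < (\<Prod>c\<in>?w. pmf (\<rho>l c (qof (\<omega> i))) (zc c (\<omega> i))) * cond_density (\<lambda>\<omega>. (restrict (zl \<omega>) ?A, yc \<omega> N)) (\<omega> i)"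
      if "i \<in> {..<n}" for i
      by (intro mult_pos_pos prod_pos cond_density_pos[OF \<omega>] \<rho>l_pos[OF \<omega>]) (use w that in auto)
  qed (use g[OF S] \<omega> in \<open>auto simp: dest_info_def intro!: cond_density_pos\<close>)
qed

lemma GI:
  assumes \<omega>: "\<omega> \<in> set_pmf R" and g: "(\<Sum>i<n. gain_info (\<omega> i)) \<le> gW"
  shows "zb \<omega> \<in> G"
proof -
  have 1: "pmf P (zb \<omega>) = (\<Prod>i<n. cond_density zl (\<omega> i))"
    unfolding P_def by (rule pmf_map_R_cond_density[OF \<omega>]) (rule zb_eq_iff_all)
  have 2: "pmf (Pi_pmf (comps N) undefined \<rho>) (zb \<omega>) = (\<Prod>c\<in>comps N. pmf (\<rho> c) (zb \<omega> c))"
    by (simp add: pmf_Pi zb_def)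
  have 3: "(\<Prod>c\<in>comps N. pmf (\<rho> c) (zb \<omega> c)) = (\<Prod>i<n. \<Prod>c\<in>comps N. pmf (\<rho>l c (qof (\<omega> i))) (zc c (\<omega> i)))"
    by (subst prod.swap, rule prod.cong) (use pmf_\<rho>_zb[OF \<omega>] in auto)
  have pos: "0 < (\<Prod>c\<in>comps N. pmf (\<rho>l c (qof (\<omega> i))) (zc c (\<omega> i)))" if "i < n" for i
    by (intro prod_pos \<rho>l_pos[OF \<omega>]) (use that in auto)
  \<comment> \<open>The inverse ratio is bounded from below, so that
    \<open>prod_ge_of_sum_log\<close> serves for this upper bound too.\<close>
  have "2 powr (- gW) * (\<Prod>i<n. cond_density zl (\<omega> i)) \<le> (\<Prod>i<n. \<Prod>c\<in>comps N. pmf (\<rho>l c (qof (\<omega> i))) (zc c (\<omega> i)))"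
  proof (rule prod_ge_of_sum_log)
    have "(\<Sum>i<n. log 2 ((\<Prod>c\<in>comps N. pmf (\<rho>l c (qof (\<omega> i))) (zc c (\<omega> i))) / cond_density zl (\<omega> i))) = - (\<Sum>i<n. gain_info (\<omega> i))"
      unfolding sum_negf[symmetric]
      by (rule sum.cong) (use pos cond_density_pos[OF \<omega>] in \<open>auto simp: gain_info_def log_divide\<close>)
    thus "- gW \<le> (\<Sum>i<n. log 2 ((\<Prod>c\<in>comps N. pmf (\<rho>l c (qof (\<omega> i))) (zc c (\<omega> i))) / cond_density zl (\<omega> i)))"
      using g by simp
  qed (use pos cond_density_pos[OF \<omega>] in auto)
  thus ?thesis by (simp add: G_def 1 2 3 powr_minus field_simps)
qed

definition "atyp = {\<omega>. (\<exists>k\<in>{2..N}. (\<Sum>i<n. relay_info k (\<omega> i)) < gR k) \<or>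
   (\<exists>S\<subseteq>{2..<N}. (\<Sum>i<n. dest_info S (\<omega> i)) < gD S) \<or> gW < (\<Sum>i<n. gain_info (\<omega> i))}"

lemma prob_G: "1 - measure_pmf.prob R atyp \<le> measure_pmf.prob P G"
proof -
  have "1 - measure_pmf.prob R atyp = measure_pmf.prob R (- atyp)"
    using measure_pmf.prob_compl[of atyp R] by (simp add: Compl_eq_Diff_UNIV)
  also have "\<dots> \<le> measure_pmf.prob R (zb -` G)"
    by (rule measure_pmf.finite_measure_mono_AE) (auto simp: AE_measure_pmf_iff atyp_def intro!: GI)
  also have "\<dots> = measure_pmf.prob P G" by (simp add: P_def)
  finally show ?thesis .
qed

lemma miss_le: "blk.miss \<le> measure_pmf.prob R atyp"
proof -
  have "blk.miss = measure_pmf.expectation P (\<lambda>z. measure_pmf.expectation (Wb z) (\<lambda>y. of_bool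
      ((\<exists>k\<in>{2..N}. \<not> acc k (z k) (z (N + k)) (\<lambda>i\<in>{..<n}. y i k)) \<or> \<not> accd z (\<lambda>i\<in>{..<n}. y i N))))"
    by (simp add: blk.miss_def prob_eq_expectation)
  also have "\<dots> = measure_pmf.prob R {\<omega>. (\<exists>k\<in>{2..N}. \<not> acc k (zb \<omega> k) (zb \<omega> (N + k)) (ob k \<omega>)) \<or> \<not> accd (zb \<omega>) (ob N \<omega>)}"
    unfolding expectation_P_Wb ob_yb prob_eq_expectation ..
  also have "\<dots> \<le> measure_pmf.prob R atyp"
  proof (rule measure_pmf.finite_measure_mono_AE)
    have "acc k (zb \<omega> k) (zb \<omega> (N + k)) (ob k \<omega>)" if "\<omega> \<in> set_pmf R" "\<omega> \<notin> atyp" "k \<in> {2..N}" for k \<omega>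
      using that accI[OF that(1,3)] by (auto simp: atyp_def not_less)
    moreover have "accd (zb \<omega>) (ob N \<omega>)" if "\<omega> \<in> set_pmf R" "\<omega> \<notin> atyp" for \<omega>
      using that accdI[OF that(1)] by (auto simp: atyp_def not_less)
    ultimately show "AE \<omega> in R. \<omega> \<in> {\<omega>. (\<exists>k\<in>{2..N}. \<not> acc k (zb \<omega> k) (zb \<omega> (N + k)) (ob k \<omega>)) \<or> \<not> accd (zb \<omega>) (ob N \<omega>)}
        \<longrightarrow> \<omega> \<in> atyp"
      unfolding AE_measure_pmf_iff by blast
  qed simp
  finally show ?thesis .
qed

lemma error_bound_le:
  "blk.error_bound \<le> measure_pmf.prob R atyp + (\<Sum>k\<in>{2..N}. L k / 2 powr gR k)
    + (\<Sum>S\<in>Pow {2..<N}. real (L 1 * (\<Prod>k\<in>S. L k)) / 2 powr gD S)"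
proof -
  have "real (L k) * blk.relay_false k \<le> L k / 2 powr gR k" if "k \<in> {2..N}" for k
    using mult_left_mono[OF relay_false_le[OF that], of "L k"] by simp
  moreover have "real (L 1 * (\<Prod>k\<in>S. L k)) * blk.dest_false S \<le> real (L 1 * (\<Prod>k\<in>S. L k)) / 2 powr gD S"
    if "S \<in> Pow {2..<N}" for S
    using mult_left_mono[OF dest_false_le, of S "real (L 1 * (\<Prod>k\<in>S. L k))"] that
    by (simp add: prod_nonneg)
  ultimately show ?thesis unfolding blk.error_bound_def
    by (intro add_mono sum_mono miss_le) auto
qed

end

section \<open>Law of large numbers and choice of rates\<close>

text \<open>Hoeffding's inequality, as finite support bounds \<open>\<phi>\<close>. The 1 in
  \<open>M\<close> keeps the divisor positive.\<close>

lemma weak_law_Pi_pmf: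
  fixes \<phi> :: "'a \<Rightarrow> real"
  assumes fin: "finite (set_pmf r)" and \<delta>: "0 < \<delta>"
  shows "(\<lambda>n::nat. measure_pmf.prob (Pi_pmf {..<n::nat} d (\<lambda>_. r))
     {\<omega>. real n * \<delta> \<le> \<bar>(\<Sum>i<n::nat. \<phi> (\<omega> i)) - real n * measure_pmf.expectation r \<phi>\<bar>}) \<longlonglongrightarrow> 0"
proof -
  define M where "M = 1 + (\<Sum>x\<in>set_pmf r. \<bar>\<phi> x\<bar>)"
  have M: "0 < M" by (simp add: M_def add_pos_nonneg sum_nonneg)
  have bd: "\<bar>\<phi> x\<bar> \<le> M" if "x \<in> set_pmf r" for x
    using member_le_sum[OF that, of "\<lambda>x. \<bar>\<phi> x\<bar>"] fin by (simp add: M_def)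
  have le: "measure_pmf.prob (Pi_pmf {..<n::nat} d (\<lambda>_. r))
     {\<omega>. real n * \<delta> \<le> \<bar>(\<Sum>i<n::nat. \<phi> (\<omega> i)) - real n * measure_pmf.expectation r \<phi>\<bar>} \<le> 2 * exp (- \<delta>\<^sup>2 / (2 * M\<^sup>2) * real n)"
    if n: "0 < n" for n :: nat
  proof -
    let ?R = "Pi_pmf {..<n::nat} d (\<lambda>_. r)"
    have E: "measure_pmf.expectation ?R (\<lambda>\<omega>. \<phi> (\<omega> i)) = measure_pmf.expectation r \<phi>" if "i < n" for i
      using Pi_pmf_component[of "{..<n}" i d "\<lambda>_. r"] that by (metis finite_lessThan integral_map_pmf lessThan_iff)
    interpret Hoeffding_ineq "measure_pmf ?R" "{..<n::nat}" "\<lambda>i \<omega>. \<phi> (\<omega> i)" "\<lambda>_. - M" "\<lambda>_. M"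
        "(\<Sum>i<n::nat. measure_pmf.expectation ?R (\<lambda>\<omega>. \<phi> (\<omega> i)))"
    proof unfold_locales
      show "prob_space.indep_vars (measure_pmf ?R) (\<lambda>_. borel) (\<lambda>i \<omega>. \<phi> (\<omega> i)) {..<n::nat}"
        by (rule prob_space.indep_vars_compose2[OF measure_pmf.prob_space_axioms indep_vars_Pi_pmf]) simp_all
      show "AE \<omega> in ?R. \<phi> (\<omega> i) \<in> {- M..M}" if "i \<in> {..<n::nat}" for i
        using that bd by (force simp: AE_measure_pmf_iff set_Pi_pmf PiE_dflt_def abs_le_iff)
    qed simp_all
    have "measure_pmf.prob ?R {\<omega>. real n * \<delta> \<le> \<bar>(\<Sum>i<n::nat. \<phi> (\<omega> i)) - real n * measure_pmf.expectation r \<phi>\<bar>} \<le>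
      2 * exp (- 2 * (real n * \<delta>)\<^sup>2 / (\<Sum>i<n::nat. (M - (- M))\<^sup>2))"
      using Hoeffding_ineq_abs_ge[of "real n * \<delta>"] \<delta> M n by (simp add: E)
    also have "- 2 * (real n * \<delta>)\<^sup>2 / (\<Sum>i<n::nat. (M - (- M))\<^sup>2) = - \<delta>\<^sup>2 / (2 * M\<^sup>2) * n"
      using n M by (simp add: power2_eq_square field_simps)
    finally show ?thesis .
  qed
  have "(\<lambda>n. 2 * exp (- \<delta>\<^sup>2 / (2 * M\<^sup>2) * real n)) \<longlonglongrightarrow> 0"
  proof -
    define c where "c = \<delta>\<^sup>2 / (2 * M\<^sup>2)"
    have "0 < c" using \<delta> M by (simp add: c_def)
    hence "(\<lambda>n. 2 * exp (- c) ^ n) \<longlonglongrightarrow> 2 * 0"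
      by (intro tendsto_mult tendsto_const LIMSEQ_realpow_zero) auto
    thus ?thesis by (simp add: exp_of_nat_mult[symmetric] c_def mult.commute)
  qed
  moreover have "\<forall>\<^sub>F n::nat in sequentially. norm (measure_pmf.prob (Pi_pmf {..<n::nat} d (\<lambda>_. r))
     {\<omega>. real n * \<delta> \<le> \<bar>(\<Sum>i<n::nat. \<phi> (\<omega> i)) - real n * measure_pmf.expectation r \<phi>\<bar>}) \<le> 2 * exp (- \<delta>\<^sup>2 / (2 * M\<^sup>2) * real n)"
    using eventually_gt_at_top[of "0::nat"] by eventually_elim (use le in auto)
  ultimately show ?thesis by (rule Lim_null_comparison[rotated])
qed

lemma weak_law_family:
  fixes \<phi> :: "'i \<Rightarrow> 'a \<Rightarrow> real"
  assumes fin: "finite (set_pmf r)" and \<delta>: "0 < \<delta>" and I: "finite I"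
  shows "(\<lambda>n::nat. measure_pmf.prob (Pi_pmf {..<n::nat} d (\<lambda>_. r))
     {\<omega>. \<exists>j\<in>I. real n * \<delta> \<le> \<bar>(\<Sum>i<n::nat. \<phi> j (\<omega> i)) - real n * measure_pmf.expectation r (\<phi> j)\<bar>}) \<longlonglongrightarrow> 0"
proof (rule Lim_null_comparison)
  let ?A = "\<lambda>n j. {\<omega>. real n * \<delta> \<le> \<bar>(\<Sum>i<n::nat. \<phi> j (\<omega> i)) - real n * measure_pmf.expectation r (\<phi> j)\<bar>}"
  show "(\<lambda>n. \<Sum>j\<in>I. measure_pmf.prob (Pi_pmf {..<n::nat} d (\<lambda>_. r)) (?A n j)) \<longlonglongrightarrow> 0"
    by (rule tendsto_null_sum) (rule weak_law_Pi_pmf[OF fin \<delta>])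
  have "measure_pmf.prob (Pi_pmf {..<n::nat} d (\<lambda>_. r)) (\<Union>j\<in>I. ?A n j) \<le>
     (\<Sum>j\<in>I. measure_pmf.prob (Pi_pmf {..<n::nat} d (\<lambda>_. r)) (?A n j))" for n
    by (rule measure_pmf.finite_measure_subadditive_finite) (use I in auto)
  moreover have "(\<Union>j\<in>I. ?A n j) = {\<omega>. \<exists>j\<in>I. real n * \<delta> \<le> \<bar>(\<Sum>i<n::nat. \<phi> j (\<omega> i)) - real n * measure_pmf.expectation r (\<phi> j)\<bar>}" for n
    by auto
  ultimately show "\<forall>\<^sub>F n::nat in sequentially. norm (measure_pmf.prob (Pi_pmf {..<n::nat} d (\<lambda>_. r))
     {\<omega>. \<exists>j\<in>I. real n * \<delta> \<le> \<bar>(\<Sum>i<n::nat. \<phi> j (\<omega> i)) - real n * measure_pmf.expectation r (\<phi> j)\<bar>})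
     \<le> (\<Sum>j\<in>I. measure_pmf.prob (Pi_pmf {..<n::nat} d (\<lambda>_. r)) (?A n j))"
    by simp
qed

text \<open>An i.i.d. sequence from the mixture arises by drawing the sequence of q's first, and
  some such sequence does no worse than the average. Thus the law of large numbers is applied to
  identically distributed letters only.\<close>

lemma ex_conditioning_le:
  assumes "finite (set_pmf pQ)" "\<And>q. q \<in> set_pmf pQ \<Longrightarrow> finite (set_pmf (rq q))"
  shows "\<exists>qs. (\<forall>i<n. qs i \<in> set_pmf pQ) \<and>
    measure_pmf.prob (Pi_pmf {..<n} d (\<lambda>i. rq (qs i))) A \<le>
    measure_pmf.prob (Pi_pmf {..<n::nat} d (\<lambda>_. bind_pmf pQ rq)) A"
proof -
  let ?Q = "Pi_pmf {..<n} undefined (\<lambda>_. pQ)"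
  let ?h = "\<lambda>qs. measure_pmf.prob (Pi_pmf {..<n} d (\<lambda>i. rq (qs i))) A"
  have fQ: "finite (set_pmf ?Q)" by (intro finite_set_Pi_pmf assms) simp
  have qs: "qs i \<in> set_pmf pQ" if "qs \<in> set_pmf ?Q" "i < n" for qs i
    using that by (auto simp: set_Pi_pmf PiE_dflt_def)
  have "measure_pmf.prob (Pi_pmf {..<n} d (\<lambda>_. bind_pmf pQ rq)) {\<omega>. \<omega> \<in> A} =
     measure_pmf.expectation (bind_pmf ?Q (\<lambda>qs. Pi_pmf {..<n} d (\<lambda>i. rq (qs i)))) (\<lambda>\<omega>. of_bool (\<omega> \<in> A))"
    unfolding prob_eq_expectation by (subst Pi_pmf_bind[where d' = undefined]) simp_all
  also have "\<dots> = measure_pmf.expectation ?Q (\<lambda>qs. measure_pmf.expectation (Pi_pmf {..<n} d (\<lambda>i. rq (qs i))) (\<lambda>\<omega>. of_bool (\<omega> \<in> A)))"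
    by (rule expectation_bind_finite) (use fQ qs in \<open>auto intro!: finite_set_Pi_pmf assms\<close>)
  also have "\<dots> = measure_pmf.expectation ?Q ?h"
    by (simp flip: prob_eq_expectation)
  finally have "measure_pmf.prob (Pi_pmf {..<n} d (\<lambda>_. bind_pmf pQ rq)) A = measure_pmf.expectation ?Q ?h" by simp
  moreover obtain qs where "qs \<in> set_pmf ?Q" "measure_pmf.expectation ?Q (\<lambda>qs. - ?h qs) \<le> - ?h qs"
    using ex_ge_expectation[OF fQ, of "\<lambda>qs. - ?h qs"] by blast
  ultimately show ?thesis using qs by (intro exI[of _ qs]) simp
qed

section \<open>Passing from one block to a code\<close>

context block_model
begin

text \<open>Condition \<open>card\<close> leaves enough trajectories for the messages after the
  total count is divided by \<open>2 * \<Gamma> ^ B\<close>, with \<open>2 powr gW\<close> as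
  \<open>\<Gamma>\<close>.\<close>

theorem code_from_block:
  assumes f_in: "\<And>k v. k \<in> {1..N} \<Longrightarrow> f k v \<in> \<X> k" and n: "0 < n" "n * B \<le> T"
    and \<eta>: "measure_pmf.prob R atyp + (\<Sum>k\<in>{2..N}. L k / 2 powr gR k)
      + (\<Sum>S\<in>Pow {2..<N}. real (L 1 * (\<Prod>k\<in>S. L k)) / 2 powr gD S) \<le> \<eta>"
    and \<epsilon>: "0 < \<epsilon>" "\<eta> \<le> 1" "B * \<eta> + B * \<eta> / \<epsilon> \<le> 1 / 2"
    and card: "2 * (2 powr gW) ^ B * card (messages Rt T) \<le> (\<Prod>k\<in>{1..N}. real (L k)) ^ (B - 1)"
  shows "\<exists>c. is_code N \<X> \<Y> Rt T c \<and> error_prob N W Rt T c \<le> \<epsilon>"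
proof -
  have nn: "0 \<le> (\<Sum>k\<in>{2..N}. L k / 2 powr gR k)"
      "0 \<le> (\<Sum>S\<in>Pow {2..<N}. real (L 1 * (\<Prod>k\<in>S. L k)) / 2 powr gD S)"
    by (intro sum_nonneg divide_nonneg_nonneg; simp add: prod_nonneg)+
  have \<eta>0: "0 \<le> \<eta>" and pG: "1 - \<eta> \<le> measure_pmf.prob P G" using \<eta> nn prob_G measure_nonneg[of R atyp] by linarith+
  have eb: "blk.error_bound \<le> \<eta>" using error_bound_le \<eta> by linarith
  obtain C where C: "card (blk.traj B) \<le> 2 * (2 powr gW) ^ B * card {\<tau>\<in>blk.traj B. blk.traj_error B \<tau> C \<le> \<epsilon>}"
    using blk.many_good_trajectories[OF pG eb \<epsilon>(1) \<eta>0 \<epsilon>(2,3)] by auto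
  have "2 * (2 powr gW) ^ B * card (messages Rt T) \<le> 2 * (2 powr gW) ^ B * card {\<tau>\<in>blk.traj B. blk.traj_error B \<tau> C \<le> \<epsilon>}"
    using card C by (simp only: blk.card_traj of_nat_power of_nat_prod)
  moreover have "0 < 2 * (2 powr gW :: real) ^ B" by simp
  ultimately have le: "card (messages Rt T) \<le> card {\<tau>\<in>blk.traj B. blk.traj_error B \<tau> C \<le> \<epsilon>}"
    by (simp only: mult_le_cancel_left_pos of_nat_le_iff)
  interpret net: net_code N L \<rho> P W f n acc accd G "2 powr gW" \<X>
    by (intro net_code.intro net_code_axioms.intro blk.block_code_axioms[unfolded Wb_def[abs_def]] f_in n)
  show ?thesis
    by (rule net.code_exists[OF le[unfolded Wb_def[abs_def]] n(2)]) (use \<epsilon> in simp)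
qed

end

section \<open>Choice of rates and lengths\<close>

lemma powr_le_ceiling:
  fixes e :: real
  assumes "0 \<le> e"
  shows "2 powr e \<le> real (nat \<lceil>2 powr e\<rceil>)" "real (nat \<lceil>2 powr e\<rceil>) \<le> 2 * 2 powr e" "1 \<le> nat \<lceil>2 powr e\<rceil>"
proof -
  have 1: "(1::real) \<le> 2 powr e" using assms by (simp add: ge_one_powr_ge_zero)
  show "2 powr e \<le> real (nat \<lceil>2 powr e\<rceil>)" by (rule real_nat_ceiling_ge)
  have "real (nat \<lceil>2 powr e\<rceil>) = of_int \<lceil>2 powr e\<rceil>" using 1 by (intro of_nat_nat) linarith
  also have "\<dots> \<le> 2 powr e + 1" by linarith
  finally show "real (nat \<lceil>2 powr e\<rceil>) \<le> 2 * 2 powr e" using 1 by linarith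
  show "1 \<le> nat \<lceil>2 powr e\<rceil>" using 1 by linarith
qed

lemma card_messages_le: "0 \<le> Rt \<Longrightarrow> real (card (messages Rt T)) \<le> 2 powr (T * Rt + 1)"
proof -
  assume "0 \<le> Rt"
  hence "0 \<le> T * Rt" by simp
  hence "real (nat \<lceil>T * Rt\<rceil>) = of_int \<lceil>T * Rt\<rceil>" by (intro of_nat_nat) linarith
  also have "\<dots> \<le> T * Rt + 1" by linarith
  finally have "2 powr real (nat \<lceil>T * Rt\<rceil>) \<le> 2 powr (T * Rt + 1)" by (intro powr_mono) auto
  thus ?thesis by (simp add: messages_def powr_realpow)
qed

context letter_model
begin

text \<open>The margin 2 in \<open>relay\<close> and \<open>dest\<close> keeps the exponents
  \<open>m k\<close> and \<open>r\<close> positive, because each gives up only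
  \<open>2 * \<delta>\<close>, which is at most 1.\<close>

theorem codes_exist:
  fixes \<X> :: "nat \<Rightarrow> 'x set" and Rt b \<epsilon> :: real
  defines "mean \<equiv> measure_pmf.expectation (bind_pmf pQ rq)"
  assumes f_in: "\<And>k v. k \<in> {1..N} \<Longrightarrow> f k v \<in> \<X> k"
    and relay: "\<And>k. k \<in> {2..N} \<Longrightarrow> 2 < mean (relay_info k)"
    and dest: "\<And>S. S \<subseteq> {2..<N} \<Longrightarrow> 2 < mean (dest_info S) - (\<Sum>k\<in>S. mean (relay_info k))"
    and b: "\<And>S. S \<subseteq> {2..<N} \<Longrightarrow> b \<le> mean (dest_info S) + (\<Sum>k\<in>{2..N} - S. mean (relay_info k)) - mean gain_info"
    and Rt: "0 \<le> Rt" "Rt < b" and \<epsilon>: "0 < \<epsilon>"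
  shows "\<exists>T0. \<forall>T\<ge>T0. \<exists>c. is_code N \<X> \<Y> Rt T c \<and> error_prob N W Rt T c \<le> \<epsilon>"
proof -
  \<comment> \<open>The slacks sum to at most \<open>(2 * N + 1) * \<delta>\<close>: twice
    \<open>\<delta>\<close> for each of the \<open>N\<close> exponents and once for the gain
    threshold. This is at most half of \<open>b - Rt\<close>; the other half is
    \<open>2 * g\<close>.\<close>
  define \<delta> where "\<delta> = min (1 / 2) ((b - Rt) / (2 * (2 * N + 1)))"
  define g where "g = (b - Rt) / 4"
  define m where "m = (\<lambda>k. mean (relay_info k) - 2 * \<delta>)"
  define D where "D = (\<lambda>S. mean (dest_info S))"
  define mW where "mW = mean gain_info"
  \<comment> \<open>Up to slack, the largest exponent for index 1 that lets the destination reject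
    competitors for every set \<open>S\<close> of wrong relays.\<close>
  define r where "r = Min ((\<lambda>S. D S - (\<Sum>k\<in>S. m k)) ` Pow {2..<N}) - 2 * \<delta>"
  define A where "A = r + (\<Sum>k\<in>{2..N}. m k)"
  have \<delta>: "0 < \<delta>" "\<delta> \<le> 1 / 2"
    unfolding \<delta>_def by (use Rt in auto)[1] (rule min.cobounded1)
  have "\<delta> * (2 * N + 1) \<le> (b - Rt) / (2 * (2 * N + 1)) * (2 * N + 1)"
    by (intro mult_right_mono) (auto simp: \<delta>_def)
  also have "\<dots> = (b - Rt) / 2" by (simp add: field_simps)
  finally have \<delta>N: "\<delta> * (2 * N + 1) \<le> (b - Rt) / 2" .
  have g: "0 < g" using Rt by (simp add: g_def)
  have m: "0 < m k" if "k \<in> {2..N}" for k using relay[OF that] \<delta> by (simp add: m_def)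
  have fin: "finite ((\<lambda>S. D S - (\<Sum>k\<in>S. m k)) ` Pow {2..<N})"
    and ne: "(\<lambda>S. D S - (\<Sum>k\<in>S. m k)) ` Pow {2..<N} \<noteq> {}" by auto
  have r_le: "r + (\<Sum>k\<in>S. m k) \<le> D S - 2 * \<delta>" if "S \<subseteq> {2..<N}" for S
  proof -
    have "Min ((\<lambda>S. D S - (\<Sum>k\<in>S. m k)) ` Pow {2..<N}) \<le> D S - (\<Sum>k\<in>S. m k)"
      by (rule Min_le[OF fin]) (use that in blast)
    thus ?thesis by (simp add: r_def)
  qed
  obtain S where S: "S \<subseteq> {2..<N}" and rS: "r = D S - (\<Sum>k\<in>S. m k) - 2 * \<delta>"
    using Min_in[OF fin ne] by (auto simp: r_def)
  have "(\<Sum>k\<in>S. m k) \<le> (\<Sum>k\<in>S. mean (relay_info k))"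
    by (rule sum_mono) (use \<delta> in \<open>simp add: m_def\<close>)
  hence r: "0 < r" using dest[OF S] \<delta> by (simp add: rS D_def)
  have "(\<Sum>k\<in>{2..N} - S. mean (relay_info k)) = (\<Sum>k\<in>{2..N} - S. m k + 2 * \<delta>)" by (simp add: m_def)
  also have "\<dots> = (\<Sum>k\<in>{2..N} - S. m k) + card ({2..N} - S) * (2 * \<delta>)" by (simp add: sum.distrib)
  also have "card ({2..N} - S) * (2 * \<delta>) \<le> (real N - 1) * (2 * \<delta>)"
  proof (rule mult_right_mono)
    have "card ({2..N} - S) \<le> card {2..N}" by (rule card_mono) auto
    thus "real (card ({2..N} - S)) \<le> real N - 1" using N2 by (simp add: of_nat_diff)
  qed (use \<delta> in simp)
  finally have rest: "b + mW - D S - (real N - 1) * (2 * \<delta>) \<le> (\<Sum>k\<in>{2..N} - S. m k)"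
    using b[OF S] unfolding mW_def D_def by linarith
  have split: "(\<Sum>k\<in>{2..N}. m k) = (\<Sum>k\<in>S. m k) + (\<Sum>k\<in>{2..N} - S. m k)"
  proof -
    have "S \<subseteq> {2..N}" using S by auto
    from sum.subset_diff[OF this, of m] show ?thesis by (simp add: add.commute)
  qed
  define c where "c = \<delta> * N"
  have "2 * c + \<delta> \<le> (b - Rt) / 2" using \<delta>N by (simp add: algebra_simps c_def)
  moreover have "b + mW - D S - 2 * c + 2 * \<delta> \<le> (\<Sum>k\<in>{2..N} - S. m k)"
    using rest by (simp add: algebra_simps c_def)
  moreover have "2 * g = (b - Rt) / 2" by (simp add: g_def)
  moreover have "A = D S - 2 * \<delta> + (\<Sum>k\<in>{2..N} - S. m k)" unfolding A_def rS split by simp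
  ultimately have A_ge: "2 * g \<le> A - mW - \<delta> - Rt" by argo
  have "0 \<le> (\<Sum>k\<in>{2..N}. m k)" by (intro sum_nonneg less_imp_le m)
  hence A: "0 < A" using r by (simp add: A_def)
  \<comment> \<open>One \<open>g\<close> per block pays for the exponent \<open>A\<close> lost at
    the fixed end points, as \<open>A \<le> B * g\<close>. The second \<open>g\<close> is kept for
    the roundings in \<open>n0\<close>.\<close>
  define B where "B = nat \<lceil>A / g\<rceil> + 1"
  have B1: "1 \<le> B" by (simp add: B_def)
  have "A / g \<le> real B" unfolding B_def using real_nat_ceiling_ge[of "A / g"] by simp
  hence BA: "A \<le> B * g" using g by (simp add: divide_le_eq)
  define \<eta> where "\<eta> = min 1 (1 / (2 * (B + B / \<epsilon>)))"
  have pos: "0 < B + B / \<epsilon>" using B1 \<epsilon> by (intro add_pos_pos) auto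
  have \<eta>: "0 < \<eta>" "\<eta> \<le> 1" using pos by (auto simp: \<eta>_def)
  have "(B + B / \<epsilon>) * \<eta> \<le> (B + B / \<epsilon>) * (1 / (2 * (B + B / \<epsilon>)))"
    using pos by (intro mult_left_mono) (auto simp: \<eta>_def)
  also have "\<dots> = 1 / 2" using pos by simp
  finally have \<eta>B: "B * \<eta> + B * \<eta> / \<epsilon> \<le> 1 / 2" by (simp add: algebra_simps)
  define I where "I = relay_info ` {2..N} \<union> dest_info ` Pow {2..<N} \<union> {gain_info}"
  define bad where "bad = (\<lambda>n::nat. {\<omega>. \<exists>\<phi>\<in>I. real n * \<delta> \<le> \<bar>(\<Sum>i<n. \<phi> (\<omega> i)) - real n * mean \<phi>\<bar>})"
  define pb where "pb = (\<lambda>n. measure_pmf.prob (Pi_pmf {..<n} undefined (\<lambda>_. bind_pmf pQ rq)) (bad n))"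
  have fin_r: "finite (set_pmf (bind_pmf pQ rq))" using fin_pQ fin_rq by simp
  have lim1: "pb \<longlonglongrightarrow> 0"
    unfolding pb_def bad_def mean_def
    by (rule weak_law_family[OF fin_r \<delta>(1), where I = I and \<phi> = "\<lambda>\<phi>. \<phi>"]) (simp add: I_def)
  have lim2: "(\<lambda>n. (2 powr (- \<delta>)) ^ n) \<longlonglongrightarrow> 0"
    using \<delta> powr_less_mono[of "- \<delta>" 0 2] by (intro LIMSEQ_realpow_zero) auto
  \<comment> \<open>Rounding up costs a factor 2 for each \<open>L k\<close>; the two packing sums
    have at most \<open>N\<close> and \<open>2 ^ N\<close> terms.\<close>
  have "(\<lambda>n. pb n + (2 * real N + 2 ^ N * 2 ^ N) * (2 powr (- \<delta>)) ^ n) \<longlonglongrightarrow> 0 + (2 * real N + 2 ^ N * 2 ^ N) * 0"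
    by (rule tendsto_add[OF lim1 tendsto_mult[OF tendsto_const lim2]])
  hence "\<forall>\<^sub>F n in sequentially. pb n + (2 * real N + 2 ^ N * 2 ^ N) * (2 powr (- \<delta>)) ^ n < \<eta>"
    by (rule order_tendstoD) (use \<eta> in simp)
  then obtain n1 where n1: "\<And>n. n1 \<le> n \<Longrightarrow> pb n + (2 * real N + 2 ^ N * 2 ^ N) * (2 powr (- \<delta>)) ^ n < \<eta>"
    by (auto simp: eventually_sequentially)
  \<comment> \<open>The second entry makes \<open>n * (B * g)\<close> at least
    \<open>2 + B * Rt\<close>, which covers the constants in the counts and the fewer than
    \<open>B\<close> times left over when \<open>B\<close> does not divide \<open>T\<close>.\<close>
  define n0 where "n0 = max n1 (nat \<lceil>(2 + B * Rt) / (B * g)\<rceil> + 1)"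
  show ?thesis
  proof (intro exI[of _ "n0 * B"] allI impI)
    fix T assume T: "n0 * B \<le> T"
    define n where "n = T div B"
    have nB: "n * B \<le> T" by (simp add: n_def)
    have "n0 \<le> n" using div_le_mono[OF T, of B] B1 by (simp add: n_def)
    hence n: "n1 \<le> n" "nat \<lceil>(2 + B * Rt) / (B * g)\<rceil> + 1 \<le> n" by (simp_all add: n0_def)
    have n_pos: "0 < n" using n(2) by simp
    have "T < (n + 1) * B" using B1 by (simp add: n_def dividend_less_div_times add.commute)
    hence "real T \<le> real ((n + 1) * B)" by (intro of_nat_mono) simp
    hence TB: "T * Rt \<le> (n + 1) * B * Rt" using Rt(1) by (intro mult_right_mono) auto
    have "(2 + B * Rt) / (B * g) \<le> real n"
      using n(2) real_nat_ceiling_ge[of "(2 + B * Rt) / (B * g)"] by linarith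
    hence nBg: "2 + B * Rt \<le> n * (B * g)" using B1 g by (simp add: divide_le_eq)
    define L where "L = (\<lambda>k. nat \<lceil>2 powr (n * (if k \<in> {2..N} then m k else r))\<rceil>)"
    have e0: "0 \<le> n * (if k \<in> {2..N} then m k else r)" for k
      using m[of k] r by auto
    have L_lo: "2 powr (n * (if k \<in> {2..N} then m k else r)) \<le> L k"
      and L_hi: "L k \<le> 2 * 2 powr (n * (if k \<in> {2..N} then m k else r))" and L1: "1 \<le> L k" for k
      using powr_le_ceiling[OF e0[of k]] by (simp_all add: L_def)
    obtain qs where qs: "\<And>i. i < n \<Longrightarrow> qs i \<in> set_pmf pQ"
      and qs_le: "measure_pmf.prob (Pi_pmf {..<n} undefined (\<lambda>i. rq (qs i))) (bad n) \<le> pb n"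
      using ex_conditioning_le[where pQ = pQ and rq = rq and n = n and d = undefined and A = "bad n"] fin_pQ fin_rq
      unfolding pb_def by blast
    \<comment> \<open>Thresholds lie \<open>\<delta>\<close> inside the means and the exponents of
      \<open>L\<close> at least \<open>\<delta>\<close> further inside, so both packing sums decay
      like 2 to the -n \<delta>.\<close>
    interpret block_model N pQ rq qof zc yc W f \<rho>l n qs "\<lambda>k. n * (mean (relay_info k) - \<delta>)"
        "\<lambda>S. n * (D S - \<delta>)" "n * (mW + \<delta>)" L undefined
      by unfold_locales (use qs L1 in auto)
    have "atyp \<subseteq> bad n"
    proof
      fix \<omega> assume "\<omega> \<in> atyp"
      then consider k where "k \<in> {2..N}" "(\<Sum>i<n. relay_info k (\<omega> i)) < n * (mean (relay_info k) - \<delta>)"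
        | S where "S \<subseteq> {2..<N}" "(\<Sum>i<n. dest_info S (\<omega> i)) < n * (D S - \<delta>)"
        | "n * (mW + \<delta>) < (\<Sum>i<n. gain_info (\<omega> i))"
        unfolding atyp_def by blast
      thus "\<omega> \<in> bad n"
      proof cases
        case 1
        thus ?thesis unfolding bad_def I_def
          by (intro CollectI bexI[of _ "relay_info k"]) (auto simp: right_diff_distrib)
      next
        case 2
        thus ?thesis unfolding bad_def I_def D_def
          by (intro CollectI bexI[of _ "dest_info S"]) (auto simp: right_diff_distrib)
      next
        case 3
        thus ?thesis unfolding bad_def I_def mW_def
          by (intro CollectI bexI[of _ "gain_info"]) (auto simp: distrib_left)
      qed
    qed
    hence "measure_pmf.prob R atyp \<le> measure_pmf.prob R (bad n)"
      by (rule measure_pmf.finite_measure_mono) simp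
    hence p1: "measure_pmf.prob R atyp \<le> pb n" using qs_le by (simp add: R_def)
    let ?t = "(2 powr (- \<delta>)) ^ n"
    have t: "?t = 2 powr (- (n * \<delta>))" by (simp add: powr_powr powr_realpow[symmetric] mult.commute)
    have p2: "(\<Sum>k\<in>{2..N}. L k / 2 powr (n * (mean (relay_info k) - \<delta>))) \<le> 2 * N * ?t"
    proof -
      have "L k / 2 powr (n * (mean (relay_info k) - \<delta>)) \<le> 2 * ?t" if "k \<in> {2..N}" for k
      proof -
        have "L k \<le> 2 * 2 powr (n * m k)" using L_hi[of k] that by simp
        hence "L k / 2 powr (n * (mean (relay_info k) - \<delta>)) \<le> 2 * 2 powr (n * m k) / 2 powr (n * (mean (relay_info k) - \<delta>))"
          by (rule divide_right_mono) simp
        also have "\<dots> = 2 * 2 powr (n * m k - n * (mean (relay_info k) - \<delta>))" by (simp add: powr_diff)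
        also have "n * m k - n * (mean (relay_info k) - \<delta>) = - (n * \<delta>)" by (simp add: m_def algebra_simps)
        finally show ?thesis by (simp add: t)
      qed
      hence "(\<Sum>k\<in>{2..N}. L k / 2 powr (n * (mean (relay_info k) - \<delta>))) \<le> (\<Sum>k\<in>{2..N}. 2 * ?t)"
        by (rule sum_mono)
      also have "\<dots> \<le> 2 * N * ?t" by (simp add: mult_right_mono)
      finally show ?thesis .
    qed
    have p3: "(\<Sum>S\<in>Pow {2..<N}. real (L 1 * (\<Prod>k\<in>S. L k)) / 2 powr (n * (D S - \<delta>))) \<le> 2 ^ N * 2 ^ N * ?t"
    proof -
      have "real (L 1 * (\<Prod>k\<in>S. L k)) / 2 powr (n * (D S - \<delta>)) \<le> 2 ^ N * ?t" if "S \<in> Pow {2..<N}" for S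
      proof -
        have S: "S \<subseteq> {2..<N}" "finite S" using that finite_subset by auto
        have "(\<Prod>k\<in>S. real (L k)) \<le> (\<Prod>k\<in>S. 2 * 2 powr (n * m k))"
        proof (rule prod_mono)
          fix k assume "k \<in> S"
          hence "k \<in> {2..N}" using S by auto
          thus "0 \<le> real (L k) \<and> real (L k) \<le> 2 * 2 powr (n * m k)" using L_hi[of k] by simp
        qed
        also have "\<dots> = 2 ^ card S * 2 powr (\<Sum>k\<in>S. n * m k)"
          using S(2) by (simp add: prod.distrib powr_sum)
        finally have "real (L 1) * (\<Prod>k\<in>S. real (L k)) \<le> (2 * 2 powr (n * r)) * (2 ^ card S * 2 powr (\<Sum>k\<in>S. n * m k))"
          using L_hi[of 1] by (intro mult_mono prod_nonneg) auto
        also have "\<dots> = 2 ^ (Suc (card S)) * 2 powr (n * (r + (\<Sum>k\<in>S. m k)))"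
          by (simp add: powr_add distrib_left sum_distrib_left)
        also have "\<dots> \<le> 2 ^ N * 2 powr (n * (D S - 2 * \<delta>))"
        proof (rule mult_mono[OF power_increasing powr_mono[OF mult_left_mono[OF r_le[OF S(1)]]]])
          have "card S \<le> card {2..<N}" by (rule card_mono) (use S in auto)
          thus "Suc (card S) \<le> N" using N2 by simp
        qed auto
        finally have "real (L 1 * (\<Prod>k\<in>S. L k)) / 2 powr (n * (D S - \<delta>)) \<le> 2 ^ N * 2 powr (n * (D S - 2 * \<delta>)) / 2 powr (n * (D S - \<delta>))"
          by (intro divide_right_mono) simp_all
        also have "\<dots> = 2 ^ N * 2 powr (n * (D S - 2 * \<delta>) - n * (D S - \<delta>))" by (simp add: powr_diff)
        also have "n * (D S - 2 * \<delta>) - n * (D S - \<delta>) = - (n * \<delta>)" by (simp add: algebra_simps)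
        finally show ?thesis by (simp add: t)
      qed
      hence "(\<Sum>S\<in>Pow {2..<N}. real (L 1 * (\<Prod>k\<in>S. L k)) / 2 powr (n * (D S - \<delta>))) \<le> (\<Sum>S\<in>Pow {2..<N}. 2 ^ N * ?t)"
        by (rule sum_mono)
      also have "\<dots> = 2 ^ (N - 2) * (2 ^ N * ?t)" by (simp add: card_Pow)
      also have "\<dots> \<le> 2 ^ N * (2 ^ N * ?t)" by (intro mult_right_mono power_increasing) auto
      finally show ?thesis by simp
    qed
    have err: "measure_pmf.prob R atyp + (\<Sum>k\<in>{2..N}. L k / 2 powr (n * (mean (relay_info k) - \<delta>)))
      + (\<Sum>S\<in>Pow {2..<N}. real (L 1 * (\<Prod>k\<in>S. L k)) / 2 powr (n * (D S - \<delta>))) \<le> \<eta>"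
      using p1 p2 p3 n1[OF n(1)] by (simp add: distrib_right)
    have "2 * (2 powr (n * (mW + \<delta>))) ^ B * card (messages Rt T) \<le> (\<Prod>k\<in>{1..N}. real (L k)) ^ (B - 1)"
    proof -
      have eq: "(2 powr (n * (mW + \<delta>))) ^ B = 2 powr (n * (mW + \<delta>) * B)"
        using powr_realpow[of "2 powr (n * (mW + \<delta>))" B] by (simp add: powr_powr)
      have "2 * (2 powr (n * (mW + \<delta>))) ^ B * card (messages Rt T)
          \<le> 2 * (2 powr (n * (mW + \<delta>))) ^ B * 2 powr (T * Rt + 1)"
        by (intro mult_left_mono card_messages_le Rt) simp
      also have "\<dots> = 2 powr (2 + n * (mW + \<delta>) * B + T * Rt)"
        unfolding eq by (simp add: powr_add)
      also have "\<dots> \<le> 2 powr (n * A * (B - 1))"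
      proof (rule powr_mono)
        have "n * B * (2 * g) \<le> n * B * (A - mW - \<delta> - Rt)" using A_ge by (intro mult_left_mono) auto
        moreover have "n * A \<le> n * (B * g)" using BA by (intro mult_left_mono) auto
        moreover have "real (B - 1) = real B - 1" using B1 by simp
        ultimately show "2 + n * (mW + \<delta>) * B + T * Rt \<le> n * A * (B - 1)"
          using nBg TB by (simp add: algebra_simps)
      qed simp
      also have "\<dots> = (2 powr (n * A)) ^ (B - 1)"
        using powr_realpow[of "2 powr (n * A)" "B - 1"] by (simp add: powr_powr)
      also have "\<dots> \<le> (\<Prod>k\<in>{1..N}. real (L k)) ^ (B - 1)"
      proof (rule power_mono)
        have "2 powr (n * A) = (\<Prod>k\<in>insert 1 {2..N}. 2 powr (n * (if k \<in> {2..N} then m k else r)))"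
          by (simp add: A_def powr_add distrib_left sum_distrib_left powr_sum)
        also have "\<dots> \<le> (\<Prod>k\<in>insert 1 {2..N}. real (L k))"
          by (intro prod_mono conjI L_lo) auto
        also have "insert 1 {2..N} = {1..N}" using N2 by auto
        finally show "2 powr (n * A) \<le> (\<Prod>k\<in>{1..N}. real (L k))" .
      qed simp
      finally show ?thesis .
    qed
    thus "\<exists>c. is_code N \<X> \<Y> Rt T c \<and> error_prob N W Rt T c \<le> \<epsilon>"
      by (intro code_from_block[OF f_in n_pos nB err \<epsilon> \<eta>(2) \<eta>B]) auto
  qed
qed

end

section \<open>Entropies and the cut-set expression\<close>

definition ent :: "'a pmf \<Rightarrow> ('a \<Rightarrow> 'b) \<Rightarrow> real" where
  "ent r g = - measure_pmf.expectation r (\<lambda>\<omega>. log 2 (pmf (map_pmf g r) (g \<omega>)))"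

lemma pmf_map_at: "pmf (map_pmf g r) (g \<omega>) = measure_pmf.prob r ({\<omega>'. g \<omega>' = g \<omega>} \<inter> set_pmf r)"
  by (simp add: pmf_map vimage_def measure_Int_set_pmf)

lemma pmf_map_at_pos: "\<omega> \<in> set_pmf r \<Longrightarrow> 0 < pmf (map_pmf g r) (g \<omega>)"
  by (auto intro: pmf_positive)

text \<open>Only the partition that \<open>g\<close> induces on the support matters. This handles
  reordering and relabelling of variables below.\<close>

lemma ent_cong:
  assumes "finite (set_pmf r)"
    and "\<And>\<omega> \<omega>'. \<omega> \<in> set_pmf r \<Longrightarrow> \<omega>' \<in> set_pmf r \<Longrightarrow> g \<omega> = g \<omega>' \<longleftrightarrow> g' \<omega> = g' \<omega>'"
  shows "ent r g = ent r g'"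
proof -
  have "pmf (map_pmf g r) (g \<omega>) = pmf (map_pmf g' r) (g' \<omega>)" if "\<omega> \<in> set_pmf r" for \<omega>
  proof -
    have "{\<omega>'. g \<omega>' = g \<omega>} \<inter> set_pmf r = {\<omega>'. g' \<omega>' = g' \<omega>} \<inter> set_pmf r"
      using assms(2) that by auto
    thus ?thesis by (simp add: pmf_map_at)
  qed
  thus ?thesis unfolding ent_def
    by (intro arg_cong[where f = uminus] expectation_cong_finite assms(1)) simp
qed

lemma cond_mutual_info_ent:
  assumes fin: "finite (set_pmf r)"
  shows "cond_mutual_info r X Y Z =
    ent r (\<lambda>\<omega>. (X \<omega>, Z \<omega>)) + ent r (\<lambda>\<omega>. (Y \<omega>, Z \<omega>)) - ent r (\<lambda>\<omega>. (X \<omega>, Y \<omega>, Z \<omega>)) - ent r Z"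
proof -
  let ?g = "\<lambda>\<omega>. (X \<omega>, Y \<omega>, Z \<omega>)"
  let ?A = "\<lambda>\<omega>. pmf (map_pmf ?g r) (?g \<omega>)"
  let ?B = "\<lambda>\<omega>. pmf (map_pmf (\<lambda>\<omega>. (X \<omega>, Z \<omega>)) r) (X \<omega>, Z \<omega>)"
  let ?C = "\<lambda>\<omega>. pmf (map_pmf (\<lambda>\<omega>. (Y \<omega>, Z \<omega>)) r) (Y \<omega>, Z \<omega>)"
  let ?D = "\<lambda>\<omega>. pmf (map_pmf Z r) (Z \<omega>)"
  define F where "F = (\<lambda>(x, y, z). log 2 (pmf (map_pmf ?g r) (x, y, z) /
     (pmf (map_pmf (\<lambda>\<omega>. (X \<omega>, Z \<omega>)) r) (x, z) * (pmf (map_pmf (\<lambda>\<omega>. (Y \<omega>, Z \<omega>)) r) (y, z) / pmf (map_pmf Z r) z))))"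
  have "cond_mutual_info r X Y Z = (\<Sum>t\<in>set_pmf (map_pmf ?g r). pmf (map_pmf ?g r) t * F t)"
    unfolding cond_mutual_info_eq[OF fin] by (simp add: F_def case_prod_unfold)
  also have "\<dots> = measure_pmf.expectation (map_pmf ?g r) F"
    by (rule expectation_finite_sum[symmetric]) (use fin in simp)
  also have "\<dots> = measure_pmf.expectation r (\<lambda>\<omega>. F (?g \<omega>))" by simp
  also have "\<dots> = measure_pmf.expectation r (\<lambda>\<omega>. log 2 (?A \<omega>) - log 2 (?B \<omega>) - (log 2 (?C \<omega>) - log 2 (?D \<omega>)))"
  proof (rule expectation_cong_finite[OF fin])
    fix \<omega> assume \<omega>: "\<omega> \<in> set_pmf r"
    have "0 < ?A \<omega>" "0 < ?B \<omega>" "0 < ?C \<omega>" "0 < ?D \<omega>"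
      using pmf_map_at_pos[OF \<omega>, of ?g] pmf_map_at_pos[OF \<omega>, of "\<lambda>\<omega>. (X \<omega>, Z \<omega>)"]
        pmf_map_at_pos[OF \<omega>, of "\<lambda>\<omega>. (Y \<omega>, Z \<omega>)"] pmf_map_at_pos[OF \<omega>, of Z] by simp_all
    thus "F (?g \<omega>) = log 2 (?A \<omega>) - log 2 (?B \<omega>) - (log 2 (?C \<omega>) - log 2 (?D \<omega>))"
      by (simp add: F_def log_divide_pos log_mult_pos)
  qed
  also have "\<dots> = measure_pmf.expectation r (\<lambda>\<omega>. log 2 (?A \<omega>)) - measure_pmf.expectation r (\<lambda>\<omega>. log 2 (?B \<omega>))
     - (measure_pmf.expectation r (\<lambda>\<omega>. log 2 (?C \<omega>)) - measure_pmf.expectation r (\<lambda>\<omega>. log 2 (?D \<omega>)))"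
    by (simp only: expectation_diff_finite[OF fin])
  finally show ?thesis by (simp add: ent_def)
qed

text \<open>As \<open>g\<close> determines x through \<open>xof\<close>, the law of y_k given
  \<open>g\<close> is the channel marginal at x, whatever else \<open>g\<close> contains. All such
  \<open>g\<close> therefore gain the same amount, later called \<open>noise k\<close>.\<close>

lemma ent_channel:
  fixes g :: "(nat \<Rightarrow> 'x) \<times> (nat \<Rightarrow> nat) \<times> nat \<Rightarrow> 'b"
  assumes fin: "finite (set_pmf (joint_pmf W p))"
    and xof: "\<And>x u q. (x, u, q) \<in> set_pmf p \<Longrightarrow> xof (g (x, u, q)) = x"
  shows "ent (joint_pmf W p) (\<lambda>(x, u, q, y). (g (x, u, q), y k)) = ent (joint_pmf W p) (\<lambda>(x, u, q, y). g (x, u, q))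
    - measure_pmf.expectation (joint_pmf W p) (\<lambda>(x, u, q, y). log 2 (pmf (map_pmf (\<lambda>y. y k) (W x)) (y k)))"
proof -
  let ?r = "joint_pmf W p"
  let ?G = "\<lambda>(x, u, q, y). (g (x, u, q), y k)" and ?g = "\<lambda>(x, u, q, y). g (x, u, q)"
  have mg: "map_pmf ?g ?r = map_pmf g p"
  proof -
    have "map_pmf ?g ?r = bind_pmf p (\<lambda>s. return_pmf (g s))"
      by (simp add: joint_pmf_def map_bind_pmf map_pmf_comp case_prod_unfold)
    thus ?thesis by (simp add: map_pmf_def)
  qed
  have mG: "map_pmf ?G ?r = bind_pmf (map_pmf g p) (\<lambda>v. map_pmf (Pair v) (map_pmf (\<lambda>y. y k) (W (xof v))))"
    unfolding bind_map_pmf joint_pmf_def map_bind_pmf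
    by (rule bind_pmf_cong) (use xof in \<open>auto simp: map_pmf_comp\<close>)
  have "log 2 (pmf (map_pmf ?G ?r) (?G \<omega>)) = log 2 (pmf (map_pmf ?g ?r) (?g \<omega>)) +
     (\<lambda>(x, u, q, y). log 2 (pmf (map_pmf (\<lambda>y. y k) (W x)) (y k))) \<omega>" if \<omega>: "\<omega> \<in> set_pmf ?r" for \<omega>
  proof -
    obtain x u q y where e: "\<omega> = (x, u, q, y)" by (metis surj_pair)
    have "(x, u, q) \<in> set_pmf p" using \<omega> by (auto simp: e joint_pmf_def)
    hence "pmf (map_pmf ?G ?r) (?G \<omega>) = pmf (map_pmf ?g ?r) (?g \<omega>) * pmf (map_pmf (\<lambda>y. y k) (W x)) (y k)"
      unfolding mG mg by (simp add: e pmf_bind_Pair xof)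
    moreover have "0 < pmf (map_pmf ?G ?r) (?G \<omega>)" "0 < pmf (map_pmf ?g ?r) (?g \<omega>)"
      by (rule pmf_map_at_pos[OF \<omega>])+
    ultimately have "0 < pmf (map_pmf (\<lambda>y. y k) (W x)) (y k)" by (simp add: zero_less_mult_iff)
    thus ?thesis using \<open>0 < pmf (map_pmf ?g ?r) (?g \<omega>)\<close> \<open>pmf (map_pmf ?G ?r) (?G \<omega>) = _\<close>
      by (simp add: e log_mult_pos)
  qed
  hence "measure_pmf.expectation ?r (\<lambda>\<omega>. log 2 (pmf (map_pmf ?G ?r) (?G \<omega>))) =
    measure_pmf.expectation ?r (\<lambda>\<omega>. log 2 (pmf (map_pmf ?g ?r) (?g \<omega>)) +
     (\<lambda>(x, u, q, y). log 2 (pmf (map_pmf (\<lambda>y. y k) (W x)) (y k))) \<omega>)"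
    by (rule expectation_cong_finite[OF fin])
  thus ?thesis unfolding ent_def expectation_add_finite[OF fin] by linarith
qed

text \<open>With \<open>F\<close> an entropy indexed by sets this is the chain rule in increasing
  order of nodes, and it eliminates the sets S_k^c. The condition on 0 is there because
  \<open>{1..k - 1}\<close> starts at 1.\<close>

lemma sum_telescope_below:
  fixes F :: "nat set \<Rightarrow> real"
  assumes "finite T" "0 \<notin> T"
  shows "(\<Sum>k\<in>T. F (insert k (T \<inter> {1..k - 1})) - F (T \<inter> {1..k - 1})) = F T - F {}"
  using assms
proof (induction T rule: finite_linorder_max_induct)
  case (insert b T)
  have b: "b \<notin> T" using insert.hyps by auto
  have 1: "insert b T \<inter> {1..k - 1} = T \<inter> {1..k - 1}" if "k \<in> T" for k
    using insert.hyps that by force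
  have 2: "insert b T \<inter> {1..b - 1} = T"
  proof -
    have "1 \<le> k \<and> k \<le> b - 1" if "k \<in> T" for k
      using insert.hyps(2) insert.prems that by (cases k) force+
    thus ?thesis using insert.prems by (cases b) auto
  qed
  have "(\<Sum>k\<in>T. F (insert k (insert b T \<inter> {1..k - 1})) - F (insert b T \<inter> {1..k - 1})) =
    (\<Sum>k\<in>T. F (insert k (T \<inter> {1..k - 1})) - F (T \<inter> {1..k - 1}))"
    by (rule sum.cong) (simp_all only: 1)
  also have "\<dots> = F T - F {}" using insert.IH insert.prems by simp
  finally show ?case unfolding sum.insert[OF insert.hyps(1) b] 2 by simp
qed simp

lemma restrict_eq_iff: "restrict f A = restrict g A \<longleftrightarrow> (\<forall>a\<in>A. f a = g a)"
  by (auto simp: fun_eq_iff restrict_def)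

lemma PiE_eq_iff: "f \<in> PiE A B \<Longrightarrow> g \<in> PiE A B \<Longrightarrow> f = g \<longleftrightarrow> (\<forall>a\<in>A. f a = g a)"
  by (auto intro: PiE_ext)

section \<open>The cut-set expression in entropies\<close>

locale ddf_setting =
  fixes N :: nat and \<X> :: "nat \<Rightarrow> 'x set" and \<Y> :: "nat \<Rightarrow> 'y set"
    and W :: "(nat \<Rightarrow> 'x) \<Rightarrow> (nat \<Rightarrow> 'y) pmf" and p :: "((nat \<Rightarrow> 'x) \<times> (nat \<Rightarrow> nat) \<times> nat) pmf"
  assumes N2: "2 \<le> N" and net: "dm_network N \<X> \<Y> W" and p: "p \<in> input_pmfs N \<X>"
begin

abbreviation "r \<equiv> joint_pmf W p"

lemma finite_p: "finite (set_pmf p)"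
proof -
  obtain \<U> \<Q> where "\<forall>k\<in>{2..N}. finite (\<U> k)" "finite \<Q>" "set_pmf p \<subseteq> PiE {1..N} \<X> \<times> PiE {2..N} \<U> \<times> \<Q>"
    using p by (auto simp: input_pmfs_def)
  moreover have "finite (PiE {1..N} \<X>)" using net by (intro finite_PiE) (auto simp: dm_network_def)
  ultimately show ?thesis by (meson finite_PiE finite_SigmaI finite_atLeastAtMost finite_subset)
qed

lemma p_x: "(x, u, q) \<in> set_pmf p \<Longrightarrow> x \<in> PiE {1..N} \<X>"
  using p by (auto simp: input_pmfs_def)

lemma finite_W: "x \<in> PiE {1..N} \<X> \<Longrightarrow> finite (set_pmf (W x))"
  using net unfolding dm_network_def by (meson finite_PiE finite_atLeastAtMost finite_subset)

lemma finite_joint: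
  assumes "set_pmf p' \<subseteq> set_pmf p"
  shows "finite (set_pmf (joint_pmf W p'))"
  using assms finite_subset[OF assms finite_p] finite_W p_x by (fastforce simp: joint_pmf_def)

lemma finite_r: "finite (set_pmf r)" by (rule finite_joint) simp

lemma r_p: "(x, u, q, y) \<in> set_pmf r \<Longrightarrow> (x, u, q) \<in> set_pmf p"
  by (auto simp: joint_pmf_def)

lemma r_x: "(x, u, q, y) \<in> set_pmf r \<Longrightarrow> x \<in> PiE {1..N} \<X>"
  by (rule p_x[OF r_p])

text \<open>Here \<open>hX k\<close> is H(X_k|Q), \<open>hU k\<close> is H(U_k|X_k,Y_k,Q) and
  \<open>noise k\<close> is H(Y_k|X^N), while \<open>hT\<close> and \<open>hUx\<close> are joint
  entropies including Q.\<close>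

definition "hq = ent r (\<lambda>(x, u, q, y). q)"
definition "hX k = ent r (\<lambda>(x, u, q, y). (x k, q)) - hq"
definition "hU k = ent r (\<lambda>(x, u, q, y). (u k, x k, y k, q)) - ent r (\<lambda>(x, u, q, y). (x k, y k, q))"
definition "hT T = ent r (\<lambda>(x, u, q, y). (restrict u T, restrict x T, y N, q))"
definition "noise k = - measure_pmf.expectation r (\<lambda>(x, u, q, y). log 2 (pmf (map_pmf (\<lambda>y. y k) (W x)) (y k)))"
definition "hUx A = ent r (\<lambda>(x, u, q, y). (restrict u A, x, q))"

lemmas ent_eq = ent_cong[OF finite_r]

lemma ent_noise:
  assumes "\<And>x u q. (x, u, q) \<in> set_pmf p \<Longrightarrow> xof (g (x, u, q)) = x"
  shows "ent r (\<lambda>(x, u, q, y). (g (x, u, q), y k)) = ent r (\<lambda>(x, u, q, y). g (x, u, q)) + noise k"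
  using ent_channel[where W = W and p = p and g = g and xof = xof and k = k, OF finite_r assms] by (simp add: noise_def)

lemma hUx_noise: "ent r (\<lambda>(x, u, q, y). ((restrict u A, x, q), y k)) = hUx A + noise k"
  unfolding hUx_def
  using ent_noise[of "\<lambda>(v, x, q). x" "\<lambda>(x, u, q). (restrict u A, x, q)" k] by simp

lemma x_eq_iff: "(x, u, q, y) \<in> set_pmf r \<Longrightarrow> (x', u', q', y') \<in> set_pmf r \<Longrightarrow>
    x = x' \<longleftrightarrow> (\<forall>k\<in>{1..N}. x k = x' k)"
  by (rule PiE_eq_iff[OF r_x r_x])

text \<open>In entropies the penalty sums telescope along the nodes of \<open>T\<close> and cancel
  joint entropies of the main term; what stays does not depend on the order of the nodes.\<close>

lemma ddf_bound_eq:
  assumes S: "S \<in> cuts N"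
  defines "T \<equiv> {1..N} - S"
  shows "ddf_bound N W p S = hT T - noise N - hq - (\<Sum>k\<in>T. hU k + hX k)"
proof -
  have T: "finite T" "0 \<notin> T" "N \<in> T" "T \<subseteq> {1..N}" "S \<union> T = {1..N}"
    using S by (auto simp: T_def cuts_def)
  have bS: "x = x' \<longleftrightarrow> (\<forall>k\<in>S. x k = x' k) \<and> (\<forall>k\<in>T. x k = x' k)"
    if "(x, u, q, y) \<in> set_pmf r" "(x', u', q', y') \<in> set_pmf r" for x u q y x' u' q' y'
    using x_eq_iff[OF that] T(5) by blast
  define V where "V = (\<lambda>A. ent r (\<lambda>(x, u, q, y). (restrict x A, q)))"
  have A1: "cond_mutual_info r (\<lambda>(x, u, q, y). restrict x S) (\<lambda>(x, u, q, y). (restrict u T, y N))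
     (\<lambda>(x, u, q, y). (restrict x T, q)) = hUx {} + hT T - (hUx T + noise N) - V T"
  proof -
    have "ent r (\<lambda>\<omega>. ((\<lambda>(x, u, q, y). restrict x S) \<omega>, (\<lambda>(x, u, q, y). (restrict x T, q)) \<omega>)) = hUx {}"
      unfolding hUx_def by (rule ent_eq) (auto simp: restrict_eq_iff bS)
    moreover have "ent r (\<lambda>\<omega>. ((\<lambda>(x, u, q, y). (restrict u T, y N)) \<omega>, (\<lambda>(x, u, q, y). (restrict x T, q)) \<omega>)) = hT T"
      unfolding hT_def by (rule ent_eq) auto
    moreover have "ent r (\<lambda>\<omega>. ((\<lambda>(x, u, q, y). restrict x S) \<omega>, (\<lambda>(x, u, q, y). (restrict u T, y N)) \<omega>,
        (\<lambda>(x, u, q, y). (restrict x T, q)) \<omega>)) = hUx T + noise N"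
      unfolding hUx_noise[symmetric] by (rule ent_eq) (auto simp: restrict_eq_iff bS)
    ultimately show ?thesis unfolding cond_mutual_info_ent[OF finite_r] V_def by simp
  qed
  have A2: "cond_mutual_info r (\<lambda>(x, u, q, y). u k) (\<lambda>(x, u, q, y). (restrict u A, x)) (\<lambda>(x, u, q, y). (x k, y k, q))
     = hU k - (hUx (insert k A) - hUx A)" for k A
  proof -
    have "ent r (\<lambda>\<omega>. ((\<lambda>(x, u, q, y). u k) \<omega>, (\<lambda>(x, u, q, y). (x k, y k, q)) \<omega>)) = ent r (\<lambda>(x, u, q, y). (u k, x k, y k, q))"
      by (rule ent_eq) auto
    moreover have "ent r (\<lambda>\<omega>. ((\<lambda>(x, u, q, y). (restrict u A, x)) \<omega>, (\<lambda>(x, u, q, y). (x k, y k, q)) \<omega>)) = hUx A + noise k"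
      unfolding hUx_noise[symmetric] by (rule ent_eq) auto
    moreover have "ent r (\<lambda>\<omega>. ((\<lambda>(x, u, q, y). u k) \<omega>, (\<lambda>(x, u, q, y). (restrict u A, x)) \<omega>, (\<lambda>(x, u, q, y). (x k, y k, q)) \<omega>))
        = hUx (insert k A) + noise k"
      unfolding hUx_noise[symmetric] by (rule ent_eq) (auto simp: restrict_eq_iff)
    ultimately show ?thesis unfolding cond_mutual_info_ent[OF finite_r] hU_def by simp
  qed
  have A3: "cond_mutual_info r (\<lambda>(x, u, q, y). x k) (\<lambda>(x, u, q, y). restrict x A) (\<lambda>(x, u, q, y). q)
     = hX k - (V (insert k A) - V A)" for k A
  proof -
    have "ent r (\<lambda>\<omega>. ((\<lambda>(x, u, q, y). x k) \<omega>, (\<lambda>(x, u, q, y). q) \<omega>)) = hX k + hq"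
      unfolding hX_def by (simp, rule ent_eq) auto
    moreover have "ent r (\<lambda>\<omega>. ((\<lambda>(x, u, q, y). restrict x A) \<omega>, (\<lambda>(x, u, q, y). q) \<omega>)) = V A"
      unfolding V_def by (rule ent_eq) auto
    moreover have "ent r (\<lambda>\<omega>. ((\<lambda>(x, u, q, y). x k) \<omega>, (\<lambda>(x, u, q, y). restrict x A) \<omega>, (\<lambda>(x, u, q, y). q) \<omega>))
        = V (insert k A)"
      unfolding V_def by (rule ent_eq) (auto simp: restrict_eq_iff)
    ultimately show ?thesis unfolding cond_mutual_info_ent[OF finite_r] by (simp add: hq_def)
  qed
  have V0: "V {} = hq" unfolding V_def hq_def by (rule ent_eq) auto
  have "ddf_bound N W p S = hUx {} + hT T - (hUx T + noise N) - V T -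
    (\<Sum>k\<in>T. hU k - (hUx (insert k (T \<inter> {1..k - 1})) - hUx (T \<inter> {1..k - 1})) +
      (hX k - (V (insert k (T \<inter> {1..k - 1})) - V (T \<inter> {1..k - 1}))))"
    unfolding ddf_bound_def Let_def T_def[symmetric] A1 A2 A3 ..
  also have "(\<Sum>k\<in>T. hU k - (hUx (insert k (T \<inter> {1..k - 1})) - hUx (T \<inter> {1..k - 1})) +
      (hX k - (V (insert k (T \<inter> {1..k - 1})) - V (T \<inter> {1..k - 1})))) =
    (\<Sum>k\<in>T. hU k + hX k) - (\<Sum>k\<in>T. hUx (insert k (T \<inter> {1..k - 1})) - hUx (T \<inter> {1..k - 1}))
      - (\<Sum>k\<in>T. V (insert k (T \<inter> {1..k - 1})) - V (T \<inter> {1..k - 1}))"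
    unfolding sum_subtractf[symmetric] by (rule sum.cong) simp_all
  also have "\<dots> = (\<Sum>k\<in>T. hU k + hX k) - (hUx T - hUx {}) - (V T - hq)"
    unfolding sum_telescope_below[OF T(1,2)] V0 ..
  finally show ?thesis by simp
qed

end

section \<open>Means of the information densities\<close>

context letter_model
begin

abbreviation "law \<equiv> bind_pmf pQ rq"

text \<open>Cross entropy of component \<open>c\<close> against its drawing law: its conditional
  entropy given Q when drawn from its own conditional law, \<open>log 2 K\<close> when drawn
  uniformly.\<close>

definition "rate c = - measure_pmf.expectation law (\<lambda>\<omega>. log 2 (pmf (\<rho>l c (qof \<omega>)) (zc c \<omega>)))"

lemma finite_law: "finite (set_pmf law)" using fin_pQ fin_rq by simp

lemma law_qof: "\<omega> \<in> set_pmf law \<Longrightarrow> qof \<omega> \<in> set_pmf pQ \<and> \<omega> \<in> set_pmf (rq (qof \<omega>))"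
  using qof by auto

lemma map_qof_law: "map_pmf qof law = pQ"
proof -
  have "map_pmf qof law = bind_pmf pQ (\<lambda>q. map_pmf qof (rq q))" by (simp add: map_bind_pmf)
  also have "\<dots> = bind_pmf pQ return_pmf"
  proof (rule bind_pmf_cong)
    fix q assume "q \<in> set_pmf pQ"
    hence "map_pmf qof (rq q) = map_pmf (\<lambda>_. q) (rq q)" by (intro map_pmf_cong) (auto simp: qof)
    thus "map_pmf qof (rq q) = return_pmf q" by simp
  qed simp
  finally show ?thesis by (simp add: bind_return_pmf')
qed

lemma map_pair_law: "map_pmf (\<lambda>\<omega>. (qof \<omega>, g \<omega>)) law = bind_pmf pQ (\<lambda>q. map_pmf (Pair q) (map_pmf g (rq q)))"
  unfolding map_bind_pmf map_pmf_comp
  by (intro bind_pmf_cong map_pmf_cong) (auto simp: qof)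

lemma cond_density_pos_law: "\<omega> \<in> set_pmf law \<Longrightarrow> 0 < cond_density g \<omega>"
  using law_qof[of \<omega>] by (auto simp: cond_density_def intro!: pmf_positive)

lemma \<rho>l_pos_law: "\<omega> \<in> set_pmf law \<Longrightarrow> c \<in> comps N \<Longrightarrow> 0 < pmf (\<rho>l c (qof \<omega>)) (zc c \<omega>)"
  using law_qof[of \<omega>] supp_\<rho>l by (auto intro!: pmf_positive)

text \<open>Pointwise p(q, g) = p(q) p(g|q); the value is minus the entropy of \<open>g\<close>
  given Q.\<close>

lemma mean_log_cond_density:
  "measure_pmf.expectation law (\<lambda>\<omega>. log 2 (cond_density g \<omega>)) = ent law qof - ent law (\<lambda>\<omega>. (qof \<omega>, g \<omega>))"
proof -
  let ?G = "\<lambda>\<omega>. (qof \<omega>, g \<omega>)"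
  have "log 2 (cond_density g \<omega>) = log 2 (pmf (map_pmf ?G law) (?G \<omega>)) - log 2 (pmf (map_pmf qof law) (qof \<omega>))"
    if \<omega>: "\<omega> \<in> set_pmf law" for \<omega>
  proof -
    have "pmf (map_pmf ?G law) (?G \<omega>) = pmf (map_pmf qof law) (qof \<omega>) * cond_density g \<omega>"
      unfolding map_pair_law map_qof_law cond_density_def by (rule pmf_bind_Pair)
    thus ?thesis using cond_density_pos_law[OF \<omega>, of g] pmf_map_at_pos[OF \<omega>, of qof] by (simp add: log_mult_pos)
  qed
  hence "measure_pmf.expectation law (\<lambda>\<omega>. log 2 (cond_density g \<omega>)) =
    measure_pmf.expectation law (\<lambda>\<omega>. log 2 (pmf (map_pmf ?G law) (?G \<omega>)) - log 2 (pmf (map_pmf qof law) (qof \<omega>)))"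
    by (rule expectation_cong_finite[OF finite_law])
  thus ?thesis by (simp add: expectation_diff_finite[OF finite_law] ent_def)
qed

lemma mean_relay_info:
  assumes "k \<in> {2..N}"
  shows "measure_pmf.expectation law (relay_info k) = rate (N + k)
    - ent law (\<lambda>\<omega>. (qof \<omega>, zc k \<omega>, zc (N + k) \<omega>, yc \<omega> k)) + ent law (\<lambda>\<omega>. (qof \<omega>, zc k \<omega>, yc \<omega> k))"
proof -
  have c: "N + k \<in> comps N" using assms by (auto simp: comps_def)
  have "measure_pmf.expectation law (relay_info k) = measure_pmf.expectation law
    (\<lambda>\<omega>. log 2 (cond_density (\<lambda>\<omega>. (zc k \<omega>, zc (N + k) \<omega>, yc \<omega> k)) \<omega>) -
      (log 2 (pmf (\<rho>l (N + k) (qof \<omega>)) (zc (N + k) \<omega>)) + log 2 (cond_density (\<lambda>\<omega>. (zc k \<omega>, yc \<omega> k)) \<omega>)))"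
    by (rule expectation_cong_finite[OF finite_law])
       (simp add: relay_info_def log_divide_pos log_mult_pos cond_density_pos_law \<rho>l_pos_law[OF _ c] del: set_bind_pmf)
  thus ?thesis
    by (simp only: expectation_diff_finite[OF finite_law] expectation_add_finite[OF finite_law] mean_log_cond_density rate_def)
qed

lemma log_prod_\<rho>l:
  assumes "\<omega> \<in> set_pmf law" "A \<subseteq> comps N"
  shows "log 2 (\<Prod>c\<in>A. pmf (\<rho>l c (qof \<omega>)) (zc c \<omega>)) = (\<Sum>c\<in>A. log 2 (pmf (\<rho>l c (qof \<omega>)) (zc c \<omega>)))"
    and "0 < (\<Prod>c\<in>A. pmf (\<rho>l c (qof \<omega>)) (zc c \<omega>))"
proof -
  have f: "finite A" using assms(2) finite_comps finite_subset by blast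
  have pos: "0 < pmf (\<rho>l c (qof \<omega>)) (zc c \<omega>)" if "c \<in> A" for c
    using \<rho>l_pos_law[OF assms(1)] that assms(2) by blast
  show "log 2 (\<Prod>c\<in>A. pmf (\<rho>l c (qof \<omega>)) (zc c \<omega>)) = (\<Sum>c\<in>A. log 2 (pmf (\<rho>l c (qof \<omega>)) (zc c \<omega>)))"
    using ln_prod[OF f, of "\<lambda>c. pmf (\<rho>l c (qof \<omega>)) (zc c \<omega>)"] pos
    by (simp add: log_def less_imp_neq[THEN not_sym] sum_divide_distrib)
  show "0 < (\<Prod>c\<in>A. pmf (\<rho>l c (qof \<omega>)) (zc c \<omega>))" by (rule prod_pos) (rule pos)
qed

lemma mean_log_prod_\<rho>l:
  assumes "A \<subseteq> comps N"
  shows "measure_pmf.expectation law (\<lambda>\<omega>. log 2 (\<Prod>c\<in>A. pmf (\<rho>l c (qof \<omega>)) (zc c \<omega>))) = - (\<Sum>c\<in>A. rate c)"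
proof -
  have "measure_pmf.expectation law (\<lambda>\<omega>. log 2 (\<Prod>c\<in>A. pmf (\<rho>l c (qof \<omega>)) (zc c \<omega>))) =
    measure_pmf.expectation law (\<lambda>\<omega>. \<Sum>c\<in>A. log 2 (pmf (\<rho>l c (qof \<omega>)) (zc c \<omega>)))"
    by (rule expectation_cong_finite[OF finite_law]) (rule log_prod_\<rho>l[OF _ assms])
  thus ?thesis by (simp only: expectation_sum_finite[OF finite_law] rate_def sum_negf minus_minus)
qed

lemma mean_dest_info:
  assumes "S \<subseteq> {2..<N}"
  shows "measure_pmf.expectation law (dest_info S) = (\<Sum>c\<in>wrong_comps N S. rate c)
    - ent law (\<lambda>\<omega>. (qof \<omega>, zl \<omega>, yc \<omega> N))
    + ent law (\<lambda>\<omega>. (qof \<omega>, restrict (zl \<omega>) (comps N - wrong_comps N S), yc \<omega> N))"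
proof -
  note w = wrong_comps_subset[OF assms N2]
  have "measure_pmf.expectation law (dest_info S) = measure_pmf.expectation law
    (\<lambda>\<omega>. log 2 (cond_density (\<lambda>\<omega>. (zl \<omega>, yc \<omega> N)) \<omega>) -
      (log 2 (\<Prod>c\<in>wrong_comps N S. pmf (\<rho>l c (qof \<omega>)) (zc c \<omega>)) +
       log 2 (cond_density (\<lambda>\<omega>. (restrict (zl \<omega>) (comps N - wrong_comps N S), yc \<omega> N)) \<omega>)))"
    by (rule expectation_cong_finite[OF finite_law])
       (simp add: dest_info_def log_divide_pos log_mult_pos cond_density_pos_law log_prod_\<rho>l(2)[OF _ w] del: set_bind_pmf)
  thus ?thesis
    by (simp only: expectation_diff_finite[OF finite_law] expectation_add_finite[OF finite_law] mean_log_cond_density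
        mean_log_prod_\<rho>l[OF w])
qed

lemma mean_gain_info:
  "measure_pmf.expectation law gain_info = ent law qof - ent law (\<lambda>\<omega>. (qof \<omega>, zl \<omega>)) + (\<Sum>c\<in>comps N. rate c)"
proof -
  have "measure_pmf.expectation law gain_info = measure_pmf.expectation law
    (\<lambda>\<omega>. log 2 (cond_density zl \<omega>) - log 2 (\<Prod>c\<in>comps N. pmf (\<rho>l c (qof \<omega>)) (zc c \<omega>)))"
    by (rule expectation_cong_finite[OF finite_law])
       (simp add: gain_info_def log_divide_pos cond_density_pos_law log_prod_\<rho>l(2)[OF _ subset_refl] del: set_bind_pmf)
  thus ?thesis
    by (simp only: expectation_diff_finite[OF finite_law] mean_log_cond_density mean_log_prod_\<rho>l[OF subset_refl])
qed

end

text \<open>\<open>K\<close> exceeds the labels of X_1 and of all U_k, so that the uniform law on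
  \<open>{..<K}\<close> covers their values. Natural numbers as labels give all components one
  symbol type.\<close>

locale ddf_letters = ddf_setting N \<X> \<Y> W p
  for N :: nat and \<X> :: "nat \<Rightarrow> 'x set" and \<Y> :: "nat \<Rightarrow> 'y set"
    and W :: "(nat \<Rightarrow> 'x) \<Rightarrow> (nat \<Rightarrow> 'y) pmf" and p :: "((nat \<Rightarrow> 'x) \<times> (nat \<Rightarrow> nat) \<times> nat) pmf" +
  fixes K :: nat
  assumes K: "0 < K" and K_x: "\<And>x. x \<in> \<X> 1 \<Longrightarrow> to_nat_on (\<X> 1) x < K"
    and K_u: "\<And>x u q k. (x, u, q) \<in> set_pmf p \<Longrightarrow> k \<in> {2..N} \<Longrightarrow> u k < K"
begin

definition "pQ = map_pmf (\<lambda>(x, u, q). q) p"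

definition "rq q = joint_pmf W (cond_pmf p {s. snd (snd s) = q})"

definition qof :: "(nat \<Rightarrow> 'x) \<times> (nat \<Rightarrow> nat) \<times> nat \<times> (nat \<Rightarrow> 'y) \<Rightarrow> nat" where
  "qof = (\<lambda>(x, u, q, y). q)"

definition yc :: "(nat \<Rightarrow> 'x) \<times> (nat \<Rightarrow> nat) \<times> nat \<times> (nat \<Rightarrow> 'y) \<Rightarrow> nat \<Rightarrow> 'y" where
  "yc = (\<lambda>(x, u, q, y). y)"

definition zs :: "(nat \<Rightarrow> 'x) \<Rightarrow> (nat \<Rightarrow> nat) \<Rightarrow> nat \<Rightarrow> nat" where
  "zs x u c = (if c \<le> N then to_nat_on (\<X> c) (x c) else u (c - N))"

definition zc :: "nat \<Rightarrow> (nat \<Rightarrow> 'x) \<times> (nat \<Rightarrow> nat) \<times> nat \<times> (nat \<Rightarrow> 'y) \<Rightarrow> nat" where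
  "zc c = (\<lambda>(x, u, q, y). zs x u c)"

text \<open>In the rate balance the drawing costs of x_1 and of the u_k cancel, while that of x_k
  remains as a loss for every k on the destination side of the cut. The conditional marginal makes
  this loss as small as possible, namely H(X_k|Q).\<close>

definition "\<rho>l c q = (if c \<in> {2..N} then map_pmf (zc c) (rq q) else pmf_of_set {..<K})"

lemma cond_nonempty: "q \<in> set_pmf pQ \<Longrightarrow> set_pmf p \<inter> {s. snd (snd s) = q} \<noteq> {}"
  by (force simp: pQ_def)

lemma set_rq: "q \<in> set_pmf pQ \<Longrightarrow> (x, u, q', y) \<in> set_pmf (rq q) \<Longrightarrow> q' = q \<and> (x, u, q') \<in> set_pmf p"
  using set_cond_pmf[OF cond_nonempty] by (auto simp: rq_def joint_pmf_def)

lemma X_fin: "k \<in> {1..N} \<Longrightarrow> finite (\<X> k) \<and> \<X> k \<noteq> {}"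
  using net by (auto simp: dm_network_def)

lemma decode_x:
  assumes "x \<in> PiE {1..N} \<X>"
  shows "(\<lambda>k\<in>{1..N}. from_nat_into (\<X> k) ((\<lambda>c\<in>comps N. zs x u c) k)) = x"
proof
  fix k
  show "(\<lambda>k\<in>{1..N}. from_nat_into (\<X> k) ((\<lambda>c\<in>comps N. zs x u c) k)) k = x k"
  proof (cases "k \<in> {1..N}")
    case True
    hence "x k \<in> \<X> k" "countable (\<X> k)" using assms X_fin countable_finite by blast+
    thus ?thesis using True by (simp add: comps_def zs_def)
  next
    case False
    thus ?thesis using PiE_arb[OF assms False] by (simp only: restrict_apply if_False)
  qed
qed

sublocale letter_model N pQ rq qof zc yc W "\<lambda>k. from_nat_into (\<X> k)" \<rho>l
proof
  show "2 \<le> N" by (rule N2)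
  show "finite (set_pmf pQ)" by (simp add: pQ_def finite_p)
  show fin_rq: "finite (set_pmf (rq q))" if "q \<in> set_pmf pQ" for q
    unfolding rq_def by (rule finite_joint) (use set_cond_pmf[OF cond_nonempty[OF that]] in auto)
  show "qof \<omega> = q" if "q \<in> set_pmf pQ" "\<omega> \<in> set_pmf (rq q)" for q \<omega>
    using set_rq[OF that(1)] that(2) by (cases \<omega>) (auto simp: qof_def)
  show "map_pmf (\<lambda>\<omega>. (\<lambda>c\<in>comps N. zc c \<omega>, yc \<omega>)) (rq q) =
      bind_pmf (map_pmf (\<lambda>\<omega>. \<lambda>c\<in>comps N. zc c \<omega>) (rq q))
       (\<lambda>z. map_pmf (Pair z) (W (\<lambda>k\<in>{1..N}. from_nat_into (\<X> k) (z k))))"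
    if q: "q \<in> set_pmf pQ" for q
  proof -
    let ?c = "cond_pmf p {s. snd (snd s) = q}"
    let ?z = "\<lambda>(x, u, q). \<lambda>c\<in>comps N. zs x u c"
    have "map_pmf (\<lambda>\<omega>. \<lambda>c\<in>comps N. zc c \<omega>) (rq q) = bind_pmf ?c (\<lambda>s. return_pmf (?z s))"
      by (simp add: rq_def joint_pmf_def map_bind_pmf map_pmf_comp case_prod_unfold zc_def)
    hence "bind_pmf (map_pmf (\<lambda>\<omega>. \<lambda>c\<in>comps N. zc c \<omega>) (rq q))
       (\<lambda>z. map_pmf (Pair z) (W (\<lambda>k\<in>{1..N}. from_nat_into (\<X> k) (z k)))) =
      bind_pmf ?c (\<lambda>s. map_pmf (Pair (?z s)) (W (\<lambda>k\<in>{1..N}. from_nat_into (\<X> k) (?z s k))))"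
      by (simp add: bind_assoc_pmf bind_return_pmf)
    also have "\<dots> = bind_pmf ?c (\<lambda>s. map_pmf (Pair (?z s)) (W (fst s)))"
    proof (rule bind_pmf_cong)
      fix s assume "s \<in> set_pmf ?c"
      hence "s \<in> set_pmf p" using set_cond_pmf[OF cond_nonempty[OF q]] by auto
      then obtain x u q' where s: "s = (x, u, q')" "x \<in> PiE {1..N} \<X>" using p_x by (metis surj_pair)
      show "map_pmf (Pair (?z s)) (W (\<lambda>k\<in>{1..N}. from_nat_into (\<X> k) (?z s k))) = map_pmf (Pair (?z s)) (W (fst s))"
        unfolding s(1) prod.case decode_x[OF s(2)] fst_conv ..
    qed simp
    also have "\<dots> = map_pmf (\<lambda>\<omega>. (\<lambda>c\<in>comps N. zc c \<omega>, yc \<omega>)) (rq q)"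
      by (simp add: rq_def joint_pmf_def map_bind_pmf map_pmf_comp case_prod_unfold zc_def yc_def)
    finally show ?thesis ..
  qed
  show "zc c \<omega> \<in> set_pmf (\<rho>l c q)" if q: "q \<in> set_pmf pQ" "\<omega> \<in> set_pmf (rq q)" "c \<in> comps N" for q \<omega> c
  proof (cases "c \<in> {2..N}")
    case True
    thus ?thesis using that by (simp add: \<rho>l_def)
  next
    case False
    obtain x u q' y where \<omega>: "\<omega> = (x, u, q', y)" by (metis surj_pair)
    have s: "(x, u, q') \<in> set_pmf p" using set_rq q \<omega> by blast
    have "zc c \<omega> < K"
    proof (cases "c \<le> N")
      case True
      hence "c = 1" using False that(3) by (auto simp: comps_def)
      moreover have "x 1 \<in> \<X> 1" using p_x[OF s] N2 by auto
      ultimately show ?thesis using True K_x by (simp add: zc_def zs_def \<omega>)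
    next
      case f: False
      hence "c - N \<in> {2..N}" using that(3) by (auto simp: comps_def)
      thus ?thesis using f K_u[OF s] by (simp add: zc_def zs_def \<omega>)
    qed
    thus ?thesis using False K by (auto simp: \<rho>l_def set_pmf_of_set lessThan_empty_iff)
  qed
  show "finite (set_pmf (\<rho>l c q))" if "q \<in> set_pmf pQ" for c q
    using K fin_rq[OF that] by (auto simp: \<rho>l_def set_pmf_of_set lessThan_empty_iff)
  show "finite (set_pmf (W (\<lambda>k\<in>{1..N}. from_nat_into (\<X> k) (z k))))" for z
    by (rule finite_W) (use X_fin in \<open>auto intro: from_nat_into\<close>)
qed

lemma law_eq: "law = r"
proof -
  have "bind_pmf pQ (\<lambda>q. cond_pmf p {s. snd (snd s) = q}) = p"
  proof (rule bind_cond_pmf_cancel)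
    show "set_pmf p \<inter> {s. snd (snd s) = q} \<noteq> {}" if "q \<in> set_pmf pQ" for q
      by (rule cond_nonempty[OF that])
    show "set_pmf pQ \<inter> {q. snd (snd s) = q} \<noteq> {}" if "s \<in> set_pmf p" for s
    proof -
      have "snd (snd s) \<in> set_pmf pQ" using that by (auto simp: pQ_def case_prod_unfold)
      thus ?thesis by auto
    qed
    show "measure_pmf.prob p {s. snd (snd s) = q} = measure_pmf.prob pQ {q'. snd (snd s) = q'}"
      if "snd (snd s) = q" for q s
      using that by (auto simp: pQ_def vimage_def case_prod_unfold intro!: arg_cong[where f = "measure_pmf.prob p"])
  qed
  hence "joint_pmf W p = joint_pmf W (bind_pmf pQ (\<lambda>q. cond_pmf p {s. snd (snd s) = q}))" by simp
  also have "\<dots> = law" unfolding joint_pmf_def rq_def bind_assoc_pmf ..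
  finally show ?thesis ..
qed

section \<open>Identifying the means with entropies of the network\<close>

lemma zc_x:
  assumes "(x, u, q, y) \<in> set_pmf r" "(x', u', q', y') \<in> set_pmf r" "c \<in> {1..N}"
  shows "zc c (x, u, q, y) = zc c (x', u', q', y') \<longleftrightarrow> x c = x' c"
proof -
  have "x c \<in> \<X> c" "x' c \<in> \<X> c" using r_x[OF assms(1)] r_x[OF assms(2)] assms(3) by auto
  moreover have "inj_on (to_nat_on (\<X> c)) (\<X> c)"
    using X_fin[OF assms(3)] by (intro inj_on_to_nat_on countable_finite) simp
  ultimately show ?thesis using assms(3) by (auto simp: zc_def zs_def inj_on_eq_iff)
qed

lemma zc_u: "0 < k \<Longrightarrow> zc (N + k) (x, u, q, y) = u k"
  by (simp add: zc_def zs_def)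

lemma zc_comps:
  assumes "(x, u, q, y) \<in> set_pmf r" "(x', u', q', y') \<in> set_pmf r" "A \<subseteq> {1..N}" "D \<subseteq> {2..N}"
  shows "(\<forall>c\<in>A \<union> (+) N ` D. zc c (x, u, q, y) = zc c (x', u', q', y')) \<longleftrightarrow>
    (\<forall>k\<in>A. x k = x' k) \<and> (\<forall>k\<in>D. u k = u' k)"
proof -
  have "(\<forall>c\<in>A. zc c (x, u, q, y) = zc c (x', u', q', y')) \<longleftrightarrow> (\<forall>k\<in>A. x k = x' k)"
    by (rule ball_cong) (use zc_x[OF assms(1,2)] assms(3) in auto)
  moreover have "(\<forall>k\<in>D. zc (N + k) (x, u, q, y) = zc (N + k) (x', u', q', y')) \<longleftrightarrow> (\<forall>k\<in>D. u k = u' k)"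
    by (rule ball_cong) (use zc_u assms(4) in auto)
  ultimately show ?thesis by blast
qed

lemma comps_eq: "comps N = {1..N} \<union> (+) N ` {2..N}"
proof -
  have "(+) N ` {2..N} = {2 + N..N + N}" by (rule image_add_atLeastAtMost)
  thus ?thesis by (simp add: comps_def mult_2)
qed

lemma comps_minus_wrong:
  assumes "S \<subseteq> {2..<N}"
  shows "comps N - wrong_comps N S = ({2..N} - S) \<union> (+) N ` ({2..N} - S)"
proof -
  have "comps N - wrong_comps N S = ({2..N} - S) \<union> ((+) N ` {2..N} - (+) N ` S)"
    unfolding comps_eq wrong_comps_def using N2 by (auto dest!: subsetD[OF assms])
  also have "(+) N ` {2..N} - (+) N ` S = (+) N ` ({2..N} - S)"
    by (rule image_set_diff[symmetric]) simp
  finally show ?thesis .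
qed

lemma zl_eq:
  assumes "(x, u, q, y) \<in> set_pmf r" "(x', u', q', y') \<in> set_pmf r"
  shows "zl (x, u, q, y) = zl (x', u', q', y') \<longleftrightarrow> x = x' \<and> (\<forall>k\<in>{2..N}. u k = u' k)"
  unfolding zl_def restrict_eq_iff comps_eq x_eq_iff[OF assms]
  by (rule zc_comps[OF assms]) auto

lemma restrict_zl_eq:
  assumes "(x, u, q, y) \<in> set_pmf r" "(x', u', q', y') \<in> set_pmf r" "S \<subseteq> {2..<N}"
  shows "restrict (zl (x, u, q, y)) (comps N - wrong_comps N S) = restrict (zl (x', u', q', y')) (comps N - wrong_comps N S)
    \<longleftrightarrow> (\<forall>k\<in>{2..N} - S. x k = x' k) \<and> (\<forall>k\<in>{2..N} - S. u k = u' k)"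
proof -
  have "restrict (zl (x, u, q, y)) (comps N - wrong_comps N S) = restrict (zl (x', u', q', y')) (comps N - wrong_comps N S)
    \<longleftrightarrow> (\<forall>c\<in>comps N - wrong_comps N S. zc c (x, u, q, y) = zc c (x', u', q', y'))"
    by (auto simp: restrict_eq_iff zl_def)
  also have "\<dots> \<longleftrightarrow> (\<forall>k\<in>{2..N} - S. x k = x' k) \<and> (\<forall>k\<in>{2..N} - S. u k = u' k)"
    unfolding comps_minus_wrong[OF assms(3)] by (rule zc_comps[OF assms(1,2)]) auto
  finally show ?thesis .
qed

lemma ent_qof: "ent r qof = hq" by (simp add: qof_def hq_def)

lemma rate_x: "k \<in> {2..N} \<Longrightarrow> rate k = hX k"
proof -
  assume k: "k \<in> {2..N}"
  have "rate k = - measure_pmf.expectation law (\<lambda>\<omega>. log 2 (cond_density (zc k) \<omega>))"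
    using k by (simp add: rate_def \<rho>l_def cond_density_def)
  also have "\<dots> = ent r (\<lambda>\<omega>. (qof \<omega>, zc k \<omega>)) - hq"
    unfolding mean_log_cond_density unfolding law_eq ent_qof by simp
  also have "ent r (\<lambda>\<omega>. (qof \<omega>, zc k \<omega>)) = ent r (\<lambda>(x, u, q, y). (x k, q))"
    by (rule ent_eq) (use k in \<open>auto simp: qof_def zc_x\<close>)
  finally show ?thesis by (simp add: hX_def)
qed

lemma rate_uniform: "c \<in> comps N \<Longrightarrow> c \<notin> {2..N} \<Longrightarrow> rate c = log 2 K"
proof -
  assume c: "c \<in> comps N" "c \<notin> {2..N}"
  have "rate c = - measure_pmf.expectation law (\<lambda>\<omega>. - log 2 K)"
    unfolding rate_def
  proof (intro arg_cong[where f = uminus] expectation_cong_finite finite_law)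
    fix \<omega> assume "\<omega> \<in> set_pmf law"
    hence "zc c \<omega> \<in> set_pmf (\<rho>l c (qof \<omega>))" using law_qof supp_\<rho>l c(1) by blast
    hence "pmf (\<rho>l c (qof \<omega>)) (zc c \<omega>) = 1 / K"
      using c(2) K by (auto simp: \<rho>l_def set_pmf_of_set lessThan_empty_iff)
    thus "log 2 (pmf (\<rho>l c (qof \<omega>)) (zc c \<omega>)) = - log 2 K" using K by (simp add: log_divide_pos)
  qed
  thus ?thesis by simp
qed

lemma sum_rate_wrong:
  assumes S: "S \<subseteq> {2..N}"
  shows "(\<Sum>c\<in>wrong_comps N S. rate c) = log 2 K + (\<Sum>k\<in>S. hX k + log 2 K)"
proof -
  have fS: "finite S" using S finite_subset by blast
  have d: "1 \<notin> S \<union> (+) N ` S" "S \<inter> (+) N ` S = {}" using N2 by (auto dest!: subsetD[OF S])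
  have "(\<Sum>c\<in>wrong_comps N S. rate c) = rate 1 + ((\<Sum>k\<in>S. rate k) + (\<Sum>k\<in>S. rate (N + k)))"
    unfolding wrong_comps_def using fS d by (simp add: sum.union_disjoint sum.reindex)
  also have "rate 1 = log 2 K" by (rule rate_uniform) (use N2 in \<open>auto simp: comps_def\<close>)
  also have "(\<Sum>k\<in>S. rate k) = (\<Sum>k\<in>S. hX k)" by (rule sum.cong) (use S rate_x in auto)
  also have "(\<Sum>k\<in>S. rate (N + k)) = (\<Sum>k\<in>S. log 2 K)"
    by (intro sum.cong refl rate_uniform) (use S in \<open>auto simp: comps_def\<close>)
  finally show ?thesis by (simp add: sum.distrib)
qed

lemma mean_relay: "k \<in> {2..N} \<Longrightarrow> measure_pmf.expectation law (relay_info k) = log 2 K - hU k"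
proof -
  assume k: "k \<in> {2..N}"
  have "ent r (\<lambda>\<omega>. (qof \<omega>, zc k \<omega>, zc (N + k) \<omega>, yc \<omega> k)) = ent r (\<lambda>(x, u, q, y). (u k, x k, y k, q))"
    by (rule ent_eq) (use k in \<open>auto simp: qof_def yc_def zc_x zc_u\<close>)
  moreover have "ent r (\<lambda>\<omega>. (qof \<omega>, zc k \<omega>, yc \<omega> k)) = ent r (\<lambda>(x, u, q, y). (x k, y k, q))"
    by (rule ent_eq) (use k in \<open>auto simp: qof_def yc_def zc_x\<close>)
  moreover have "rate (N + k) = log 2 K" by (rule rate_uniform) (use k in \<open>auto simp: comps_def\<close>)
  ultimately show ?thesis unfolding mean_relay_info[OF k] unfolding law_eq hU_def by simp
qed

lemma mean_dest:
  assumes S: "S \<subseteq> {2..<N}"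
  shows "measure_pmf.expectation law (dest_info S) = log 2 K + (\<Sum>k\<in>S. hX k + log 2 K)
    - (hUx {2..N} + noise N) + hT ({2..N} - S)"
proof -
  have "ent r (\<lambda>\<omega>. (qof \<omega>, zl \<omega>, yc \<omega> N)) = hUx {2..N} + noise N"
    unfolding hUx_noise[symmetric] by (rule ent_eq) (auto simp: qof_def yc_def zl_eq restrict_eq_iff)
  moreover have "ent r (\<lambda>\<omega>. (qof \<omega>, restrict (zl \<omega>) (comps N - wrong_comps N S), yc \<omega> N)) = hT ({2..N} - S)"
    unfolding hT_def by (rule ent_eq) (auto simp: qof_def yc_def restrict_zl_eq[OF _ _ S] restrict_eq_iff[where A = "{2..N} - S"])
  moreover have "S \<subseteq> {2..N}" using S by auto
  ultimately show ?thesis unfolding mean_dest_info[OF S] unfolding law_eq by (simp add: sum_rate_wrong)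
qed

lemma mean_gain: "measure_pmf.expectation law gain_info =
  hq - hUx {2..N} + log 2 K + (\<Sum>k\<in>{2..N}. hX k + log 2 K)"
proof -
  have "ent r (\<lambda>\<omega>. (qof \<omega>, zl \<omega>)) = hUx {2..N}"
    unfolding hUx_def by (rule ent_eq) (auto simp: qof_def zl_eq restrict_eq_iff)
  moreover have "comps N = wrong_comps N {2..N}" using N2 by (auto simp: comps_eq wrong_comps_def)
  ultimately show ?thesis unfolding mean_gain_info unfolding law_eq ent_qof by (simp add: sum_rate_wrong)
qed

text \<open>\<open>log 2 K\<close> occurs 1 + |S| times in the destination mean, once for each node
  of \<open>{2..N} - S\<close> in the relay means and \<open>N\<close> times in the gain, so it
  cancels. So does H(X_k|Q) for k in \<open>S\<close>, and \<open>ddf_bound_eq\<close> identifies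
  the rest.\<close>

lemma info_balance:
  assumes S: "S \<subseteq> {2..<N}"
  shows "measure_pmf.expectation law (dest_info S) + (\<Sum>k\<in>{2..N} - S. measure_pmf.expectation law (relay_info k))
    - measure_pmf.expectation law gain_info = ddf_bound N W p (insert 1 S)"
proof -
  have cut: "insert 1 S \<in> cuts N" using S N2 by (auto simp: cuts_def)
  have T: "{1..N} - insert 1 S = {2..N} - S" using S by auto
  have S': "S \<subseteq> {2..N}" using S by auto
  have "(\<Sum>k\<in>{2..N}. hX k + log 2 K) = (\<Sum>k\<in>S. hX k + log 2 K) + (\<Sum>k\<in>{2..N} - S. hX k + log 2 K)"
    using sum.subset_diff[OF S', of "\<lambda>k. hX k + log 2 K"] by (simp add: add.commute)
  moreover have "(\<Sum>k\<in>{2..N} - S. measure_pmf.expectation law (relay_info k)) = (\<Sum>k\<in>{2..N} - S. log 2 K - hU k)"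
    by (rule sum.cong) (use mean_relay in auto)
  moreover have "(\<Sum>k\<in>{2..N} - S. hU k + hX k) = (\<Sum>k\<in>{2..N} - S. hX k + log 2 K) - (\<Sum>k\<in>{2..N} - S. log 2 K - hU k)"
    by (simp add: sum_subtractf[symmetric] add.commute)
  ultimately show ?thesis
    unfolding ddf_bound_eq[OF cut] T mean_dest[OF S] mean_gain by simp
qed

end

section \<open>Achievability\<close>

context ddf_setting
begin

lemma ex_alphabet_size:
  "\<exists>K>0. c \<le> log 2 (real K) \<and> ddf_letters N \<X> \<Y> W p K"
proof -
  define A where "A = to_nat_on (\<X> 1) ` \<X> 1 \<union> (\<lambda>((x, u, q), k). u k) ` (set_pmf p \<times> {2..N})"
  have "finite (\<X> 1)" using net N2 by (auto simp: dm_network_def)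
  hence A: "finite A" using finite_p by (auto simp: A_def)
  \<comment> \<open>The first summand exceeds all labels, the second makes the logarithm at least
    \<open>c\<close>.\<close>
  define K where "K = Suc (Max (insert 0 A)) + nat \<lceil>2 powr c\<rceil>"
  have lt: "a < K" if "a \<in> A" for a
  proof -
    have "a \<le> Max (insert 0 A)" by (rule Max_ge) (use A that in auto)
    thus ?thesis unfolding K_def by linarith
  qed
  have K: "0 < K" by (simp add: K_def)
  have "real (nat \<lceil>2 powr c\<rceil>) \<le> real K" unfolding K_def by (intro of_nat_mono le_add2)
  hence "2 powr c \<le> real K" by (rule order_trans[OF real_nat_ceiling_ge])
  hence "c \<le> log 2 (real K)" using K by (simp add: le_log_iff)
  moreover have "ddf_letters N \<X> \<Y> W p K"
  proof
    show "to_nat_on (\<X> 1) x < K" if "x \<in> \<X> 1" for x using that by (intro lt) (auto simp: A_def)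
    show "u k < K" if "(x, u, q) \<in> set_pmf p" "k \<in> {2..N}" for x u q k
      by (rule lt) (use that in \<open>force simp: A_def\<close>)
  qed (rule K)
  ultimately show ?thesis using K by blast
qed

theorem ddf_codes:
  assumes Rt: "0 \<le> Rt" "Rt < (MIN S\<in>cuts N. ddf_bound N W p S)" and \<epsilon>: "0 < \<epsilon>"
  shows "\<exists>T0. \<forall>T\<ge>T0. \<exists>c. is_code N \<X> \<Y> Rt T c \<and> error_prob N W Rt T c \<le> \<epsilon>"
proof -
  \<comment> \<open>By \<open>mean_relay\<close> and \<open>mean_dest\<close> the two positivity
    margins are \<open>log 2 K - hU k\<close> and \<open>log 2 K + h S\<close>. Neither
    \<open>hU\<close> nor \<open>h\<close> involves \<open>K\<close>, so \<open>c\<close> can be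
    fixed before \<open>K\<close>.\<close>
  define h where "h = (\<lambda>S. (\<Sum>k\<in>S. hX k + hU k) - (hUx {2..N} + noise N) + hT ({2..N} - S))"
  define c where "c = 3 + (\<Sum>k\<in>{2..N}. \<bar>hU k\<bar>) + (\<Sum>S\<in>Pow {2..<N}. \<bar>h S\<bar>)"
  obtain K where c: "c \<le> log 2 (real K)" and K: "ddf_letters N \<X> \<Y> W p K"
    using ex_alphabet_size[of c] by blast
  interpret ddf_letters N \<X> \<Y> W p K by (rule K)
  have nn: "0 \<le> (\<Sum>k\<in>{2..N}. \<bar>hU k\<bar>)" "0 \<le> (\<Sum>S\<in>Pow {2..<N}. \<bar>h S\<bar>)"
    by (intro sum_nonneg; simp)+
  have cU: "\<bar>hU k\<bar> + 3 \<le> c" if "k \<in> {2..N}" for k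
  proof -
    have "\<bar>hU k\<bar> \<le> (\<Sum>k\<in>{2..N}. \<bar>hU k\<bar>)" by (rule member_le_sum) (use that in auto)
    thus ?thesis using nn unfolding c_def by linarith
  qed
  have ch: "\<bar>h S\<bar> + 3 \<le> c" if "S \<subseteq> {2..<N}" for S
  proof -
    have "\<bar>h S\<bar> \<le> (\<Sum>S\<in>Pow {2..<N}. \<bar>h S\<bar>)" by (rule member_le_sum) (use that in auto)
    thus ?thesis using nn unfolding c_def by linarith
  qed
  show ?thesis
  proof (rule codes_exist[where b = "MIN S\<in>cuts N. ddf_bound N W p S"])
    show "from_nat_into (\<X> k) v \<in> \<X> k" if "k \<in> {1..N}" for k v
      using X_fin[OF that] by (intro from_nat_into) simp
    show "2 < measure_pmf.expectation law (relay_info k)" if "k \<in> {2..N}" for k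
      using mean_relay[OF that] cU[OF that] c by linarith
    show "2 < measure_pmf.expectation law (dest_info S) - (\<Sum>k\<in>S. measure_pmf.expectation law (relay_info k))"
      if S: "S \<subseteq> {2..<N}" for S
    proof -
      have "(\<Sum>k\<in>S. measure_pmf.expectation law (relay_info k)) = (\<Sum>k\<in>S. log 2 K - hU k)"
        by (rule sum.cong) (use S mean_relay in auto)
      hence "measure_pmf.expectation law (dest_info S) - (\<Sum>k\<in>S. measure_pmf.expectation law (relay_info k)) = log 2 K + h S"
        unfolding mean_dest[OF S] h_def by (simp add: sum.distrib sum_subtractf)
      thus ?thesis using ch[OF S] c by linarith
    qed
    show "(MIN S\<in>cuts N. ddf_bound N W p S) \<le> measure_pmf.expectation law (dest_info S)
      + (\<Sum>k\<in>{2..N} - S. measure_pmf.expectation law (relay_info k)) - measure_pmf.expectation law gain_info"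
      if S: "S \<subseteq> {2..<N}" for S
      unfolding info_balance[OF S]
    proof (rule Min_le)
      have "cuts N \<subseteq> Pow {1..N}" by (auto simp: cuts_def)
      thus "finite (ddf_bound N W p ` cuts N)" using finite_subset by blast
      show "ddf_bound N W p (insert 1 S) \<in> ddf_bound N W p ` cuts N"
        using S N2 by (intro imageI) (auto simp: cuts_def)
    qed
  qed (use Rt \<epsilon> in auto)
qed

end

text \<open>The constant decoder is right at rate zero, where \<open>messages\<close> is a
  singleton; at other rates the code fills the lengths that are too short for a good one.\<close>

lemma ex_code:
  assumes "2 \<le> N" "dm_network N \<X> \<Y> W"
  shows "\<exists>c. is_code N \<X> \<Y> Rt T c \<and> decoder c = (\<lambda>_. Some 1)"
proof -
  have ne: "(SOME x. x \<in> \<X> k) \<in> \<X> k" if "k \<in> {1..N}" for k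
    using assms(2) that by (intro some_in_eq[THEN iffD2]) (auto simp: dm_network_def)
  let ?c = "\<lparr>source_enc = \<lambda>_ _. SOME x. x \<in> \<X> 1, relay_enc = \<lambda>k _. SOME x. x \<in> \<X> k, decoder = \<lambda>_. Some 1\<rparr>"
  have "is_code N \<X> \<Y> Rt T ?c"
    unfolding is_code_def using assms(1) by (auto simp: messages_def intro!: ne)
  thus ?thesis by (intro exI[of _ ?c]) simp
qed

lemma error_prob_nonneg: "0 \<le> error_prob N W Rt T c"
  by (simp add: error_prob_def)

lemma achievable_zero:
  assumes "2 \<le> N" "dm_network N \<X> \<Y> W"
  shows "achievable N \<X> \<Y> W 0"
proof -
  obtain c where c: "\<And>T. is_code N \<X> \<Y> 0 T (c T)" "\<And>T. decoder (c T) = (\<lambda>_. Some 1)"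
    using ex_code[OF assms] by metis
  have "error_prob N W 0 T (c T) = 0" for T
  proof -
    have "messages 0 T = {1}" by (auto simp: messages_def)
    hence "set_pmf (message_estimate N W 0 T (c T)) \<inter> {(m, m'). m' \<noteq> Some m} = {}"
      by (auto simp: message_estimate_def c(2))
    thus ?thesis by (simp add: error_prob_def measure_pmf_zero_iff)
  qed
  thus ?thesis using c(1) by (auto simp: achievable_def intro!: exI[of _ c])
qed

text \<open>A nearly optimal code at each length serves all \<open>\<epsilon>\<close> at once and
  saves a diagonal choice; the slack \<open>1 / Suc T\<close> is there since the infimum may not be
  attained.\<close>

lemma achievableI:
  assumes "2 \<le> N" "dm_network N \<X> \<Y> W" "0 \<le> Rt"
    and ev: "\<And>\<epsilon>. 0 < \<epsilon> \<Longrightarrow> \<exists>T0. \<forall>T\<ge>T0. \<exists>c. is_code N \<X> \<Y> Rt T c \<and> error_prob N W Rt T c \<le> \<epsilon>"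
  shows "achievable N \<X> \<Y> W Rt"
proof -
  define E where "E = (\<lambda>T. error_prob N W Rt T ` {c. is_code N \<X> \<Y> Rt T c})"
  have ne: "E T \<noteq> {}" for T using ex_code[OF assms(1,2)] by (auto simp: E_def)
  have bdd: "bdd_below (E T)" for T by (rule bdd_belowI[of _ 0]) (auto simp: E_def error_prob_nonneg)
  have "\<exists>c. is_code N \<X> \<Y> Rt T c \<and> error_prob N W Rt T c < Inf (E T) + 1 / Suc T" for T
    using cInf_lessD[OF ne, of T "Inf (E T) + 1 / Suc T"] by (auto simp: E_def)
  then obtain c where c: "\<And>T. is_code N \<X> \<Y> Rt T (c T)"
      "\<And>T. error_prob N W Rt T (c T) < Inf (E T) + 1 / Suc T" by metis
  have "(\<lambda>T. error_prob N W Rt T (c T)) \<longlonglongrightarrow> 0"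
  proof (rule LIMSEQ_I)
    fix \<epsilon> :: real assume \<epsilon>: "0 < \<epsilon>"
    obtain T0 where T0: "\<And>T. T0 \<le> T \<Longrightarrow> \<exists>c. is_code N \<X> \<Y> Rt T c \<and> error_prob N W Rt T c \<le> \<epsilon> / 2"
      using ev[of "\<epsilon> / 2"] \<epsilon> by auto
    obtain T1 :: nat where T1: "inverse (Suc T1) < \<epsilon> / 2" using reals_Archimedean[of "\<epsilon> / 2"] \<epsilon> by auto
    show "\<exists>n0. \<forall>T\<ge>n0. norm (error_prob N W Rt T (c T) - 0) < \<epsilon>"
    proof (intro exI[of _ "max T0 T1"] allI impI)
      fix T assume T: "max T0 T1 \<le> T"
      obtain c' where "is_code N \<X> \<Y> Rt T c'" "error_prob N W Rt T c' \<le> \<epsilon> / 2" using T0 T by force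
      hence "Inf (E T) \<le> \<epsilon> / 2" using cInf_lower[OF _ bdd, of "error_prob N W Rt T c'" T] by (auto simp: E_def)
      moreover have "1 / Suc T \<le> inverse (Suc T1)" using T by (simp add: inverse_eq_divide frac_le)
      ultimately show "norm (error_prob N W Rt T (c T) - 0) < \<epsilon>"
        using c(2)[of T] T1 error_prob_nonneg[of N W Rt T "c T"] by simp
    qed
  qed
  thus ?thesis using c(1) assms(3) by (auto simp: achievable_def)
qed

theorem theorem1:
  fixes N :: nat
    and \<X> :: "nat \<Rightarrow> 'x set"
    and \<Y> :: "nat \<Rightarrow> 'y set"
    and W :: "(nat \<Rightarrow> 'x) \<Rightarrow> (nat \<Rightarrow> 'y) pmf"
  assumes "N \<ge> 2"
    and "dm_network N \<X> \<Y> W"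
  shows "capacity N \<X> \<Y> W \<ge> (SUP p \<in> input_pmfs N \<X>. ereal (MIN S \<in> cuts N. ddf_bound N W p S))"
proof (rule SUP_least)
  fix p assume p: "p \<in> input_pmfs N \<X>"
  let ?b = "MIN S \<in> cuts N. ddf_bound N W p S"
  interpret ddf_setting N \<X> \<Y> W p by unfold_locales (use assms p in auto)
  have ach: "ereal Rt \<le> capacity N \<X> \<Y> W" if "achievable N \<X> \<Y> W Rt" for Rt
    unfolding capacity_def by (rule SUP_upper) (use that in simp)
  show "ereal ?b \<le> capacity N \<X> \<Y> W"
  proof (rule dense_le)
    fix z assume z: "z < ereal ?b"
    show "z \<le> capacity N \<X> \<Y> W"
    \<comment> \<open>The bound may be negative while rates are not; rate zero settles that
      case.\<close>
    proof (cases "z \<le> 0")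
      case True
      thus ?thesis using ach[OF achievable_zero[OF assms]] by (simp add: zero_ereal_def)
    next
      case False
      then obtain Rt where Rt: "z = ereal Rt" using z by (cases z) auto
      hence "achievable N \<X> \<Y> W Rt"
        using False z ddf_codes by (intro achievableI assms) auto
      thus ?thesis using ach Rt by simp
    qed
  qed
qed

end
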